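(* Let $(\mathbb{M}^n,g,f,\varphi,\lambda)$ be a Ricci-Hessian type manifold, with associated positive integer $m$; that is, $(\mathbb{M}^n,g)$ is an $n$-dimensional Riemannian manifold, $\varphi,f,\lambda$ are real smooth functions on $\mathbb{M}$ with $f>0$, and $$Ric+\nabla^2\varphi=\lambda g+\frac{m}{f}\nabla^2 f .$$ Then: (1) $$f\,d\varphi\wedge d\lambda=df\wedge\Big[(n+m-2)\,d\lambda+\frac{m}{f}\,d[g(\nabla\varphi,\nabla f)]-d|\nabla\varphi|^2+2\lambda\, d\varphi+d\Delta\varphi\Big];$$ (2) $$df\wedge d\varphi\wedge d\lambda=0.$$
   Context: $Ric$ is the Ricci tensor of $g$, $\nabla$ the Levi-Civita connection (also the gradient), $\nabla^2 u$ the Hessian of a function $u$, and $\Delta u$ the trace of $\nabla^2u$ with respect to $g$. The wedge product of $1$-forms is $\alpha\wedge\beta=\alpha\otimes\beta-\beta\otimes\alpha$. *)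

theory Defs
  imports "HOL-Analysis.Analysis"
begin

section \<open>Smooth functions on open subsets of Euclidean space\<close>

definition partial :: "'n \<Rightarrow> (real^'n \<Rightarrow> real) \<Rightarrow> real^'n \<Rightarrow> real" where
  "partial i h y = frechet_derivative h (at y) (axis i 1)"

text \<open>The next two notions are only meant for open sets \<open>S\<close>, since \<^const>\<open>partial\<close> looks at a full
  neighbourhood of the point.\<close>

primrec Ck_on :: "nat \<Rightarrow> (real^'n) set \<Rightarrow> (real^'n \<Rightarrow> real) \<Rightarrow> bool" where
  "Ck_on 0 S h \<longleftrightarrow> continuous_on S h"
| "Ck_on (Suc k) S h \<longleftrightarrow> h differentiable_on S \<and> (\<forall>i. Ck_on k S (partial i h))"

definition smooth_on :: "(real^'n) set \<Rightarrow> (real^'n \<Rightarrow> real) \<Rightarrow> bool" where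
  "smooth_on S h \<longleftrightarrow> (\<forall>k. Ck_on k S h)"


section \<open>Smooth manifolds\<close>

text \<open>A chart is a pair of its domain \<open>U\<close> and its coordinate map \<open>x\<close>, of which only the values
  on \<open>U\<close> matter. The dimension of the manifold is \<open>CARD('n)\<close>.\<close>

type_synonym ('a, 'n) chart = "'a set \<times> ('a \<Rightarrow> real^'n)"

definition is_chart :: "'a topology \<Rightarrow> ('a, 'n::finite) chart \<Rightarrow> bool" where
  "is_chart M = (\<lambda>(U, x). openin M U \<and> open (x ` U) \<and>
     homeomorphic_map (subtopology M U) (top_of_set (x ` U)) x)"

definition smooth_transition :: "('a, 'n::finite) chart \<Rightarrow> ('a, 'n) chart \<Rightarrow> bool" where
  "smooth_transition = (\<lambda>(U, x) (V, y).
     \<forall>i. smooth_on (x ` (U \<inter> V)) (\<lambda>z. y (inv_into U x z) $ i))"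

locale smooth_manifold =
  fixes M :: "'a topology" and A :: "('a, 'n::finite) chart set"
  assumes Hausdorff: "Hausdorff_space M"
    and second_countable: "second_countable M"
    and charts: "c \<in> A \<Longrightarrow> is_chart M c"
    and cover: "\<Union> (fst ` A) = topspace M"
    and compatible: "c \<in> A \<Longrightarrow> c' \<in> A \<Longrightarrow> smooth_transition c c'"

text \<open>Objects living on an open subset \<open>U\<close> of \<open>M\<close> (functions, vector fields) are total functions
  on the type \<open>'a\<close>; their values outside \<open>U\<close> are irrelevant.\<close>

definition smooth_fun :: "('a, 'n::finite) chart set \<Rightarrow> 'a set \<Rightarrow> ('a \<Rightarrow> real) \<Rightarrow> bool" where
  "smooth_fun A V h \<longleftrightarrow> (\<forall>(U, x)\<in>A. smooth_on (x ` (U \<inter> V)) (h \<circ> inv_into U x))"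

definition smooth_at :: "'a topology \<Rightarrow> ('a, 'n::finite) chart set \<Rightarrow> 'a \<Rightarrow> ('a \<Rightarrow> real) \<Rightarrow> bool" where
  "smooth_at M A p h \<longleftrightarrow> (\<exists>V. openin M V \<and> p \<in> V \<and> smooth_fun A V h)"


section \<open>Tangent vectors, vector fields and exterior products\<close>

text \<open>Tangent vectors at \<open>p\<close> are derivations on the functions that are smooth near \<open>p\<close>. They are
  extended by \<open>0\<close> to all other functions, so that equality of tangent vectors is equality in HOL.
  No separate axiom says that \<open>v h\<close> depends only on the germ of \<open>h\<close> at \<open>p\<close>: the indicator function
  of a neighbourhood of \<open>p\<close> is smooth near \<open>p\<close>, so this follows from the Leibniz rule.\<close>

type_synonym 'a tangent = "('a \<Rightarrow> real) \<Rightarrow> real"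
type_synonym 'a vfield = "'a \<Rightarrow> 'a tangent"

definition tangent_space :: "'a topology \<Rightarrow> ('a, 'n::finite) chart set \<Rightarrow> 'a \<Rightarrow> 'a tangent set" where
  "tangent_space M A p = {v.
     (\<forall>h k a b. smooth_at M A p h \<longrightarrow> smooth_at M A p k \<longrightarrow>
        v (\<lambda>q. a * h q + b * k q) = a * v h + b * v k) \<and>
     (\<forall>h k. smooth_at M A p h \<longrightarrow> smooth_at M A p k \<longrightarrow>
        v (\<lambda>q. h q * k q) = h p * v k + v h * k p) \<and>
     (\<forall>h. \<not> smooth_at M A p h \<longrightarrow> v h = 0)}"

definition vector_field ::
  "'a topology \<Rightarrow> ('a, 'n::finite) chart set \<Rightarrow> 'a set \<Rightarrow> 'a vfield \<Rightarrow> bool" where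
  "vector_field M A U X \<longleftrightarrow>
     (\<forall>p\<in>U. X p \<in> tangent_space M A p) \<and>
     (\<forall>V h. openin M V \<longrightarrow> V \<subseteq> U \<longrightarrow> smooth_fun A V h \<longrightarrow> smooth_fun A V (\<lambda>p. X p h))"

definition lie_bracket ::
  "'a topology \<Rightarrow> ('a, 'n::finite) chart set \<Rightarrow> 'a vfield \<Rightarrow> 'a vfield \<Rightarrow> 'a vfield" where
  "lie_bracket M A X Y = (\<lambda>p h.
     if smooth_at M A p h then X p (\<lambda>q. Y q h) - Y p (\<lambda>q. X q h) else 0)"

definition differential :: "('a \<Rightarrow> real) \<Rightarrow> 'a \<Rightarrow> 'a tangent \<Rightarrow> real" where
  "differential h p v = v h"

definition wedge :: "('v \<Rightarrow> real) \<Rightarrow> ('v \<Rightarrow> real) \<Rightarrow> 'v \<Rightarrow> 'v \<Rightarrow> real" where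
  "wedge \<alpha> \<beta> v w = \<alpha> v * \<beta> w - \<beta> v * \<alpha> w"

text \<open>The product of a covector with an alternating bilinear form. It extends \<^const>\<open>wedge\<close>
  associatively: \<open>wedge2 \<alpha> (wedge \<beta> \<gamma>) u v w\<close> is the determinant of the values of
  \<open>\<alpha>, \<beta>, \<gamma>\<close> on \<open>u, v, w\<close>.\<close>

definition wedge2 :: "('v \<Rightarrow> real) \<Rightarrow> ('v \<Rightarrow> 'v \<Rightarrow> real) \<Rightarrow> 'v \<Rightarrow> 'v \<Rightarrow> 'v \<Rightarrow> real" where
  "wedge2 \<alpha> \<omega> u v w = \<alpha> u * \<omega> v w - \<alpha> v * \<omega> u w + \<alpha> w * \<omega> u v"


section \<open>Riemannian metrics and the Levi-Civita connection\<close>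

locale riemannian_manifold = smooth_manifold M A
  for M :: "'a topology" and A :: "('a, 'n::finite) chart set" +
  fixes g :: "'a \<Rightarrow> 'a tangent \<Rightarrow> 'a tangent \<Rightarrow> real"
  assumes metric_linear: "p \<in> topspace M \<Longrightarrow> u \<in> tangent_space M A p \<Longrightarrow>
      v \<in> tangent_space M A p \<Longrightarrow> w \<in> tangent_space M A p \<Longrightarrow>
      g p (\<lambda>h. a * u h + b * v h) w = a * g p u w + b * g p v w"
    and metric_sym: "p \<in> topspace M \<Longrightarrow> v \<in> tangent_space M A p \<Longrightarrow>
      w \<in> tangent_space M A p \<Longrightarrow> g p v w = g p w v"
    and metric_pos: "p \<in> topspace M \<Longrightarrow> v \<in> tangent_space M A p \<Longrightarrow> v \<noteq> (\<lambda>h. 0) \<Longrightarrow> g p v v > 0"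
    and metric_smooth: "openin M U \<Longrightarrow> vector_field M A U X \<Longrightarrow> vector_field M A U Y \<Longrightarrow>
      smooth_fun A U (\<lambda>p. g p (X p) (Y p))"

text \<open>A connection \<open>D\<close>, where \<open>D X Y\<close> is the covariant derivative of \<open>Y\<close> along \<open>X\<close>, acts on
  vector fields defined on arbitrary open sets. By \<open>conn_local\<close>, applied to open subsets of the
  domains of \<open>X\<close> and \<open>Y\<close>, it is compatible with restriction.\<close>

locale affine_connection = smooth_manifold M A
  for M :: "'a topology" and A :: "('a, 'n::finite) chart set" +
  fixes D :: "'a vfield \<Rightarrow> 'a vfield \<Rightarrow> 'a vfield"
  assumes conn_vector_field: "openin M U \<Longrightarrow> vector_field M A U X \<Longrightarrow> vector_field M A U Y \<Longrightarrow>
      vector_field M A U (D X Y)"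
    and conn_local: "openin M U \<Longrightarrow> vector_field M A U X \<Longrightarrow> vector_field M A U Y \<Longrightarrow>
      (\<And>q. q \<in> U \<Longrightarrow> X' q = X q) \<Longrightarrow> (\<And>q. q \<in> U \<Longrightarrow> Y' q = Y q) \<Longrightarrow> p \<in> U \<Longrightarrow>
      D X' Y' p = D X Y p"
    and conn_add_left: "openin M U \<Longrightarrow> vector_field M A U X \<Longrightarrow> vector_field M A U Y \<Longrightarrow>
      vector_field M A U Z \<Longrightarrow> p \<in> U \<Longrightarrow>
      D (\<lambda>q h. X q h + Y q h) Z p = (\<lambda>h. D X Z p h + D Y Z p h)"
    and conn_scale_left: "openin M U \<Longrightarrow> vector_field M A U X \<Longrightarrow> vector_field M A U Y \<Longrightarrow>
      smooth_fun A U k \<Longrightarrow> p \<in> U \<Longrightarrow>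
      D (\<lambda>q h. k q * X q h) Y p = (\<lambda>h. k p * D X Y p h)"
    and conn_add_right: "openin M U \<Longrightarrow> vector_field M A U X \<Longrightarrow> vector_field M A U Y \<Longrightarrow>
      vector_field M A U Z \<Longrightarrow> p \<in> U \<Longrightarrow>
      D X (\<lambda>q h. Y q h + Z q h) p = (\<lambda>h. D X Y p h + D X Z p h)"
    and conn_leibniz: "openin M U \<Longrightarrow> vector_field M A U X \<Longrightarrow> vector_field M A U Y \<Longrightarrow>
      smooth_fun A U k \<Longrightarrow> p \<in> U \<Longrightarrow>
      D X (\<lambda>q h. k q * Y q h) p = (\<lambda>h. X p k * Y p h + k p * D X Y p h)"

locale levi_civita_connection = riemannian_manifold M A g + affine_connection M A D
  for M :: "'a topology" and A :: "('a, 'n::finite) chart set" and g D +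
  assumes torsion_free: "openin M U \<Longrightarrow> vector_field M A U X \<Longrightarrow> vector_field M A U Y \<Longrightarrow> p \<in> U \<Longrightarrow>
      (\<lambda>h. D X Y p h - D Y X p h) = lie_bracket M A X Y p"
    and metric_compatible: "openin M U \<Longrightarrow> vector_field M A U X \<Longrightarrow> vector_field M A U Y \<Longrightarrow>
      vector_field M A U Z \<Longrightarrow> p \<in> U \<Longrightarrow>
      X p (\<lambda>q. g q (Y q) (Z q)) = g p (D X Y p) (Z p) + g p (Y p) (D X Z p)"


section \<open>Gradient, Hessian, Laplacian and Ricci tensor\<close>

definition gradient :: "'a topology \<Rightarrow> ('a, 'n::finite) chart set \<Rightarrow>
    ('a \<Rightarrow> 'a tangent \<Rightarrow> 'a tangent \<Rightarrow> real) \<Rightarrow> ('a \<Rightarrow> real) \<Rightarrow> 'a vfield" where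
  "gradient M A g h p = (THE v. v \<in> tangent_space M A p \<and>
     (\<forall>w\<in>tangent_space M A p. g p v w = differential h p w))"

text \<open>The trace with respect to \<open>g\<close> of a bilinear form on the tangent space at \<open>p\<close>. An orthonormal
  family indexed by \<open>'n\<close> is a basis, and the result does not depend on which one is chosen.\<close>

definition orthonormal_basis :: "'a topology \<Rightarrow> ('a, 'n::finite) chart set \<Rightarrow>
    ('a \<Rightarrow> 'a tangent \<Rightarrow> 'a tangent \<Rightarrow> real) \<Rightarrow> 'a \<Rightarrow> ('n \<Rightarrow> 'a tangent) \<Rightarrow> bool" where
  "orthonormal_basis M A g p e \<longleftrightarrow> (\<forall>i. e i \<in> tangent_space M A p) \<and>
     (\<forall>i j. g p (e i) (e j) = (if i = j then 1 else 0))"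

definition metric_trace :: "'a topology \<Rightarrow> ('a, 'n::finite) chart set \<Rightarrow>
    ('a \<Rightarrow> 'a tangent \<Rightarrow> 'a tangent \<Rightarrow> real) \<Rightarrow> 'a \<Rightarrow> ('a tangent \<Rightarrow> 'a tangent \<Rightarrow> real) \<Rightarrow> real" where
  "metric_trace M A g p B =
     (let e = (SOME e. orthonormal_basis M A g p e) in \<Sum>i\<in>UNIV. B (e i) (e i))"

text \<open>Tensors are evaluated on tangent vectors at \<open>p\<close> by extending these to vector fields near \<open>p\<close>;
  by tensoriality the choice of the extension does not matter.\<close>

definition extend :: "'a topology \<Rightarrow> ('a, 'n::finite) chart set \<Rightarrow> 'a \<Rightarrow> 'a tangent \<Rightarrow> 'a vfield" where
  "extend M A p v = (SOME X. X p = v \<and> (\<exists>U. openin M U \<and> p \<in> U \<and> vector_field M A U X))"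

definition hessian :: "'a topology \<Rightarrow> ('a, 'n::finite) chart set \<Rightarrow>
    ('a vfield \<Rightarrow> 'a vfield \<Rightarrow> 'a vfield) \<Rightarrow> ('a \<Rightarrow> real) \<Rightarrow> 'a \<Rightarrow> 'a tangent \<Rightarrow> 'a tangent \<Rightarrow> real" where
  "hessian M A D h p v w = (let X = extend M A p v; Y = extend M A p w in
     X p (\<lambda>q. Y q h) - D X Y p h)"

definition laplacian :: "'a topology \<Rightarrow> ('a, 'n::finite) chart set \<Rightarrow>
    ('a \<Rightarrow> 'a tangent \<Rightarrow> 'a tangent \<Rightarrow> real) \<Rightarrow> ('a vfield \<Rightarrow> 'a vfield \<Rightarrow> 'a vfield) \<Rightarrow>
    ('a \<Rightarrow> real) \<Rightarrow> 'a \<Rightarrow> real" where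
  "laplacian M A g D h p = metric_trace M A g p (hessian M A D h p)"

definition curvature :: "'a topology \<Rightarrow> ('a, 'n::finite) chart set \<Rightarrow>
    ('a vfield \<Rightarrow> 'a vfield \<Rightarrow> 'a vfield) \<Rightarrow> 'a vfield \<Rightarrow> 'a vfield \<Rightarrow> 'a vfield \<Rightarrow> 'a vfield" where
  "curvature M A D X Y Z p = (\<lambda>h.
     D X (D Y Z) p h - D Y (D X Z) p h - D (lie_bracket M A X Y) Z p h)"

definition riemann :: "'a topology \<Rightarrow> ('a, 'n::finite) chart set \<Rightarrow>
    ('a vfield \<Rightarrow> 'a vfield \<Rightarrow> 'a vfield) \<Rightarrow> 'a \<Rightarrow> 'a tangent \<Rightarrow> 'a tangent \<Rightarrow> 'a tangent \<Rightarrow> 'a tangent" where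
  "riemann M A D p u v w =
     curvature M A D (extend M A p u) (extend M A p v) (extend M A p w) p"

text \<open>\<open>ricci p v w\<close> is the trace of the endomorphism \<open>u \<mapsto> R(u, v)w\<close>; with this sign round spheres
  have positive Ricci tensor.\<close>

definition ricci :: "'a topology \<Rightarrow> ('a, 'n::finite) chart set \<Rightarrow>
    ('a \<Rightarrow> 'a tangent \<Rightarrow> 'a tangent \<Rightarrow> real) \<Rightarrow> ('a vfield \<Rightarrow> 'a vfield \<Rightarrow> 'a vfield) \<Rightarrow>
    'a \<Rightarrow> 'a tangent \<Rightarrow> 'a tangent \<Rightarrow> real" where
  "ricci M A g D p v w = metric_trace M A g p (\<lambda>u u'. g p (riemann M A D p u v w) u')"


section \<open>Ricci-Hessian type manifolds\<close>

locale ricci_hessian_manifold = levi_civita_connection M A g D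
  for M :: "'a topology" and A :: "('a, 'n::finite) chart set" and g D +
  fixes f \<phi> lam :: "'a \<Rightarrow> real" and m :: nat
  assumes m_pos: "m > 0"
    and f_smooth: "smooth_fun A (topspace M) f"
    and phi_smooth: "smooth_fun A (topspace M) \<phi>"
    and lam_smooth: "smooth_fun A (topspace M) lam"
    and f_pos: "p \<in> topspace M \<Longrightarrow> f p > 0"
    and ricci_hessian: "p \<in> topspace M \<Longrightarrow> v \<in> tangent_space M A p \<Longrightarrow> w \<in> tangent_space M A p \<Longrightarrow>
      ricci M A g D p v w + hessian M A D \<phi> p v w
        = lam p * g p v w + real m / f p * hessian M A D f p v w"

end

theory Submission
  imports Defs
begin

text \<open>The structural equation is traced and its divergence is taken, using the contracted second Bianchi
  identity \<open>div Ric = dR/2\<close> and Bochner's formula \<open>div \<nabla>\<^sup>2h = d\<Delta>h + Ric(\<nabla>h)\<close>. Eliminating the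
  scalar curvature and the Ricci terms gives an equality of one-forms of which one side is
  \<open>m (d(f \<Delta>f + (m - 1) |\<nabla>f|\<^sup>2) + 2 \<lambda> f df)\<close>; its exterior derivative, divided by \<open>2f\<close>, is (1), and
  (2) follows by taking the wedge product with \<open>df\<close>. The identities involving traces are verified one
  point at a time, in an orthonormal frame that is parallel at that point. Tangent
  vectors being derivations, Hadamard's lemma is needed to see that they are spanned by the coordinate
  derivations.\<close>

section \<open>Calculus of smooth functions on open sets\<close>

text \<open>In the divergence the Ricci terms collect to (1 - m) Ric(\<nabla>f) + f
  Ric(\<nabla>\<phi>). Nothing is known about the curvature beyond the structural equation, so they
  are removed by contracting that equation with \<nabla>f and \<nabla>\<phi>, at the price of one
  more factor f; this also produces the coefficient m - 1. The product f \<Delta>f appears because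
  f^2 dR contributes m (f d\<Delta>f - \<Delta>f df), Bochner's formula for f contributes 2m f
  d\<Delta>f on the other side, and the difference m (f d\<Delta>f + \<Delta>f df) is exact. The one
  term that is not closed, 2m \<lambda> f df, has derivative 2m f d\<lambda> \<and> df; it turns n -
  2 into n + m - 2. Differentiating the identity of one-forms requires it on a whole neighbourhood:
  each point is treated in its own frame, and the resulting identity no longer mentions frames.
  Hessian, curvature, trace and gradient are defined through choices (\<open>SOME\<close>,
  \<open>THE\<close>), hence the detour through tensoriality before anything can be computed or seen
  to be smooth.\<close>

lemma partial_cong:
  assumes "open S" "y \<in> S" "\<And>z. z \<in> S \<Longrightarrow> h z = h' z"
  shows "partial i h y = partial i h' y"
proof -
  have "(h has_derivative F) (at y) \<longleftrightarrow> (h' has_derivative F) (at y)" for F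
    using assms by (metis has_derivative_transform_within_open)
  then show ?thesis by (simp add: partial_def frechet_derivative_def)
qed

lemma differentiable_on_open_at:
  "open S \<Longrightarrow> h differentiable_on S \<Longrightarrow> y \<in> S \<Longrightarrow> h differentiable (at y)"
  by (simp add: differentiable_on_eq_differentiable_at)

lemma Ck_on_cong:
  assumes "open S" "\<And>z. z \<in> S \<Longrightarrow> h z = h' z"
  shows "Ck_on k S h \<longleftrightarrow> Ck_on k S h'"
proof -
  have "Ck_on k S h \<Longrightarrow> (\<And>z. z \<in> S \<Longrightarrow> h z = h' z) \<Longrightarrow> Ck_on k S h'" for h h'
  proof (induction k arbitrary: h h')
    case 0
    then show ?case by (metis Ck_on.simps(1) continuous_on_cong)
  next
    case (Suc k)
    have "h' differentiable_on S"
      using Suc.prems by (auto simp: differentiable_on_def intro: differentiable_transform_within[where d = 1])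
    moreover have "Ck_on k S (partial i h')" for i
      using Suc.prems Suc.IH[of "partial i h" "partial i h'"]
        partial_cong[OF assms(1), of _ h h'] by simp
    ultimately show ?case by simp
  qed
  then show ?thesis using assms(2) by metis
qed

lemma Ck_on_SucD: "Ck_on (Suc k) S h \<Longrightarrow> Ck_on k S h"
proof (induction k arbitrary: h)
  case 0
  then show ?case by (simp add: differentiable_imp_continuous_on)
next
  case (Suc k)
  then show ?case by (metis Ck_on.simps(2))
qed

lemma Ck_on_subset: "Ck_on k S h \<Longrightarrow> T \<subseteq> S \<Longrightarrow> Ck_on k T h"
  by (induction k arbitrary: h) (auto intro: continuous_on_subset differentiable_on_subset)

lemma partial_const [simp]: "partial i (\<lambda>y. c) = (\<lambda>y. 0)"
  by (simp add: partial_def fun_eq_iff)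

lemma Ck_on_const: "Ck_on k S (\<lambda>y. c)"
  by (induction k arbitrary: c) (auto simp: continuous_on_const)

lemma partial_eqI: "(h has_derivative H) (at y) \<Longrightarrow> partial i h y = H (axis i 1)"
  unfolding partial_def by (simp add: frechet_derivative_at[symmetric])

lemma partial_add:
  "h differentiable (at y) \<Longrightarrow> k differentiable (at y) \<Longrightarrow>
    partial i (\<lambda>y. h y + k y) y = partial i h y + partial i k y"
  by (rule trans[OF partial_eqI[OF has_derivative_add]])
     (auto simp: frechet_derivative_works partial_def)

lemma partial_mult:
  "h differentiable (at y) \<Longrightarrow> k differentiable (at y) \<Longrightarrow>
    partial i (\<lambda>y. h y * k y) y = h y * partial i k y + partial i h y * k y"
  by (rule trans[OF partial_eqI[OF has_derivative_mult]])
     (auto simp: frechet_derivative_works partial_def)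

lemma Ck_on_add:
  assumes "open S"
  shows "Ck_on k S h \<Longrightarrow> Ck_on k S h' \<Longrightarrow> Ck_on k S (\<lambda>y. h y + h' y)"
proof (induction k arbitrary: h h')
  case 0
  then show ?case by (simp add: continuous_on_add)
next
  case (Suc k)
  have "Ck_on k S (partial i (\<lambda>y. h y + h' y))" for i
    using Suc.prems Suc.IH[of "partial i h" "partial i h'"]
    by (subst Ck_on_cong[OF assms, of _ "\<lambda>y. partial i h y + partial i h' y"])
       (auto simp: partial_add differentiable_on_open_at[OF assms])
  then show ?case using Suc.prems by (simp add: differentiable_on_add)
qed

lemma Ck_on_mult:
  assumes "open S"
  shows "Ck_on k S h \<Longrightarrow> Ck_on k S h' \<Longrightarrow> Ck_on k S (\<lambda>y. h y * h' y)"
proof (induction k arbitrary: h h')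
  case 0
  then show ?case by (simp add: continuous_on_mult)
next
  case (Suc k)
  have *: "Ck_on k S h" "Ck_on k S h'" using Suc.prems Ck_on_SucD by blast+
  have "Ck_on k S (partial i (\<lambda>y. h y * h' y))" for i
    using Suc.prems * Suc.IH[of h "partial i h'"] Suc.IH[of "partial i h" h']
    by (subst Ck_on_cong[OF assms, of _ "\<lambda>y. h y * partial i h' y + partial i h y * h' y"])
       (auto simp: partial_mult differentiable_on_open_at[OF assms] intro: Ck_on_add[OF assms])
  then show ?case using Suc.prems by (simp add: differentiable_on_mult)
qed

lemma Ck_on_sum:
  assumes "open S"
  shows "finite I \<Longrightarrow> (\<And>i. i \<in> I \<Longrightarrow> Ck_on k S (h i)) \<Longrightarrow> Ck_on k S (\<lambda>y. \<Sum>i\<in>I. h i y)"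
  by (induction I rule: finite_induct) (auto intro: Ck_on_const Ck_on_add[OF assms])

section \<open>Chain rule, composition and inverse square roots\<close>

lemma has_derivative_partial:
  fixes h :: "real^'n::finite \<Rightarrow> real"
  assumes "h differentiable (at y)"
  shows "(h has_derivative (\<lambda>v. \<Sum>i\<in>UNIV. v $ i * partial i h y)) (at y)"
proof -
  let ?F = "frechet_derivative h (at y)"
  have d: "(h has_derivative ?F) (at y)" using assms frechet_derivative_works by blast
  then have lin: "linear ?F" by (simp add: has_derivative_linear)
  have "?F v = (\<Sum>i\<in>UNIV. v $ i * partial i h y)" for v
  proof -
    have "?F v = ?F (\<Sum>i\<in>UNIV. v $ i *s axis i 1)" by (simp add: basis_expansion)
    also have "\<dots> = (\<Sum>i\<in>UNIV. v $ i * partial i h y)"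
      by (simp add: linear_sum[OF lin] linear_scale[OF lin] scalar_mult_eq_scaleR partial_def)
    finally show ?thesis .
  qed
  then show ?thesis using d by (metis (no_types, lifting) ext)
qed

lemma has_derivative_comp_partial:
  fixes F :: "real^'m::finite \<Rightarrow> real" and T :: "real^'n::finite \<Rightarrow> real^'m"
  assumes "F differentiable (at (T y))" "\<And>j. (\<lambda>y. T y $ j) differentiable (at y)"
  shows "((\<lambda>y. F (T y)) has_derivative
     (\<lambda>v. \<Sum>j\<in>UNIV. frechet_derivative (\<lambda>y. T y $ j) (at y) v * partial j F (T y))) (at y)"
proof -
  have "(T has_derivative (\<lambda>v. \<chi> j. frechet_derivative (\<lambda>y. T y $ j) (at y) v)) (at y)"
    using assms(2) by (subst has_derivative_componentwise_within)
      (auto simp: Basis_vec_def inner_axis frechet_derivative_works)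
  from has_derivative_compose[OF this has_derivative_partial[OF assms(1)]]
  show ?thesis by simp
qed

text \<open>By the chain rule, \<partial>_i of the composite is the sum over j of \<partial>_i T_j
  times (\<partial>_j F) after T. The induction keeps \<open>F\<close> arbitrary because its
  hypothesis is applied to the partials of \<open>F\<close>, while the components of
  \<open>T\<close> only drop one order.\<close>

lemma Ck_on_compose:
  fixes F :: "real^'m::finite \<Rightarrow> real" and T :: "real^'n::finite \<Rightarrow> real^'m"
  assumes S: "open S" and S': "open S'" and TS: "T ` S \<subseteq> S'"
  shows "(\<And>j. Ck_on k S (\<lambda>y. T y $ j)) \<Longrightarrow> Ck_on k S' F \<Longrightarrow> Ck_on k S (\<lambda>y. F (T y))"
proof (induction k arbitrary: F)
  case 0
  then have "continuous_on S (\<lambda>y. \<chi> j. T y $ j)"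
    by (intro continuous_on_vec_lambda) simp
  then have "continuous_on S T" by simp
  then show ?case using 0 TS continuous_on_compose2 by (metis Ck_on.simps(1))
next
  case (Suc k)
  have dT: "(\<lambda>y. T y $ j) differentiable (at y)" if "y \<in> S" for j y
    using Suc.prems(1) S that by (metis Ck_on.simps(2) differentiable_on_open_at)
  have dF: "F differentiable (at (T y))" if "y \<in> S" for y
    using Suc.prems(2) S' that TS
    by (metis Ck_on.simps(2) differentiable_on_open_at image_subset_iff)
  note d = has_derivative_comp_partial[OF dF dT]
  have CT: "Ck_on k S (\<lambda>y. T y $ j)" for j using Suc.prems(1) Ck_on_SucD by blast
  have "Ck_on k S (\<lambda>y. \<Sum>j\<in>UNIV. partial i (\<lambda>y. T y $ j) y * partial j F (T y))" for i
    using Suc.prems Suc.IH[OF CT]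
    by (auto intro!: Ck_on_sum[OF S] Ck_on_mult[OF S])
  then have "Ck_on k S (partial i (\<lambda>y. F (T y)))" for i
    by (subst Ck_on_cong[OF S, of _ "\<lambda>y. \<Sum>j\<in>UNIV. partial i (\<lambda>y. T y $ j) y * partial j F (T y)"])
       (use partial_eqI[OF d] in \<open>auto simp: partial_def[where h = "\<lambda>y. T y $ _"]\<close>)
  moreover have "(\<lambda>y. F (T y)) differentiable_on S"
    using d S by (auto simp: differentiable_on_eq_differentiable_at differentiable_def)
  ultimately show ?case by simp
qed

text \<open>With r = h^(-1/2) one has \<partial>_i r = -1/2 r^3 \<partial>_i h, so regularity of r
  climbs one order at a time. This is what keeps normalised vector fields smooth.\<close>

lemma Ck_on_rsqrt:
  assumes S: "open S" and pos: "\<And>y. y \<in> S \<Longrightarrow> h y > 0"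
  shows "Ck_on k S h \<Longrightarrow> Ck_on k S (\<lambda>y. 1 / sqrt (h y))"
proof (induction k)
  case 0
  then show ?case using pos by (force intro!: continuous_intros)
next
  case (Suc k)
  let ?r = "\<lambda>y. 1 / sqrt (h y)"
  have IH: "Ck_on k S ?r" using Suc Ck_on_SucD by blast
  have dh: "(h has_derivative frechet_derivative h (at y)) (at y)" if "y \<in> S" for y
    using Suc.prems S that by (metis Ck_on.simps(2) differentiable_on_open_at frechet_derivative_works)
  have d: "(?r has_derivative (\<lambda>v. (- 1/2) * (?r y * (?r y * (?r y * frechet_derivative h (at y) v))))) (at y)"
    if "y \<in> S" for y
    using pos[OF that]
    by (auto intro!: derivative_eq_intros dh[OF that] simp: fun_eq_iff field_simps)
  have "Ck_on k S (\<lambda>y. (- 1/2) * (?r y * (?r y * (?r y * partial i h y))))" for i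
    using Suc.prems IH by (intro Ck_on_mult[OF S] Ck_on_const) auto
  then have "Ck_on k S (partial i ?r)" for i
    by (subst Ck_on_cong[OF S, of _ "\<lambda>y. (- 1/2) * (?r y * (?r y * (?r y * partial i h y)))"])
       (use partial_eqI[OF d] in \<open>auto simp: partial_def[where h = h]\<close>)
  moreover have "?r differentiable_on S"
    using d S by (auto simp: differentiable_on_eq_differentiable_at differentiable_def)
  ultimately show ?case by simp
qed

lemma smooth_on_partial: "smooth_on S h \<Longrightarrow> smooth_on S (partial i h)"
  unfolding smooth_on_def by (metis Ck_on.simps(2))

lemma smooth_on_differentiable: "smooth_on S h \<Longrightarrow> h differentiable_on S"
  unfolding smooth_on_def by (metis Ck_on.simps(2))

lemma smooth_on_continuous: "smooth_on S h \<Longrightarrow> continuous_on S h"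
  unfolding smooth_on_def by (metis Ck_on.simps(1))

section \<open>Radial integrals and Hadamard's lemma\<close>

text \<open>Differentiation under the integral sign brings out a factor t from the inner map a + t
  (y - a). The weight t^l therefore belongs to the statement: the induction passes from
  \<open>H\<close> and \<open>l\<close> to \<open>partial i H\<close> and \<open>Suc l\<close>.
  Segments from the centre stay in the ball, so \<open>H\<close> is only evaluated there.\<close>

lemma Ck_on_radial_integral:
  fixes H :: "real^'n::finite \<Rightarrow> real"
  shows "Ck_on k (ball a r) H \<Longrightarrow>
    Ck_on k (ball a r) (\<lambda>y. integral {0..1} (\<lambda>t. t ^ l * H (a + t *\<^sub>R (y - a))))"
proof (induction k arbitrary: H l)
  let ?B = "ball a r"
  have inB: "a + t *\<^sub>R (y - a) \<in> ?B" if "y \<in> ?B" "t \<in> {0..1}" for y t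
  proof -
    have "norm (t *\<^sub>R (y - a)) \<le> 1 * norm (y - a)"
      using that by (intro order_trans[OF eq_refl[OF norm_scaleR] mult_right_mono]) auto
    then show ?thesis using that by (simp add: dist_norm norm_minus_commute)
  qed
  have cont: "continuous_on (?B \<times> {0..1}) (\<lambda>(y, t). t ^ l * H (a + t *\<^sub>R (y - a)))"
    if "continuous_on ?B H" for H l
  proof -
    have "continuous_on (?B \<times> {0..1}) (\<lambda>z. H (a + snd z *\<^sub>R (fst z - a)))"
      by (rule continuous_on_compose2[OF that]) (auto intro!: continuous_intros inB)
    then show ?thesis by (auto simp: case_prod_unfold intro!: continuous_intros)
  qed
  {
    case 0
    show ?case
      using integral_continuous_on_param[of ?B 0 1 "\<lambda>y t. t ^ l * H (a + t *\<^sub>R (y - a))"] cont[of H l] 0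
      by simp
  next
    case (Suc k)
    \<comment> \<open>The coordinate projections as bounded linear maps: \<open>leibniz_rule\<close>
      takes the derivative of the integrand as an element of that normed space, here a combination
      of these projections.\<close>
    let ?L = "\<lambda>i. Blinfun (\<lambda>v::real^'n. v $ i)"
    have L: "blinfun_apply (?L i) = (\<lambda>v. v $ i)" for i
      by (simp add: bounded_linear_Blinfun_apply bounded_linear_vec_nth)
    let ?P = "\<lambda>i y t. t ^ Suc l * partial i H (a + t *\<^sub>R (y - a))"
    let ?fx = "\<lambda>y t. \<Sum>i\<in>UNIV. ?P i y t *\<^sub>R ?L i"
    have dH: "H differentiable (at z)" if "z \<in> ?B" for z
      using Suc.prems that by (metis Ck_on.simps(2) differentiable_on_open_at open_ball)
    have cH: "continuous_on ?B H"
      using Suc.prems by (simp add: differentiable_imp_continuous_on)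
    have cP: "continuous_on ?B (partial i H)" for i
    proof -
      have "Ck_on k ?B (partial i H)" using Suc.prems by simp
      then show ?thesis by (cases k) (auto simp: differentiable_imp_continuous_on)
    qed
    have d: "((\<lambda>y. t ^ l * H (a + t *\<^sub>R (y - a))) has_derivative blinfun_apply (?fx y t)) (at y within ?B)"
      if "y \<in> ?B" "t \<in> cbox 0 1" for y t
    proof -
      have z: "a + t *\<^sub>R (y - a) \<in> ?B" using inB that by simp
      have "((\<lambda>y. a + t *\<^sub>R (y - a)) has_derivative (\<lambda>v. t *\<^sub>R v)) (at y)"
        by (auto intro!: derivative_eq_intros)
      from has_derivative_compose[OF this has_derivative_partial[OF dH[OF z]]]
      have "((\<lambda>y. t ^ l * H (a + t *\<^sub>R (y - a))) has_derivative
          (\<lambda>v. t ^ l * (\<Sum>i\<in>UNIV. (t *\<^sub>R v) $ i * partial i H (a + t *\<^sub>R (y - a))))) (at y)"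
        by (rule has_derivative_mult_right)
      then show ?thesis
        by (rule has_derivative_at_withinI[THEN has_derivative_eq_rhs])
           (simp add: fun_eq_iff L blinfun.sum_left blinfun.scaleR_left sum_distrib_left algebra_simps)
    qed
    have i2: "(\<lambda>t. t ^ l * H (a + t *\<^sub>R (y - a))) integrable_on cbox 0 1" if "y \<in> ?B" for y
    proof -
      have "continuous_on (cbox 0 1) (\<lambda>t. case (y, t) of (y, t) \<Rightarrow> t ^ l * H (a + t *\<^sub>R (y - a)))"
        by (rule continuous_on_compose2[OF cont[OF cH]]) (use that in \<open>auto intro!: continuous_intros\<close>)
      then have "continuous_on (cbox 0 1) (\<lambda>t. t ^ l * H (a + t *\<^sub>R (y - a)))" by simp
      then show ?thesis by (rule integrable_continuous)
    qed
    have cP2: "continuous_on (?B \<times> cbox 0 1) (\<lambda>(y, t). ?P i y t)" for i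
      using cont[OF cP[of i], of "Suc l"] by simp
    have cfx: "continuous_on (?B \<times> cbox 0 1) (\<lambda>(y, t). ?fx y t)"
      using cP2 unfolding case_prod_unfold
      by (intro continuous_on_sum continuous_on_scaleR continuous_on_const)
    have iP: "(\<lambda>t. ?P i y t) integrable_on cbox 0 1" if "y \<in> ?B" for y i
    proof -
      have "continuous_on (cbox 0 1) (\<lambda>t. case (y, t) of (y, t) \<Rightarrow> ?P i y t)"
        by (rule continuous_on_compose2[OF cP2]) (use that in \<open>auto intro!: continuous_intros\<close>)
      then have "continuous_on (cbox 0 1) (?P i y)" by simp
      then show ?thesis by (rule integrable_continuous)
    qed
    let ?G = "\<lambda>y. integral {0..1} (\<lambda>t. t ^ l * H (a + t *\<^sub>R (y - a)))"
    have D: "(?G has_derivative blinfun_apply (\<Sum>i\<in>UNIV. integral {0..1} (?P i y) *\<^sub>R ?L i)) (at y)"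
      if "y \<in> ?B" for y
    proof -
      have "(?G has_derivative blinfun_apply (integral (cbox 0 1) (?fx y))) (at y within ?B)"
        using leibniz_rule[OF d i2 cfx that convex_ball] by simp
      moreover have "integral (cbox 0 1) (?fx y) = (\<Sum>i\<in>UNIV. integral (cbox 0 1) (?P i y) *\<^sub>R ?L i)"
        by (rule integral_unique, rule has_integral_sum[OF finite],
            rule has_integral_scaleR_left, rule integrable_integral, rule iP[OF that])
      ultimately show ?thesis
        by (simp only: at_within_open[OF that open_ball] box_real)
    qed
    have pG: "partial i ?G y = integral {0..1} (?P i y)" if "y \<in> ?B" for i y
      by (subst partial_eqI[OF D[OF that]])
         (simp add: L blinfun.sum_left blinfun.scaleR_left axis_def if_distrib cong: if_cong)
    have "Ck_on k ?B (partial i ?G)" for i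
      using Suc.IH[of "partial i H" "Suc l"] Suc.prems
      by (subst Ck_on_cong[OF open_ball pG]) auto
    moreover have "?G differentiable_on ?B"
      unfolding differentiable_on_eq_differentiable_at[OF open_ball] differentiable_def using D by blast
    ultimately show ?case by simp
  }
qed

text \<open>The fundamental theorem of calculus along the segment from \<open>a\<close> to
  \<open>y\<close>: G_i(y) is the integral of \<partial>_i F over that segment, parametrised by
  [0,1]. At y = a the integrand is constant, which gives G_i(a).\<close>

lemma Hadamard:
  fixes F :: "real^'n::finite \<Rightarrow> real"
  assumes F: "smooth_on (ball a r) F" and r: "r > 0"
  obtains G where "\<And>i. smooth_on (ball a r) (G i)" "\<And>i. G i a = partial i F a"
    "\<And>y. y \<in> ball a r \<Longrightarrow> F y = F a + (\<Sum>i\<in>UNIV. (y $ i - a $ i) * G i y)"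
proof
  let ?B = "ball a r"
  let ?G = "\<lambda>i y. integral {0..1} (\<lambda>t. partial i F (a + t *\<^sub>R (y - a)))"
  show "smooth_on ?B (?G i)" for i
    using Ck_on_radial_integral[of _ a r "partial i F" 0] smooth_on_partial[OF F, of i]
    by (simp add: smooth_on_def)
  show "?G i a = partial i F a" for i by simp
  show "F y = F a + (\<Sum>i\<in>UNIV. (y $ i - a $ i) * ?G i y)" if y: "y \<in> ?B" for y
  proof -
    have inB: "a + t *\<^sub>R (y - a) \<in> ?B" if "t \<in> {0..1}" for t
    proof -
      have "norm (t *\<^sub>R (y - a)) \<le> 1 * norm (y - a)"
        using that by (intro order_trans[OF eq_refl[OF norm_scaleR] mult_right_mono]) auto
      then show ?thesis using y by (simp add: dist_norm norm_minus_commute)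
    qed
    have dF: "F differentiable (at z)" if "z \<in> ?B" for z
      using smooth_on_differentiable[OF F] that by (metis differentiable_on_open_at open_ball)
    have "((\<lambda>t. F (a + t *\<^sub>R (y - a))) has_vector_derivative
        (\<Sum>i\<in>UNIV. (y $ i - a $ i) * partial i F (a + t *\<^sub>R (y - a)))) (at t within {0..1})"
      if t: "t \<in> {0..1}" for t
    proof -
      have "((\<lambda>t. a + t *\<^sub>R (y - a)) has_derivative (\<lambda>s. s *\<^sub>R (y - a))) (at t)"
        by (auto intro!: derivative_eq_intros)
      from has_derivative_compose[OF this has_derivative_partial[OF dF[OF inB[OF t]]]]
      show ?thesis unfolding has_vector_derivative_def
        by (rule has_derivative_at_withinI[THEN has_derivative_eq_rhs])
           (simp add: fun_eq_iff sum_distrib_left algebra_simps)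
    qed
    from fundamental_theorem_of_calculus[OF _ this]
    have "((\<lambda>t. \<Sum>i\<in>UNIV. (y $ i - a $ i) * partial i F (a + t *\<^sub>R (y - a)))
        has_integral (F y - F a)) {0..1}" by simp
    moreover have "((\<lambda>t. \<Sum>i\<in>UNIV. (y $ i - a $ i) * partial i F (a + t *\<^sub>R (y - a)))
        has_integral (\<Sum>i\<in>UNIV. (y $ i - a $ i) * ?G i y)) {0..1}"
    proof (intro has_integral_sum has_integral_mult_right integrable_integral finite)
      fix i
      have "continuous_on {0..1} (\<lambda>t. partial i F (a + t *\<^sub>R (y - a)))"
        by (rule continuous_on_compose2[OF smooth_on_continuous[OF smooth_on_partial[OF F]]])
           (use inB in \<open>auto intro!: continuous_intros\<close>)
      then show "(\<lambda>t. partial i F (a + t *\<^sub>R (y - a))) integrable_on {0..1}"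
        by (rule integrable_continuous_real)
    qed
    ultimately have "F y - F a = (\<Sum>i\<in>UNIV. (y $ i - a $ i) * ?G i y)"
      by (rule has_integral_unique)
    then show ?thesis by linarith
  qed
qed

section \<open>Smooth functions and tangent vectors on a manifold\<close>

lemma smooth_on_cong:
  "open S \<Longrightarrow> (\<And>z. z \<in> S \<Longrightarrow> h z = h' z) \<Longrightarrow> smooth_on S h \<longleftrightarrow> smooth_on S h'"
  unfolding smooth_on_def using Ck_on_cong by metis

lemma smooth_on_subset: "smooth_on S h \<Longrightarrow> T \<subseteq> S \<Longrightarrow> smooth_on T h"
  unfolding smooth_on_def using Ck_on_subset by metis

lemma smooth_on_compose:
  assumes "open S" "open S'" "T ` S \<subseteq> S'" "\<And>j. smooth_on S (\<lambda>y. T y $ j)" "smooth_on S' F"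
  shows "smooth_on S (\<lambda>y. F (T y))"
  using Ck_on_compose[OF assms(1-3)] assms(4,5) by (simp add: smooth_on_def)

context smooth_manifold
begin

section \<open>Charts and the topology of the manifold\<close>

lemma chart_open: "(U, x) \<in> A \<Longrightarrow> openin M U"
  using charts[of "(U, x)"] by (simp add: is_chart_def)

lemma chart_subset: "(U, x) \<in> A \<Longrightarrow> U \<subseteq> topspace M"
  using chart_open openin_subset by blast

lemma chart_homeomorphic:
  "(U, x) \<in> A \<Longrightarrow> homeomorphic_map (subtopology M U) (top_of_set (x ` U)) x"
  using charts[of "(U, x)"] by (simp add: is_chart_def)

lemma chart_inj: "(U, x) \<in> A \<Longrightarrow> inj_on x U"
  by (frule homeomorphic_imp_injective_map[OF chart_homeomorphic], drule chart_subset)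
     (simp add: inf_absorb2)

lemma chart_image_open: "(U, x) \<in> A \<Longrightarrow> open (x ` U)"
  using charts[of "(U, x)"] by (simp add: is_chart_def)

lemma chart_open_image:
  assumes "(U, x) \<in> A" "openin M V"
  shows "open (x ` (U \<inter> V))"
proof -
  have "openin (subtopology M U) (U \<inter> V)"
    using assms chart_open by (simp add: openin_Int openin_open_subtopology)
  then have "openin (top_of_set (x ` U)) (x ` (U \<inter> V))"
    using homeomorphic_imp_open_map[OF chart_homeomorphic[OF assms(1)]] by (simp add: open_map_def)
  then show ?thesis using chart_image_open[OF assms(1)] openin_open_trans by blast
qed

lemma chart_preimage_open:
  assumes "(U, x) \<in> A" "open S"
  shows "openin M {q \<in> U. x q \<in> S}"
proof -
  have "continuous_map (subtopology M U) (top_of_set (x ` U)) x"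
    using chart_homeomorphic[OF assms(1)] homeomorphic_imp_continuous_map by blast
  moreover have "openin (top_of_set (x ` U)) (x ` U \<inter> S)" using assms(2) by (simp add: openin_open_Int)
  ultimately have "openin (subtopology M U) {q \<in> topspace (subtopology M U). x q \<in> x ` U \<inter> S}"
    by (rule openin_continuous_map_preimage)
  moreover have "{q \<in> topspace (subtopology M U). x q \<in> x ` U \<inter> S} = {q \<in> U. x q \<in> S}"
    using chart_subset[OF assms(1)] by auto
  ultimately show ?thesis
    using chart_open[OF assms(1)] by (simp add: openin_open_subtopology)
qed

lemma chart_inv [simp]: "(U, x) \<in> A \<Longrightarrow> q \<in> U \<Longrightarrow> inv_into U x (x q) = q"
  using chart_inj by (simp add: inv_into_f_f)

section \<open>Smooth functions tested in charts\<close>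

lemma smooth_funD: "smooth_fun A V h \<Longrightarrow> (U, x) \<in> A \<Longrightarrow> smooth_on (x ` (U \<inter> V)) (\<lambda>z. h (inv_into U x z))"
  by (force simp: smooth_fun_def o_def)

lemma smooth_funI:
  "(\<And>U x. (U, x) \<in> A \<Longrightarrow> smooth_on (x ` (U \<inter> V)) (\<lambda>z. h (inv_into U x z))) \<Longrightarrow> smooth_fun A V h"
  by (auto simp: smooth_fun_def o_def)

lemma smooth_fun_cong:
  assumes "openin M V" "\<And>q. q \<in> V \<Longrightarrow> h q = h' q"
  shows "smooth_fun A V h \<longleftrightarrow> smooth_fun A V h'"
proof -
  have "smooth_on (x ` (U \<inter> V)) (\<lambda>z. h (inv_into U x z)) \<longleftrightarrow> smooth_on (x ` (U \<inter> V)) (\<lambda>z. h' (inv_into U x z))"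
    if "(U, x) \<in> A" for U x
    using assms that by (intro smooth_on_cong chart_open_image) auto
  then show ?thesis using smooth_funD smooth_funI by metis
qed

lemma smooth_fun_subset: "smooth_fun A V h \<Longrightarrow> W \<subseteq> V \<Longrightarrow> smooth_fun A W h"
  by (rule smooth_funI, erule smooth_on_subset[OF smooth_funD]) auto

lemma smooth_fun_const [intro, simp]: "smooth_fun A V (\<lambda>q. c)"
  by (intro smooth_funI) (simp add: smooth_on_def Ck_on_const)

lemma smooth_fun_add [intro]:
  assumes "openin M V" "smooth_fun A V h" "smooth_fun A V k"
  shows "smooth_fun A V (\<lambda>q. h q + k q)"
  using smooth_funD[OF assms(2)] smooth_funD[OF assms(3)] chart_open_image[OF _ assms(1)]
  by (intro smooth_funI) (simp add: smooth_on_def Ck_on_add)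

lemma smooth_fun_mult [intro]:
  assumes "openin M V" "smooth_fun A V h" "smooth_fun A V k"
  shows "smooth_fun A V (\<lambda>q. h q * k q)"
  using smooth_funD[OF assms(2)] smooth_funD[OF assms(3)] chart_open_image[OF _ assms(1)]
  by (intro smooth_funI) (simp add: smooth_on_def Ck_on_mult)

lemma smooth_fun_diff [intro]:
  assumes "openin M V" "smooth_fun A V h" "smooth_fun A V k"
  shows "smooth_fun A V (\<lambda>q. h q - k q)"
  using smooth_fun_add[OF assms(1,2) smooth_fun_mult[OF assms(1) smooth_fun_const[of _ "-1"] assms(3)]]
  by simp

lemma smooth_fun_sum [intro]:
  assumes "openin M V"
  shows "finite I \<Longrightarrow> (\<And>i. i \<in> I \<Longrightarrow> smooth_fun A V (h i)) \<Longrightarrow> smooth_fun A V (\<lambda>q. \<Sum>i\<in>I. h i q)"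
  by (induction I rule: finite_induct) (use assms in auto)

lemma smooth_fun_rsqrt:
  assumes "openin M V" "smooth_fun A V h" "\<And>q. q \<in> V \<Longrightarrow> h q > 0"
  shows "smooth_fun A V (\<lambda>q. 1 / sqrt (h q))"
proof (rule smooth_funI)
  fix U x assume "(U, x) \<in> A"
  then show "smooth_on (x ` (U \<inter> V)) (\<lambda>z. 1 / sqrt (h (inv_into U x z)))"
    using smooth_funD[OF assms(2)] chart_open_image[OF _ assms(1)] assms(3)
    unfolding smooth_on_def by (intro allI Ck_on_rsqrt) auto
qed

text \<open>This is the compatibility of the atlas itself: read in another chart, the coordinates
  are the components of a transition map.\<close>

lemma smooth_fun_coord: "(U, x) \<in> A \<Longrightarrow> smooth_fun A U (\<lambda>q. x q $ i)"
  by (intro smooth_funI, drule (1) compatible)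
     (simp add: smooth_transition_def Int_commute)

text \<open>Passing to another chart composes \<open>F\<close> with a smooth transition map, so one
  chart suffices to certify smoothness.\<close>

lemma smooth_fun_of_chart:
  assumes c: "(U, x) \<in> A" and V: "openin M V" "V \<subseteq> U" and F: "smooth_on (x ` V) F"
  shows "smooth_fun A V (\<lambda>q. F (x q))"
proof (rule smooth_funI)
  fix U' x' assume c': "(U', x') \<in> A"
  have oV: "open (x ` V)" using chart_open_image[OF c V(1)] V(2) by (simp add: inf_absorb2)
  have "smooth_on (x' ` (U' \<inter> V)) (\<lambda>z. x (inv_into U' x' z) $ j)" for j
    using smooth_funD[OF smooth_fun_subset[OF smooth_fun_coord[OF c] V(2)] c'] .
  then show "smooth_on (x' ` (U' \<inter> V)) (\<lambda>z. F (x (inv_into U' x' z)))"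
    using c' by (intro smooth_on_compose[OF chart_open_image[OF c' V(1)] oV _ _ F]) auto
qed

text \<open>Continuity is available for the chart expression of \<open>h\<close>; openness is
  obtained there and pulled back. It yields the smaller neighbourhood on which a field that is
  nonzero at a point can be normalised.\<close>

lemma smooth_fun_positive_open:
  assumes c: "(U, x) \<in> A" and V: "openin M V" "V \<subseteq> U" and h: "smooth_fun A V h"
  shows "openin M {q \<in> V. h q > 0}"
proof -
  let ?F = "\<lambda>z. h (inv_into U x z)"
  have o: "open (x ` V)" using chart_open_image[OF c V(1)] V(2) by (simp add: inf_absorb2)
  have "continuous_on (x ` V) ?F"
    using smooth_on_continuous[OF smooth_funD[OF h c]] V(2) by (simp add: inf_absorb2)
  then have "open (x ` V \<inter> ?F -` {0<..})"
    using o continuous_on_open_vimage by (metis inf_commute open_greaterThan)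
  then have "openin M {q \<in> U. x q \<in> x ` V \<inter> ?F -` {0<..}}" by (rule chart_preimage_open[OF c])
  moreover have "{q \<in> U. x q \<in> x ` V \<inter> ?F -` {0<..}} = {q \<in> V. h q > 0}"
  proof -
    have "x q \<in> x ` V \<inter> ?F -` {0<..} \<longleftrightarrow> q \<in> V \<and> h q > 0" if "q \<in> U" for q
      using inj_on_image_mem_iff[OF chart_inj[OF c] that V(2)] chart_inv[OF c that] by simp
    then show ?thesis using V(2) by blast
  qed
  ultimately show ?thesis by simp
qed

section \<open>Germs of smooth functions and derivations\<close>

lemma smooth_atI: "openin M V \<Longrightarrow> p \<in> V \<Longrightarrow> smooth_fun A V h \<Longrightarrow> smooth_at M A p h"
  unfolding smooth_at_def by blast

lemma smooth_atE:
  assumes "smooth_at M A p h" "openin M W" "p \<in> W"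
  obtains V where "openin M V" "p \<in> V" "V \<subseteq> W" "smooth_fun A V h"
proof -
  from assms(1) obtain V where "openin M V" "p \<in> V" "smooth_fun A V h" unfolding smooth_at_def by blast
  then show ?thesis using assms(2,3) smooth_fun_subset that[of "V \<inter> W"] by (simp add: openin_Int)
qed

lemma smooth_at_cong:
  assumes "openin M V" "p \<in> V" "\<And>q. q \<in> V \<Longrightarrow> h q = k q"
  shows "smooth_at M A p h \<longleftrightarrow> smooth_at M A p k"
proof -
  have "smooth_at M A p k" if h: "smooth_at M A p h" and eq: "\<And>q. q \<in> V \<Longrightarrow> h q = k q" for h k
  proof -
    obtain W where W: "openin M W" "p \<in> W" "W \<subseteq> V" "smooth_fun A W h"
      using smooth_atE[OF h assms(1,2)] .
    then have "smooth_fun A W k" using smooth_fun_cong[OF W(1), of h k] eq by blast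
    then show ?thesis using smooth_atI W(1,2) by blast
  qed
  then show ?thesis using assms(3) by metis
qed

lemma tangent_lin:
  assumes "v \<in> tangent_space M A p" "smooth_at M A p h" "smooth_at M A p k"
  shows "v (\<lambda>q. a * h q + b * k q) = a * v h + b * v k"
  using assms unfolding tangent_space_def by blast

lemma tangent_mult:
  assumes "v \<in> tangent_space M A p" "smooth_at M A p h" "smooth_at M A p k"
  shows "v (\<lambda>q. h q * k q) = h p * v k + v h * k p"
  using assms unfolding tangent_space_def by blast

lemma tangent_nonsmooth: "v \<in> tangent_space M A p \<Longrightarrow> \<not> smooth_at M A p h \<Longrightarrow> v h = 0"
  unfolding tangent_space_def by blast

lemma smooth_at_const [simp]: "p \<in> topspace M \<Longrightarrow> smooth_at M A p (\<lambda>q. c)"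
  by (rule smooth_atI[of "topspace M"]) auto

lemma smooth_at_add: "smooth_at M A p h \<Longrightarrow> smooth_at M A p k \<Longrightarrow> smooth_at M A p (\<lambda>q. h q + k q)"
proof -
  assume h: "smooth_at M A p h" and "smooth_at M A p k"
  then obtain V where V: "openin M V" "p \<in> V" "smooth_fun A V k" unfolding smooth_at_def by blast
  obtain W where W: "openin M W" "p \<in> W" "W \<subseteq> V" "smooth_fun A W h" using smooth_atE[OF h V(1,2)] .
  show "smooth_at M A p (\<lambda>q. h q + k q)"
    using smooth_atI[OF W(1,2) smooth_fun_add[OF W(1,4) smooth_fun_subset[OF V(3) W(3)]]] .
qed

lemma smooth_at_mult: "smooth_at M A p h \<Longrightarrow> smooth_at M A p k \<Longrightarrow> smooth_at M A p (\<lambda>q. h q * k q)"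
proof -
  assume h: "smooth_at M A p h" and "smooth_at M A p k"
  then obtain V where V: "openin M V" "p \<in> V" "smooth_fun A V k" unfolding smooth_at_def by blast
  obtain W where W: "openin M W" "p \<in> W" "W \<subseteq> V" "smooth_fun A W h" using smooth_atE[OF h V(1,2)] .
  show "smooth_at M A p (\<lambda>q. h q * k q)"
    using smooth_atI[OF W(1,2) smooth_fun_mult[OF W(1,4) smooth_fun_subset[OF V(3) W(3)]]] .
qed

lemma tangent_add:
  assumes "v \<in> tangent_space M A p" "smooth_at M A p h" "smooth_at M A p k"
  shows "v (\<lambda>q. h q + k q) = v h + v k"
  using tangent_lin[OF assms, of 1 1] by simp

lemma tangent_scale:
  assumes "v \<in> tangent_space M A p" "smooth_at M A p h"
  shows "v (\<lambda>q. c * h q) = c * v h"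
  using tangent_lin[OF assms assms(2), of c 0] by simp

lemma tangent_diff:
  assumes "v \<in> tangent_space M A p" "smooth_at M A p h" "smooth_at M A p k"
  shows "v (\<lambda>q. h q - k q) = v h - v k"
  using tangent_lin[OF assms, of 1 "-1"] by simp

text \<open>The Leibniz rule for 1 * 1 = 1 reads v 1 = 2 v 1.\<close>

lemma tangent_const:
  assumes "v \<in> tangent_space M A p" "p \<in> topspace M"
  shows "v (\<lambda>q. c) = 0"
proof -
  have "v (\<lambda>q. 1 * 1) = 1 * v (\<lambda>q. 1) + v (\<lambda>q. 1) * 1"
    using assms by (intro tangent_mult) auto
  then have 1: "v (\<lambda>q. 1) = 0" by simp
  have "v (\<lambda>q. c * 1) = c * v (\<lambda>q. 1)" using assms by (intro tangent_scale) auto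
  then show ?thesis using 1 by simp
qed

lemma smooth_at_sum:
  "p \<in> topspace M \<Longrightarrow> finite I \<Longrightarrow> (\<And>i. i \<in> I \<Longrightarrow> smooth_at M A p (h i)) \<Longrightarrow>
    smooth_at M A p (\<lambda>q. \<Sum>i\<in>I. h i q)"
  by (rotate_tac, induction I rule: finite_induct) (auto intro: smooth_at_add)

lemma tangent_sum:
  assumes "v \<in> tangent_space M A p" "p \<in> topspace M"
  shows "finite I \<Longrightarrow> (\<And>i. i \<in> I \<Longrightarrow> smooth_at M A p (h i)) \<Longrightarrow>
    v (\<lambda>q. \<Sum>i\<in>I. h i q) = (\<Sum>i\<in>I. v (h i))"
  by (induction I rule: finite_induct)
     (auto simp: tangent_const[OF assms] tangent_add[OF assms(1)] smooth_at_sum[OF assms(2)])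

text \<open>The indicator \<chi> of \<open>V\<close> plays the part of a bump function. It equals 1
  near \<open>p\<close>, so it is smooth there; \<chi>^2 = \<chi> forces v \<chi> = 0, and then v h
  = v (h \<chi>) = v (k \<chi>) = v k.\<close>

lemma tangent_local:
  assumes v: "v \<in> tangent_space M A p" and V: "openin M V" "p \<in> V" and eq: "\<And>q. q \<in> V \<Longrightarrow> h q = k q"
  shows "v h = v k"
proof (cases "smooth_at M A p h")
  \<comment> \<open>Off the smooth germs both values are 0 by the convention in
    \<open>tangent_space\<close>.\<close>
  case False
  then have "\<not> smooth_at M A p k" using smooth_at_cong[of V p h k, OF V eq] by simp
  then show ?thesis using False tangent_nonsmooth[OF v] by simp
next
  case True
  then have k: "smooth_at M A p k" using smooth_at_cong[of V p h k, OF V eq] by simp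
  let ?\<chi> = "indicator V :: 'a \<Rightarrow> real"
  have \<chi>: "smooth_at M A p ?\<chi>"
    using V openin_subset[OF V(1)] by (subst smooth_at_cong[OF V, of _ "\<lambda>q. 1"]) auto
  have "(\<lambda>q. ?\<chi> q * ?\<chi> q) = ?\<chi>" by (auto simp: indicator_def)
  then have "v ?\<chi> = 0" using tangent_mult[OF v \<chi> \<chi>] V(2) by simp
  moreover have "(\<lambda>q. h q * ?\<chi> q) = (\<lambda>q. k q * ?\<chi> q)" using eq by (auto simp: indicator_def)
  ultimately show ?thesis
    using tangent_mult[OF v True \<chi>] tangent_mult[OF v k \<chi>] V(2) by simp
qed

lemma tangent_space_add:
  assumes "v \<in> tangent_space M A p" "w \<in> tangent_space M A p"
  shows "(\<lambda>h. v h + w h) \<in> tangent_space M A p"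
  using assms unfolding tangent_space_def by (simp add: algebra_simps)

lemma tangent_space_scale:
  assumes "v \<in> tangent_space M A p"
  shows "(\<lambda>h. c * v h) \<in> tangent_space M A p"
  using assms unfolding tangent_space_def by (simp add: algebra_simps)

lemma tangent_space_zero: "(\<lambda>h. 0) \<in> tangent_space M A p"
  unfolding tangent_space_def by simp

lemma tangent_space_sum:
  "finite I \<Longrightarrow> (\<And>i. i \<in> I \<Longrightarrow> v i \<in> tangent_space M A p) \<Longrightarrow>
    (\<lambda>h. \<Sum>i\<in>I. v i h) \<in> tangent_space M A p"
  by (induction I rule: finite_induct) (auto intro: tangent_space_zero tangent_space_add)

section \<open>Coordinate derivations span the tangent space\<close>

text \<open>The derivation \<partial>/\<partial>x_i of the chart. The value 0 on functions that are
  not smooth near the point is what membership in \<open>tangent_space\<close> demands.\<close>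

definition coord_field :: "'a set \<Rightarrow> ('a \<Rightarrow> real^'n) \<Rightarrow> 'n \<Rightarrow> 'a vfield" where
  "coord_field U x i q h = (if smooth_at M A q h then partial i (\<lambda>z. h (inv_into U x z)) (x q) else 0)"

lemma smooth_at_chart:
  assumes c: "(U, x) \<in> A" and q: "q \<in> U" and h: "smooth_at M A q h"
  shows "(\<lambda>z. h (inv_into U x z)) differentiable (at (x q))"
proof -
  obtain V where V: "openin M V" "q \<in> V" "smooth_fun A V h" using h unfolding smooth_at_def by blast
  show ?thesis
    using differentiable_on_open_at[OF chart_open_image[OF c V(1)]
        smooth_on_differentiable[OF smooth_funD[OF V(3) c]], of "x q"] q V(2) by blast
qed

lemma coord_field_tangent:
  assumes c: "(U, x) \<in> A" and q: "q \<in> U"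
  shows "coord_field U x i q \<in> tangent_space M A q"
proof -
  have top: "q \<in> topspace M" using c q chart_subset by blast
  note d = smooth_at_chart[OF c q]
  have "partial i (\<lambda>z. a * h (inv_into U x z) + b * k (inv_into U x z)) (x q) =
      a * partial i (\<lambda>z. h (inv_into U x z)) (x q) + b * partial i (\<lambda>z. k (inv_into U x z)) (x q)"
    if "smooth_at M A q h" "smooth_at M A q k" for a b h k
    using d[OF that(1)] d[OF that(2)] by (simp add: partial_add partial_mult)
  moreover have "smooth_at M A q (\<lambda>r. a * h r + b * k r)"
    if "smooth_at M A q h" "smooth_at M A q k" for a b h k
    using that top by (intro smooth_at_add smooth_at_mult) auto
  moreover have "partial i (\<lambda>z. h (inv_into U x z) * k (inv_into U x z)) (x q) =
      h q * partial i (\<lambda>z. k (inv_into U x z)) (x q) + partial i (\<lambda>z. h (inv_into U x z)) (x q) * k q"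
    if "smooth_at M A q h" "smooth_at M A q k" for h k
    using d[OF that(1)] d[OF that(2)] c q by (simp add: partial_mult)
  ultimately show ?thesis
    unfolding tangent_space_def by (auto simp: coord_field_def smooth_at_mult)
qed

lemma coord_field_vector_field:
  assumes c: "(U, x) \<in> A"
  shows "vector_field M A U (coord_field U x i)"
  unfolding vector_field_def
proof (intro conjI ballI allI impI)
  show "coord_field U x i p \<in> tangent_space M A p" if "p \<in> U" for p
    using coord_field_tangent[OF c that] .
  fix V h assume V: "openin M V" "V \<subseteq> U" and h: "smooth_fun A V h"
  have "smooth_on (x ` V) (\<lambda>z. h (inv_into U x z))"
    using smooth_funD[OF h c] V(2) by (simp add: inf_absorb2)
  from smooth_fun_of_chart[OF c V smooth_on_partial[OF this]]
  show "smooth_fun A V (\<lambda>p. coord_field U x i p h)"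
    by (rule iffD1[OF smooth_fun_cong[OF V(1)], rotated])
       (auto simp: coord_field_def intro: smooth_atI[OF V(1) _ h])
qed

lemma partial_component: "partial i (\<lambda>z. z $ j) z = (if i = j then 1 else 0)"
  by (subst partial_eqI[OF bounded_linear.has_derivative[OF bounded_linear_vec_nth has_derivative_ident]])
     (simp add: axis_def)

lemma coord_field_coord:
  assumes c: "(U, x) \<in> A" and q: "q \<in> U"
  shows "coord_field U x i q (\<lambda>r. x r $ j) = (if i = j then 1 else 0)"
proof -
  have "smooth_at M A q (\<lambda>r. x r $ j)"
    using smooth_atI[OF chart_open[OF c] q smooth_fun_coord[OF c]] .
  moreover have "partial i (\<lambda>z. x (inv_into U x z) $ j) (x q) = partial i (\<lambda>z. z $ j) (x q)"
    using q by (intro partial_cong[OF chart_image_open[OF c]]) (auto simp: f_inv_into_f)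
  ultimately show ?thesis by (simp add: coord_field_def partial_component)
qed

text \<open>By Hadamard's lemma h = h(p) + \<Sum> (x_i - x_i(p)) G_i(x) near \<open>p\<close>. The
  derivation \<open>v\<close> kills constants, and as x_i - x_i(p) vanishes at \<open>p\<close>,
  only v(x_i) G_i(x(p)) survives, where G_i(x(p)) is the i-th partial of \<open>h\<close>.\<close>

lemma tangent_coord_expansion:
  assumes c: "(U, x) \<in> A" and p: "p \<in> U" and v: "v \<in> tangent_space M A p"
  shows "v h = (\<Sum>i\<in>UNIV. v (\<lambda>r. x r $ i) * coord_field U x i p h)"
proof (cases "smooth_at M A p h")
  case False
  then show ?thesis by (simp add: tangent_nonsmooth[OF v] coord_field_def)
next
  case True
  have top: "p \<in> topspace M" using c p chart_subset by blast
  obtain V where V: "openin M V" "p \<in> V" "V \<subseteq> U" "smooth_fun A V h"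
    using smooth_atE[OF True chart_open[OF c] p] .
  let ?F = "\<lambda>z. h (inv_into U x z)"
  have oV: "open (x ` V)" using chart_open_image[OF c V(1)] V(3) by (simp add: inf_absorb2)
  have F: "smooth_on (x ` V) ?F" using smooth_funD[OF V(4) c] V(3) by (simp add: inf_absorb2)
  obtain r where r: "r > 0" "ball (x p) r \<subseteq> x ` V"
    using oV V(2) by (metis image_eqI openE)
  obtain G where G: "\<And>i. smooth_on (ball (x p) r) (G i)" "\<And>i. G i (x p) = partial i ?F (x p)"
    "\<And>y. y \<in> ball (x p) r \<Longrightarrow> ?F y = ?F (x p) + (\<Sum>i\<in>UNIV. (y $ i - x p $ i) * G i y)"
    by (rule Hadamard[OF smooth_on_subset[OF F r(2)] r(1)]) (rule that)
  let ?W = "{q \<in> U. x q \<in> ball (x p) r}"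
  have W: "openin M ?W" "p \<in> ?W" "?W \<subseteq> U"
    using chart_preimage_open[OF c open_ball] r(1) p by auto
  \<comment> \<open>The neighbourhood is the exact preimage of the ball, so the smoothness of
    \<open>G i\<close> supplied by Hadamard's lemma is what \<open>smooth_fun_of_chart\<close> asks
    for.\<close>
  have "x ` ?W = x ` U \<inter> ball (x p) r" by blast
  then have xW: "x ` ?W = ball (x p) r" using r(2) V(3) by blast
  have sG: "smooth_at M A p (\<lambda>q. G i (x q))" for i
    using smooth_atI[OF W(1,2) smooth_fun_of_chart[OF c W(1,3)]] G(1) by (simp only: xW)
  have sx: "smooth_at M A p (\<lambda>q. x q $ i)" for i
    using smooth_atI[OF chart_open[OF c] p smooth_fun_coord[OF c]] .
  \<comment> \<open>The sum form with a negated constant fits \<open>tangent_add\<close> and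
    \<open>tangent_const\<close>; the simplifier is kept from turning it back into a
    difference.\<close>
  then have sx': "smooth_at M A p (\<lambda>q. x q $ i + (- x p $ i))" for i
    using top by (intro smooth_at_add) auto
  have "v h = v (\<lambda>q. h p + (\<Sum>i\<in>UNIV. (x q $ i + (- x p $ i)) * G i (x q)))"
  proof (rule tangent_local[OF v W(1,2)])
    fix q assume "q \<in> ?W"
    then show "h q = h p + (\<Sum>i\<in>UNIV. (x q $ i + (- x p $ i)) * G i (x q))"
      using G(3)[of "x q"] c p by simp
  qed
  also have "\<dots> = (\<Sum>i\<in>UNIV. v (\<lambda>r. x r $ i) * G i (x p))"
    using sx sx' sG top
    by (simp add: tangent_add[OF v] tangent_sum[OF v] tangent_const[OF v] tangent_mult[OF v]
        smooth_at_mult smooth_at_sum del: add_uminus_conv_diff)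
  finally show ?thesis using True by (simp add: G(2) coord_field_def)
qed

end

section \<open>Vector fields and tensorial expressions\<close>

context smooth_manifold
begin

lemma vector_field_tangent: "vector_field M A U X \<Longrightarrow> p \<in> U \<Longrightarrow> X p \<in> tangent_space M A p"
  unfolding vector_field_def by blast

lemma vector_field_smooth:
  "vector_field M A U X \<Longrightarrow> openin M U \<Longrightarrow> smooth_fun A U h \<Longrightarrow> smooth_fun A U (\<lambda>p. X p h)"
  unfolding vector_field_def by blast

lemma vector_field_subset: "vector_field M A U X \<Longrightarrow> V \<subseteq> U \<Longrightarrow> vector_field M A V X"
  unfolding vector_field_def by (meson subset_iff subset_trans)

lemma vector_field_cong:
  assumes "openin M U" "vector_field M A U X" "\<And>q. q \<in> U \<Longrightarrow> Y q = X q"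
  shows "vector_field M A U Y"
proof -
  have "smooth_fun A V (\<lambda>p. Y p h)" if V: "openin M V" "V \<subseteq> U" "smooth_fun A V h" for V h
  proof -
    have "smooth_fun A V (\<lambda>p. X p h)" using assms(2) V unfolding vector_field_def by blast
    then show ?thesis
      using smooth_fun_cong[OF V(1), of "\<lambda>p. Y p h" "\<lambda>p. X p h"] assms(3) V(2) by (simp add: subset_iff)
  qed
  then show ?thesis using assms unfolding vector_field_def by simp
qed

lemma vector_field_add:
  "vector_field M A U X \<Longrightarrow> vector_field M A U Y \<Longrightarrow> vector_field M A U (\<lambda>q h. X q h + Y q h)"
  unfolding vector_field_def by (auto intro: tangent_space_add)

lemma vector_field_scale:
  assumes "smooth_fun A U k" "vector_field M A U X"
  shows "vector_field M A U (\<lambda>q h. k q * X q h)"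
  using assms smooth_fun_subset[OF assms(1)]
  unfolding vector_field_def by (auto intro: tangent_space_scale)

lemma vector_field_zero: "vector_field M A U (\<lambda>q h. 0)"
  unfolding vector_field_def by (auto intro: tangent_space_zero)

lemma vector_field_sum:
  "finite I \<Longrightarrow> (\<And>i. i \<in> I \<Longrightarrow> smooth_fun A U (k i)) \<Longrightarrow> (\<And>i. i \<in> I \<Longrightarrow> vector_field M A U (X i)) \<Longrightarrow>
    vector_field M A U (\<lambda>q h. \<Sum>i\<in>I. k i q * X i q h)"
proof (induction I rule: finite_induct)
  case empty
  show ?case by (simp add: vector_field_zero)
next
  case (insert i I)
  then have "vector_field M A U (\<lambda>q h. k i q * X i q h + (\<Sum>i\<in>I. k i q * X i q h))"
    by (intro vector_field_add vector_field_scale) auto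
  then show ?case using insert by simp
qed

lemma vector_field_diff:
  assumes "vector_field M A U X" "vector_field M A U Y"
  shows "vector_field M A U (\<lambda>q h. X q h - Y q h)"
  using vector_field_add[OF assms(1) vector_field_scale[OF smooth_fun_const[of _ "-1"] assms(2)]] by simp

section \<open>Function-linear functionals on vector fields\<close>

text \<open>Being contained in a chart domain, rather than being one, is stable under shrinking, and
  still provides a frame of coordinate fields on \<open>W\<close>.\<close>

definition chart_nbhd :: "'a \<Rightarrow> 'a set \<Rightarrow> bool" where
  "chart_nbhd p W \<longleftrightarrow> openin M W \<and> p \<in> W \<and> (\<exists>U x. (U, x) \<in> A \<and> W \<subseteq> U)"

lemma chart_nbhd_open: "chart_nbhd p W \<Longrightarrow> openin M W"
  and chart_nbhd_mem: "chart_nbhd p W \<Longrightarrow> p \<in> W"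
  unfolding chart_nbhd_def by auto

lemma chart_nbhd_move: "chart_nbhd p W \<Longrightarrow> q \<in> W \<Longrightarrow> chart_nbhd q W"
  unfolding chart_nbhd_def by auto

lemma chart_nbhd_Int: "chart_nbhd p W \<Longrightarrow> openin M V \<Longrightarrow> p \<in> V \<Longrightarrow> chart_nbhd p (W \<inter> V)"
  unfolding chart_nbhd_def by (auto simp: openin_Int)

text \<open>Linearity over the smooth functions on \<open>W\<close>, evaluated at \<open>p\<close>.
  The last clause reflects that fields are total functions whose values off \<open>W\<close> carry
  no meaning.\<close>

definition tensorial_at :: "'a \<Rightarrow> 'a set \<Rightarrow> ('a vfield \<Rightarrow> real) \<Rightarrow> bool" where
  "tensorial_at p W T \<longleftrightarrow>
    (\<forall>X Y. vector_field M A W X \<longrightarrow> vector_field M A W Y \<longrightarrow> T (\<lambda>q h. X q h + Y q h) = T X + T Y) \<and>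
    (\<forall>k X. smooth_fun A W k \<longrightarrow> vector_field M A W X \<longrightarrow> T (\<lambda>q h. k q * X q h) = k p * T X) \<and>
    (\<forall>X Y. vector_field M A W X \<longrightarrow> (\<forall>q\<in>W. Y q = X q) \<longrightarrow> T Y = T X)"

lemma tensorial_atI:
  assumes "\<And>X Y. vector_field M A W X \<Longrightarrow> vector_field M A W Y \<Longrightarrow> T (\<lambda>q h. X q h + Y q h) = T X + T Y"
    and "\<And>k X. smooth_fun A W k \<Longrightarrow> vector_field M A W X \<Longrightarrow> T (\<lambda>q h. k q * X q h) = k p * T X"
    and "\<And>X Y. vector_field M A W X \<Longrightarrow> (\<And>q. q \<in> W \<Longrightarrow> Y q = X q) \<Longrightarrow> T Y = T X"
  shows "tensorial_at p W T"
  using assms unfolding tensorial_at_def by blast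

lemma tensorial_add:
  "tensorial_at p W T \<Longrightarrow> vector_field M A W X \<Longrightarrow> vector_field M A W Y \<Longrightarrow>
    T (\<lambda>q h. X q h + Y q h) = T X + T Y"
  and tensorial_scale:
  "tensorial_at p W T \<Longrightarrow> smooth_fun A W k \<Longrightarrow> vector_field M A W X \<Longrightarrow>
    T (\<lambda>q h. k q * X q h) = k p * T X"
  and tensorial_cong:
  "tensorial_at p W T \<Longrightarrow> vector_field M A W X \<Longrightarrow> (\<And>q. q \<in> W \<Longrightarrow> Y q = X q) \<Longrightarrow> T Y = T X"
  unfolding tensorial_at_def by blast+

lemma tensorial_sum:
  assumes T: "tensorial_at p W T"
  shows "finite I \<Longrightarrow> (\<And>i. i \<in> I \<Longrightarrow> smooth_fun A W (k i)) \<Longrightarrow> (\<And>i. i \<in> I \<Longrightarrow> vector_field M A W (X i)) \<Longrightarrow>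
    T (\<lambda>q h. \<Sum>i\<in>I. k i q * X i q h) = (\<Sum>i\<in>I. k i p * T (X i))"
proof (induction I rule: finite_induct)
  case empty
  have "T (\<lambda>q h. 0 * 0) = 0 * T (\<lambda>q h. 0)"
    by (rule tensorial_scale[OF T smooth_fun_const vector_field_zero])
  then show ?case by simp
next
  case (insert i I)
  have "T (\<lambda>q h. k i q * X i q h + (\<Sum>i\<in>I. k i q * X i q h)) =
      T (\<lambda>q h. k i q * X i q h) + T (\<lambda>q h. \<Sum>i\<in>I. k i q * X i q h)"
    using insert by (intro tensorial_add[OF T] vector_field_scale vector_field_sum) auto
  moreover have "T (\<lambda>q h. k i q * X i q h) = k i p * T (X i)"
    using insert by (intro tensorial_scale[OF T]) auto
  ultimately show ?case using insert by simp
qed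

text \<open>Over all of \<open>W\<close> a field is a combination of coordinate fields with smooth
  coefficients, so T sees only the coefficients at \<open>p\<close>. Fields live on \<open>W\<close>
  and not on \<open>M\<close>, hence no cutoff functions.\<close>

lemma tensorial_point:
  assumes W: "chart_nbhd p W" and T: "tensorial_at p W T"
    and X: "vector_field M A W X" and Y: "vector_field M A W Y" and eq: "X p = Y p"
  shows "T X = T Y"
proof -
  obtain U x where c: "(U, x) \<in> A" and WU: "W \<subseteq> U" using W unfolding chart_nbhd_def by blast
  have "T Z = (\<Sum>i\<in>UNIV. Z p (\<lambda>r. x r $ i) * T (coord_field U x i))" if Z: "vector_field M A W Z" for Z
  proof -
    have k: "smooth_fun A W (\<lambda>q. Z q (\<lambda>r. x r $ i))" for i
      using vector_field_smooth[OF Z chart_nbhd_open[OF W] smooth_fun_subset[OF smooth_fun_coord[OF c] WU]] .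
    have e: "vector_field M A W (coord_field U x i)" for i
      using vector_field_subset[OF coord_field_vector_field[OF c] WU] .
    have "Z q = (\<lambda>h. \<Sum>i\<in>UNIV. Z q (\<lambda>r. x r $ i) * coord_field U x i q h)" if "q \<in> W" for q
      using tangent_coord_expansion[OF c _ vector_field_tangent[OF Z that]] WU that by blast
    then have "T Z = T (\<lambda>q h. \<Sum>i\<in>UNIV. Z q (\<lambda>r. x r $ i) * coord_field U x i q h)"
      by (intro tensorial_cong[OF T vector_field_sum[OF finite k e]])
    then show ?thesis using tensorial_sum[OF T finite k e] by simp
  qed
  then show ?thesis using X Y eq by simp
qed

text \<open>The combination with constant coefficients is a field on \<open>W\<close> agreeing with
  \<open>X\<close> at \<open>p\<close>.\<close>

lemma tensorial_expansion:
  assumes W: "chart_nbhd p W" and T: "tensorial_at p W T"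
    and X: "vector_field M A W X" and E: "finite I" "\<And>i. i \<in> I \<Longrightarrow> vector_field M A W (E i)"
    and eq: "X p = (\<lambda>h. \<Sum>i\<in>I. c i * E i p h)"
  shows "T X = (\<Sum>i\<in>I. c i * T (E i))"
proof -
  have "T X = T (\<lambda>q h. \<Sum>i\<in>I. c i * E i q h)"
    using E eq by (intro tensorial_point[OF W T X vector_field_sum]) auto
  then show ?thesis using tensorial_sum[OF T E(1), of "\<lambda>i q. c i" E] E(2) by simp
qed

text \<open>The components of \<open>v\<close> in a chart are frozen while the coordinate fields
  vary.\<close>

lemma extension_exists:
  assumes "p \<in> topspace M" "v \<in> tangent_space M A p"
  shows "\<exists>X. X p = v \<and> (\<exists>U. openin M U \<and> p \<in> U \<and> vector_field M A U X)"
proof -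
  from assms(1) cover obtain U x where c: "(U, x) \<in> A" and p: "p \<in> U" by fastforce
  have "vector_field M A U (\<lambda>q h. \<Sum>i\<in>UNIV. v (\<lambda>r. x r $ i) * coord_field U x i q h)"
    by (intro vector_field_sum coord_field_vector_field[OF c]) auto
  moreover have "v = (\<lambda>h. \<Sum>i\<in>UNIV. v (\<lambda>r. x r $ i) * coord_field U x i p h)"
    using tangent_coord_expansion[OF c p assms(2)] by blast
  ultimately show ?thesis using chart_open[OF c] p
    by (intro exI[of _ "\<lambda>q h. \<Sum>i\<in>UNIV. v (\<lambda>r. x r $ i) * coord_field U x i q h"]) auto
qed

lemma extendE:
  assumes "p \<in> topspace M" "v \<in> tangent_space M A p"
  obtains U where "extend M A p v p = v" "openin M U" "p \<in> U" "vector_field M A U (extend M A p v)"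
  using someI_ex[OF extension_exists[OF assms]] that unfolding extend_def by blast

text \<open>Each extension picked by \<open>extend\<close> comes with its own domain; a curvature
  term involves three, so the domains are intersected inside a given chart neighbourhood.\<close>

lemma extend3E:
  assumes W: "chart_nbhd p W" and "u \<in> tangent_space M A p" "v \<in> tangent_space M A p" "w \<in> tangent_space M A p"
  obtains V where "chart_nbhd p V" "V \<subseteq> W"
    "extend M A p u p = u" "vector_field M A V (extend M A p u)"
    "extend M A p v p = v" "vector_field M A V (extend M A p v)"
    "extend M A p w p = w" "vector_field M A V (extend M A p w)"
proof -
  have p: "p \<in> topspace M" using W openin_subset unfolding chart_nbhd_def by blast
  obtain U1 where 1: "extend M A p u p = u" "openin M U1" "p \<in> U1" "vector_field M A U1 (extend M A p u)"
    using extendE[OF p assms(2)] .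
  obtain U2 where 2: "extend M A p v p = v" "openin M U2" "p \<in> U2" "vector_field M A U2 (extend M A p v)"
    using extendE[OF p assms(3)] .
  obtain U3 where 3: "extend M A p w p = w" "openin M U3" "p \<in> U3" "vector_field M A U3 (extend M A p w)"
    using extendE[OF p assms(4)] .
  let ?V = "W \<inter> (U1 \<inter> U2 \<inter> U3)"
  have V: "chart_nbhd p ?V" using 1 2 3 by (intro chart_nbhd_Int[OF W] openin_Int) auto
  have "vector_field M A ?V (extend M A p u)" "vector_field M A ?V (extend M A p v)"
    "vector_field M A ?V (extend M A p w)"
    by (rule vector_field_subset[OF 1(4)] vector_field_subset[OF 2(4)] vector_field_subset[OF 3(4)]; blast)+
  then show ?thesis using that[OF V _ 1(1) _ 2(1) _ 3(1)] by blast
qed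

lemma vector_field_scalar_mult:
  assumes "vector_field M A W X" "openin M W" "p \<in> W" "smooth_fun A W h" "smooth_fun A W k"
  shows "X p (\<lambda>q. h q * k q) = h p * X p k + X p h * k p"
  using assms by (intro tangent_mult[OF vector_field_tangent[OF assms(1,3)]] smooth_atI)

lemma vector_field_scalar_add:
  assumes "vector_field M A W X" "openin M W" "p \<in> W" "smooth_fun A W h" "smooth_fun A W k"
  shows "X p (\<lambda>q. h q + k q) = X p h + X p k"
  using assms by (intro tangent_add[OF vector_field_tangent[OF assms(1,3)]] smooth_atI)

lemma vector_field_scalar_diff:
  assumes "vector_field M A W X" "openin M W" "p \<in> W" "smooth_fun A W h" "smooth_fun A W k"
  shows "X p (\<lambda>q. h q - k q) = X p h - X p k"
  using assms by (intro tangent_diff[OF vector_field_tangent[OF assms(1,3)]] smooth_atI)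

end

section \<open>Connections\<close>

context affine_connection
begin

lemma conn_diff_left:
  assumes "openin M U" "vector_field M A U X" "vector_field M A U Y" "vector_field M A U Z" "p \<in> U"
  shows "D (\<lambda>q h. X q h - Y q h) Z p h = D X Z p h - D Y Z p h"
proof -
  have m: "vector_field M A U (\<lambda>q h. - 1 * Y q h)"
    using vector_field_scale[OF smooth_fun_const assms(3)] .
  have "D (\<lambda>q h. X q h + - 1 * Y q h) Z p h = D X Z p h + D (\<lambda>q h. - 1 * Y q h) Z p h"
    using conn_add_left[OF assms(1,2) m assms(4,5)] by simp
  also have "D (\<lambda>q h. - 1 * Y q h) Z p h = - 1 * D Y Z p h"
    using conn_scale_left[OF assms(1,3,4) smooth_fun_const assms(5), of "- 1"] by simp
  finally show ?thesis by simp
qed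

lemma conn_diff_right:
  assumes "openin M U" "vector_field M A U X" "vector_field M A U Y" "vector_field M A U Z" "p \<in> U"
  shows "D X (\<lambda>q h. Y q h - Z q h) p h = D X Y p h - D X Z p h"
proof -
  have m: "vector_field M A U (\<lambda>q h. - 1 * Z q h)"
    using vector_field_scale[OF smooth_fun_const assms(4)] .
  have "X p (\<lambda>q. - 1) = 0"
    using tangent_const[OF vector_field_tangent[OF assms(2,5)]] assms(1,5) openin_subset by blast
  then have "D X (\<lambda>q h. - 1 * Z q h) p h = - 1 * D X Z p h"
    using conn_leibniz[OF assms(1,2,4) smooth_fun_const assms(5), of "- 1"] by simp
  then show ?thesis
    using conn_add_right[OF assms(1,2,3) m assms(5)] by simp
qed

lemma conn_cong:
  assumes "openin M U" "vector_field M A U X" "vector_field M A U Y"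
    "\<And>q. q \<in> U \<Longrightarrow> X' q = X q" "\<And>q. q \<in> U \<Longrightarrow> Y' q = Y q" "p \<in> U"
  shows "D X' Y' p = D X Y p"
  using conn_local[OF assms(1-3), of X' Y' p] assms(4-6) by blast

lemma conn_tensorial_left:
  assumes "openin M W" "vector_field M A W Y" "p \<in> W"
  shows "tensorial_at p W (\<lambda>X. D X Y p h)"
proof (rule tensorial_atI)
  fix X Y' assume "vector_field M A W X" "\<And>q. q \<in> W \<Longrightarrow> Y' q = X q"
  then show "D Y' Y p h = D X Y p h"
    using conn_cong[OF assms(1) _ assms(2), of X Y' Y p] assms(3) by simp
qed (simp_all add: conn_add_left[OF assms(1) _ _ assms(2,3)] conn_scale_left[OF assms(1) _ assms(2) _ assms(3)])

end

context levi_civita_connection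
begin

lemma bracket_conn:
  assumes "openin M U" "vector_field M A U X" "vector_field M A U Y" "p \<in> U" "smooth_fun A U h"
  shows "X p (\<lambda>q. Y q h) - Y p (\<lambda>q. X q h) = D X Y p h - D Y X p h"
  using fun_cong[OF torsion_free[OF assms(1-4)], of h] smooth_atI[OF assms(1,4,5)]
  by (simp add: lie_bracket_def)

section \<open>Tensoriality of curvature and Hessian\<close>

text \<open>Torsion-freeness replaces the bracket by D X Y - D Y X. Curvature then consists of
  iterated \<open>D\<close> only, to which the rules for connections apply directly.\<close>

lemma curvature_eq:
  assumes U: "openin M U" and X: "vector_field M A U X" and Y: "vector_field M A U Y"
    and Z: "vector_field M A U Z" and p: "p \<in> U"
  shows "curvature M A D X Y Z p h = D X (D Y Z) p h - D Y (D X Z) p h - D (D X Y) Z p h + D (D Y X) Z p h"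
proof -
  have XY: "vector_field M A U (D X Y)" and YX: "vector_field M A U (D Y X)"
    using conn_vector_field U X Y by blast+
  have "D (lie_bracket M A X Y) Z p = D (\<lambda>q h. D X Y q h - D Y X q h) Z p"
    by (rule conn_cong[OF U vector_field_diff[OF XY YX] Z _ _ p]) (use torsion_free[OF U X Y] in auto)
  then show ?thesis
    using conn_diff_left[OF U XY YX Z p] by (simp add: curvature_def)
qed

lemma curvature_cong:
  assumes U: "openin M U" and X: "vector_field M A U X" and Y: "vector_field M A U Y"
    and Z: "vector_field M A U Z" and p: "p \<in> U"
    and eq: "\<And>q. q \<in> U \<Longrightarrow> X' q = X q" "\<And>q. q \<in> U \<Longrightarrow> Y' q = Y q" "\<And>q. q \<in> U \<Longrightarrow> Z' q = Z q"
  shows "curvature M A D X' Y' Z' p h = curvature M A D X Y Z p h"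
proof -
  note v = conn_vector_field[OF U]
  have X': "vector_field M A U X'" using vector_field_cong[OF U X eq(1)] .
  have Y': "vector_field M A U Y'" using vector_field_cong[OF U Y eq(2)] .
  have Z': "vector_field M A U Z'" using vector_field_cong[OF U Z eq(3)] .
  note c = conn_cong[OF U]
  have "D X' (D Y' Z') p = D X (D Y Z) p"
    by (rule c[OF X v[OF Y Z] eq(1) c[OF Y Z eq(2,3)] p])
  moreover have "D Y' (D X' Z') p = D Y (D X Z) p"
    by (rule c[OF Y v[OF X Z] eq(2) c[OF X Z eq(1,3)] p])
  moreover have "D (D X' Y') Z' p = D (D X Y) Z p"
    by (rule c[OF v[OF X Y] Z c[OF X Y eq(1,2)] eq(3) p])
  moreover have "D (D Y' X') Z' p = D (D Y X) Z p"
    by (rule c[OF v[OF Y X] Z c[OF Y X eq(2,1)] eq(3) p])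
  ultimately show ?thesis
    using curvature_eq[OF U X Y Z p] curvature_eq[OF U X' Y' Z' p] by simp
qed

lemma curvature_skew:
  assumes "openin M U" "vector_field M A U X" "vector_field M A U Y" "vector_field M A U Z" "p \<in> U"
  shows "curvature M A D Y X Z p h = - curvature M A D X Y Z p h"
  using curvature_eq[OF assms] curvature_eq[OF assms(1,3,2,4,5)] by simp

lemma curvature_vector_field:
  assumes U: "openin M U" and X: "vector_field M A U X" and Y: "vector_field M A U Y"
    and Z: "vector_field M A U Z"
  shows "vector_field M A U (curvature M A D X Y Z)"
proof (rule vector_field_cong[OF U])
  note v = conn_vector_field[OF U]
  show "vector_field M A U (\<lambda>q h. D X (D Y Z) q h - D Y (D X Z) q h - D (D X Y) Z q h + D (D Y X) Z q h)"
    by (intro vector_field_add vector_field_diff v X Y Z)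
qed (auto simp: curvature_eq[OF U X Y Z])

text \<open>When \<open>X\<close> is multiplied by \<open>k\<close>, the derivative of
  \<open>k\<close> enters as (Y k) D X Z twice, through D Y (D (k X) Z) and D (D Y (k X)) Z, with
  opposite signs in \<open>curvature_eq\<close>. The facts \<open>1\<close> to \<open>4\<close>
  expand the four terms of that formula.\<close>

lemma curvature_tensorial_1:
  assumes W: "openin M W" and Y: "vector_field M A W Y" and Z: "vector_field M A W Z" and p: "p \<in> W"
  shows "tensorial_at p W (\<lambda>X. curvature M A D X Y Z p h)"
proof (rule tensorial_atI)
  note v = conn_vector_field[OF W]
  note ladd = conn_add_left[OF W] and radd = conn_add_right[OF W]
    and lscale = conn_scale_left[OF W] and rscale = conn_leibniz[OF W]
  note c = conn_cong[OF W]
  {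
    fix X X' assume X: "vector_field M A W X" and X': "vector_field M A W X'"
    let ?S = "\<lambda>q h. X q h + X' q h"
    have S: "vector_field M A W ?S" using vector_field_add[OF X X'] .
    have 1: "D ?S (D Y Z) p = (\<lambda>h. D X (D Y Z) p h + D X' (D Y Z) p h)"
      by (rule ladd[OF X X' v[OF Y Z] p])
    have "D Y (D ?S Z) p = D Y (\<lambda>q h. D X Z q h + D X' Z q h) p"
      by (rule c[OF Y vector_field_add[OF v[OF X Z] v[OF X' Z]] refl ladd[OF X X' Z] p])
    also have "\<dots> = (\<lambda>h. D Y (D X Z) p h + D Y (D X' Z) p h)"
      by (rule radd[OF Y v[OF X Z] v[OF X' Z] p])
    finally have 2: "D Y (D ?S Z) p = \<dots>" .
    have "D (D ?S Y) Z p = D (\<lambda>q h. D X Y q h + D X' Y q h) Z p"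
      by (rule c[OF vector_field_add[OF v[OF X Y] v[OF X' Y]] Z ladd[OF X X' Y] refl p])
    also have "\<dots> = (\<lambda>h. D (D X Y) Z p h + D (D X' Y) Z p h)"
      by (rule ladd[OF v[OF X Y] v[OF X' Y] Z p])
    finally have 3: "D (D ?S Y) Z p = \<dots>" .
    have "D (D Y ?S) Z p = D (\<lambda>q h. D Y X q h + D Y X' q h) Z p"
      by (rule c[OF vector_field_add[OF v[OF Y X] v[OF Y X']] Z radd[OF Y X X'] refl p])
    also have "\<dots> = (\<lambda>h. D (D Y X) Z p h + D (D Y X') Z p h)"
      by (rule ladd[OF v[OF Y X] v[OF Y X'] Z p])
    finally have 4: "D (D Y ?S) Z p = \<dots>" .
    show "curvature M A D ?S Y Z p h = curvature M A D X Y Z p h + curvature M A D X' Y Z p h"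
      using curvature_eq[OF W S Y Z p] curvature_eq[OF W X Y Z p] curvature_eq[OF W X' Y Z p]
      by (simp add: 1 2 3 4)
  next
    fix k X assume k: "smooth_fun A W k" and X: "vector_field M A W X"
    let ?S = "\<lambda>q h. k q * X q h"
    have S: "vector_field M A W ?S" using vector_field_scale[OF k X] .
    have Yk: "smooth_fun A W (\<lambda>q. Y q k)" using vector_field_smooth[OF Y W k] .
    have 1: "D ?S (D Y Z) p = (\<lambda>h. k p * D X (D Y Z) p h)"
      by (rule lscale[OF X v[OF Y Z] k p])
    have "D Y (D ?S Z) p = D Y (\<lambda>q h. k q * D X Z q h) p"
      by (rule c[OF Y vector_field_scale[OF k v[OF X Z]] refl lscale[OF X Z k] p])
    also have "\<dots> = (\<lambda>h. Y p k * D X Z p h + k p * D Y (D X Z) p h)"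
      by (rule rscale[OF Y v[OF X Z] k p])
    finally have 2: "D Y (D ?S Z) p = \<dots>" .
    have "D (D ?S Y) Z p = D (\<lambda>q h. k q * D X Y q h) Z p"
      by (rule c[OF vector_field_scale[OF k v[OF X Y]] Z lscale[OF X Y k] refl p])
    also have "\<dots> = (\<lambda>h. k p * D (D X Y) Z p h)"
      by (rule lscale[OF v[OF X Y] Z k p])
    finally have 3: "D (D ?S Y) Z p = \<dots>" .
    have YX: "vector_field M A W (\<lambda>q h. k q * D Y X q h)" using vector_field_scale[OF k v[OF Y X]] .
    have YkX: "vector_field M A W (\<lambda>q h. Y q k * X q h)" using vector_field_scale[OF Yk X] .
    have "D (D Y ?S) Z p = D (\<lambda>q h. Y q k * X q h + k q * D Y X q h) Z p"
      by (rule c[OF vector_field_add[OF YkX YX] Z rscale[OF Y X k] refl p])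
    also have "\<dots> = (\<lambda>h. D (\<lambda>q h. Y q k * X q h) Z p h + D (\<lambda>q h. k q * D Y X q h) Z p h)"
      by (rule ladd[OF YkX YX Z p])
    also have "\<dots> = (\<lambda>h. Y p k * D X Z p h + k p * D (D Y X) Z p h)"
      using lscale[OF X Z Yk p] lscale[OF v[OF Y X] Z k p] by simp
    finally have 4: "D (D Y ?S) Z p = \<dots>" .
    show "curvature M A D ?S Y Z p h = k p * curvature M A D X Y Z p h"
      unfolding curvature_eq[OF W S Y Z p] curvature_eq[OF W X Y Z p]
      by (simp add: 1 2 3 4 algebra_simps)
  next
    fix X X' assume "vector_field M A W X" "\<And>q. q \<in> W \<Longrightarrow> X' q = X q"
    then show "curvature M A D X' Y Z p h = curvature M A D X Y Z p h"
      by (intro curvature_cong[OF W _ Y Z p]) simp_all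
  }
qed

text \<open>Inherited from the first slot by antisymmetry.\<close>

lemma curvature_tensorial_2:
  assumes W: "openin M W" and X: "vector_field M A W X" and Z: "vector_field M A W Z" and p: "p \<in> W"
  shows "tensorial_at p W (\<lambda>Y. curvature M A D X Y Z p h)"
proof (rule tensorial_atI)
  note T = curvature_tensorial_1[OF W X Z p, of h]
  note sk = curvature_skew[OF W X _ Z p, of _ h]
  {
    fix Y Y' assume Y: "vector_field M A W Y" and Y': "vector_field M A W Y'"
    show "curvature M A D X (\<lambda>q h. Y q h + Y' q h) Z p h = curvature M A D X Y Z p h + curvature M A D X Y' Z p h"
      using tensorial_add[OF T Y Y'] sk[OF Y] sk[OF Y'] sk[OF vector_field_add[OF Y Y']] by simp
  next
    fix k Y assume k: "smooth_fun A W k" and Y: "vector_field M A W Y"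
    show "curvature M A D X (\<lambda>q h. k q * Y q h) Z p h = k p * curvature M A D X Y Z p h"
      using tensorial_scale[OF T k Y] sk[OF Y] sk[OF vector_field_scale[OF k Y]] by simp
  next
    fix Y Y' assume "vector_field M A W Y" "\<And>q. q \<in> W \<Longrightarrow> Y' q = Y q"
    then show "curvature M A D X Y' Z p h = curvature M A D X Y Z p h"
      by (intro curvature_cong[OF W X _ Z p]) simp_all
  }
qed

text \<open>When \<open>Z\<close> is multiplied by \<open>k\<close>, the terms in X k and Y k from
  the second derivatives are symmetric in \<open>X\<close> and \<open>Y\<close> and cancel. What is
  left multiplying \<open>Z\<close> is X(Y k) - Y(X k) - (D X Y) k + (D Y X) k, which vanishes by
  \<open>bracket_conn\<close>.\<close>

lemma curvature_tensorial_3: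
  assumes W: "openin M W" and X: "vector_field M A W X" and Y: "vector_field M A W Y" and p: "p \<in> W"
  shows "tensorial_at p W (\<lambda>Z. curvature M A D X Y Z p h)"
proof (rule tensorial_atI)
  note v = conn_vector_field[OF W]
  note radd = conn_add_right[OF W] and rscale = conn_leibniz[OF W]
  note c = conn_cong[OF W]
  {
    fix Z Z' assume Z: "vector_field M A W Z" and Z': "vector_field M A W Z'"
    let ?S = "\<lambda>q h. Z q h + Z' q h"
    have S: "vector_field M A W ?S" using vector_field_add[OF Z Z'] .
    have *: "D X (D Y ?S) p = (\<lambda>h. D X (D Y Z) p h + D X (D Y Z') p h)"
      if X: "vector_field M A W X" and Y: "vector_field M A W Y" for X Y
    proof -
      have "D X (D Y ?S) p = D X (\<lambda>q h. D Y Z q h + D Y Z' q h) p"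
        by (rule c[OF X vector_field_add[OF v[OF Y Z] v[OF Y Z']] refl radd[OF Y Z Z'] p])
      then show ?thesis using radd[OF X v[OF Y Z] v[OF Y Z'] p] by simp
    qed
    show "curvature M A D X Y ?S p h = curvature M A D X Y Z p h + curvature M A D X Y Z' p h"
      using curvature_eq[OF W X Y S p] curvature_eq[OF W X Y Z p] curvature_eq[OF W X Y Z' p]
        *[OF X Y] *[OF Y X] radd[OF v[OF X Y] Z Z' p] radd[OF v[OF Y X] Z Z' p] by simp
  next
    fix k Z assume k: "smooth_fun A W k" and Z: "vector_field M A W Z"
    let ?S = "\<lambda>q h. k q * Z q h"
    have S: "vector_field M A W ?S" using vector_field_scale[OF k Z] .
    have *: "D X (D Y ?S) p h = X p (\<lambda>q. Y q k) * Z p h + Y p k * D X Z p h + X p k * D Y Z p h + k p * D X (D Y Z) p h"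
      if X: "vector_field M A W X" and Y: "vector_field M A W Y" for X Y
    proof -
      have Yk: "smooth_fun A W (\<lambda>q. Y q k)" using vector_field_smooth[OF Y W k] .
      have YZ: "vector_field M A W (\<lambda>q h. k q * D Y Z q h)" using vector_field_scale[OF k v[OF Y Z]] .
      have YkZ: "vector_field M A W (\<lambda>q h. Y q k * Z q h)" using vector_field_scale[OF Yk Z] .
      have "D X (D Y ?S) p = D X (\<lambda>q h. Y q k * Z q h + k q * D Y Z q h) p"
        by (rule c[OF X vector_field_add[OF YkZ YZ] refl rscale[OF Y Z k] p])
      then show ?thesis
        using radd[OF X YkZ YZ p] rscale[OF X Z Yk p] rscale[OF X v[OF Y Z] k p] by simp
    qed
    have b: "X p (\<lambda>q. Y q k) = Y p (\<lambda>q. X q k) + (D X Y p k - D Y X p k)"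
      using bracket_conn[OF W X Y p k] by simp
    show "curvature M A D X Y ?S p h = k p * curvature M A D X Y Z p h"
      unfolding curvature_eq[OF W X Y S p] curvature_eq[OF W X Y Z p]
        *[OF X Y] *[OF Y X] rscale[OF v[OF X Y] Z k p] rscale[OF v[OF Y X] Z k p]
      by (simp add: b algebra_simps)
  next
    fix Z Z' assume "vector_field M A W Z" "\<And>q. q \<in> W \<Longrightarrow> Z' q = Z q"
    then show "curvature M A D X Y Z' p h = curvature M A D X Y Z p h"
      by (intro curvature_cong[OF W X Y _ p]) simp_all
  }
qed

text \<open>Tensoriality exchanges the three picked extensions for the given fields, one slot at a
  time. From here on \<open>riemann\<close> can be computed with any convenient fields.\<close>

lemma riemann_eq:
  assumes W: "chart_nbhd p W" and X: "vector_field M A W X" and Y: "vector_field M A W Y"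
    and Z: "vector_field M A W Z"
  shows "riemann M A D p (X p) (Y p) (Z p) = curvature M A D X Y Z p"
proof
  fix h
  note t = vector_field_tangent[OF _ chart_nbhd_mem[OF W]]
  obtain V where V: "chart_nbhd p V" "V \<subseteq> W"
    and ext: "extend M A p (X p) p = X p" "vector_field M A V (extend M A p (X p))"
    "extend M A p (Y p) p = Y p" "vector_field M A V (extend M A p (Y p))"
    "extend M A p (Z p) p = Z p" "vector_field M A V (extend M A p (Z p))"
    using extend3E[OF W t[OF X] t[OF Y] t[OF Z]] .
  note s = vector_field_subset[OF _ V(2)]
  note o = chart_nbhd_open[OF V(1)] and p = chart_nbhd_mem[OF V(1)]
  have "riemann M A D p (X p) (Y p) (Z p) h =
      curvature M A D X (extend M A p (Y p)) (extend M A p (Z p)) p h"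
    unfolding riemann_def
    by (rule tensorial_point[OF V(1) curvature_tensorial_1[OF o ext(4,6) p] ext(2) s[OF X] ext(1)])
  also have "\<dots> = curvature M A D X Y (extend M A p (Z p)) p h"
    by (rule tensorial_point[OF V(1) curvature_tensorial_2[OF o s[OF X] ext(6) p] ext(4) s[OF Y] ext(3)])
  also have "\<dots> = curvature M A D X Y Z p h"
    by (rule tensorial_point[OF V(1) curvature_tensorial_3[OF o s[OF X] s[OF Y] p] ext(6) s[OF Z] ext(5)])
  finally show "riemann M A D p (X p) (Y p) (Z p) h = curvature M A D X Y Z p h" .
qed

lemma hessian_tensorial_1:
  assumes W: "openin M W" and Y: "vector_field M A W Y" and p: "p \<in> W"
  shows "tensorial_at p W (\<lambda>X. X p (\<lambda>q. Y q h) - D X Y p h)"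
proof (rule tensorial_atI)
  note T = conn_tensorial_left[OF W Y p, of h]
  show "X p (\<lambda>q. Y q h) + X' p (\<lambda>q. Y q h) - D (\<lambda>q h. X q h + X' q h) Y p h =
      X p (\<lambda>q. Y q h) - D X Y p h + (X' p (\<lambda>q. Y q h) - D X' Y p h)"
    if "vector_field M A W X" "vector_field M A W X'" for X X'
    using tensorial_add[OF T that] by simp
  show "k p * X p (\<lambda>q. Y q h) - D (\<lambda>q h. k q * X q h) Y p h = k p * (X p (\<lambda>q. Y q h) - D X Y p h)"
    if "smooth_fun A W k" "vector_field M A W X" for k X
    using tensorial_scale[OF T that] by (simp add: algebra_simps)
  show "X' p (\<lambda>q. Y q h) - D X' Y p h = X p (\<lambda>q. Y q h) - D X Y p h"
    if X: "vector_field M A W X" and e: "\<And>q. q \<in> W \<Longrightarrow> X' q = X q" for X X'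
    using tensorial_cong[OF T X e] e[OF p] by simp
qed

text \<open>Multiplying \<open>Y\<close> by \<open>k\<close> produces (X k)(Y h) both in the second
  derivative and in D X (k Y) h; the two cancel.\<close>

lemma hessian_tensorial_2:
  assumes W: "openin M W" and X: "vector_field M A W X" and p: "p \<in> W" and h: "smooth_fun A W h"
  shows "tensorial_at p W (\<lambda>Y. X p (\<lambda>q. Y q h) - D X Y p h)"
proof (rule tensorial_atI)
  note sm = vector_field_smooth[OF _ W h]
  {
    fix Y Y' assume Y: "vector_field M A W Y" and Y': "vector_field M A W Y'"
    show "X p (\<lambda>q. Y q h + Y' q h) - D X (\<lambda>q h. Y q h + Y' q h) p h =
       X p (\<lambda>q. Y q h) - D X Y p h + (X p (\<lambda>q. Y' q h) - D X Y' p h)"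
      using vector_field_scalar_add[OF X W p sm[OF Y] sm[OF Y']] conn_add_right[OF W X Y Y' p] by simp
  next
    fix k Y assume k: "smooth_fun A W k" and Y: "vector_field M A W Y"
    show "X p (\<lambda>q. k q * Y q h) - D X (\<lambda>q h. k q * Y q h) p h = k p * (X p (\<lambda>q. Y q h) - D X Y p h)"
      using vector_field_scalar_mult[OF X W p k sm[OF Y]] conn_leibniz[OF W X Y k p] by (simp add: algebra_simps)
  next
    fix Y Y' assume Y: "vector_field M A W Y" and e: "\<And>q. q \<in> W \<Longrightarrow> Y' q = Y q"
    have "X p (\<lambda>q. Y' q h) = X p (\<lambda>q. Y q h)"
      by (rule tangent_local[OF vector_field_tangent[OF X p] W p]) (simp add: e)
    then show "X p (\<lambda>q. Y' q h) - D X Y' p h = X p (\<lambda>q. Y q h) - D X Y p h"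
      using conn_cong[OF W X Y refl e p] by simp
  }
qed

lemma hessian_eq:
  assumes W: "chart_nbhd p W" and X: "vector_field M A W X" and Y: "vector_field M A W Y"
    and h: "smooth_fun A W h"
  shows "hessian M A D h p (X p) (Y p) = X p (\<lambda>q. Y q h) - D X Y p h"
proof -
  note t = vector_field_tangent[OF _ chart_nbhd_mem[OF W]]
  obtain V where V: "chart_nbhd p V" "V \<subseteq> W"
    and ext: "extend M A p (X p) p = X p" "vector_field M A V (extend M A p (X p))"
    "extend M A p (Y p) p = Y p" "vector_field M A V (extend M A p (Y p))"
    using extend3E[OF W t[OF X] t[OF Y] t[OF Y]] .
  note s = vector_field_subset[OF _ V(2)]
  note o = chart_nbhd_open[OF V(1)] and p = chart_nbhd_mem[OF V(1)]
  have "hessian M A D h p (X p) (Y p) = X p (\<lambda>q. extend M A p (Y p) q h) - D X (extend M A p (Y p)) p h"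
    unfolding hessian_def Let_def
    by (rule tensorial_point[OF V(1) hessian_tensorial_1[OF o ext(4) p] ext(2) s[OF X] ext(1)])
  also have "\<dots> = X p (\<lambda>q. Y q h) - D X Y p h"
    by (rule tensorial_point[OF V(1) hessian_tensorial_2[OF o s[OF X] p smooth_fun_subset[OF h V(2)]]
          ext(4) s[OF Y] ext(3)])
  finally show ?thesis .
qed

end

section \<open>Orthonormal bases and traces\<close>

context smooth_manifold
begin

definition linear_at :: "'a \<Rightarrow> ('a tangent \<Rightarrow> real) \<Rightarrow> bool" where
  "linear_at p B \<longleftrightarrow> (\<forall>u\<in>tangent_space M A p. \<forall>v\<in>tangent_space M A p. \<forall>a b.
     B (\<lambda>h. a * u h + b * v h) = a * B u + b * B v)"

lemma linear_atD:
  "linear_at p B \<Longrightarrow> u \<in> tangent_space M A p \<Longrightarrow> v \<in> tangent_space M A p \<Longrightarrow>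
    B (\<lambda>h. a * u h + b * v h) = a * B u + b * B v"
  unfolding linear_at_def by blast

lemma linear_at_zero:
  assumes "linear_at p B"
  shows "B (\<lambda>h. 0) = 0"
  using linear_atD[OF assms tangent_space_zero tangent_space_zero, of 0 0] by simp

lemma linear_at_scale:
  assumes "linear_at p B" "u \<in> tangent_space M A p"
  shows "B (\<lambda>h. a * u h) = a * B u"
proof -
  have "B (\<lambda>h. a * u h + 0 * u h) = a * B u + 0 * B u"
    using assms unfolding linear_at_def by blast
  then show ?thesis by simp
qed

lemma linear_at_diff:
  assumes "linear_at p B" "u \<in> tangent_space M A p" "v \<in> tangent_space M A p"
  shows "B (\<lambda>h. u h - v h) = B u - B v"
proof -
  have "B (\<lambda>h. 1 * u h + (- 1) * v h) = 1 * B u + (- 1) * B v"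
    using assms unfolding linear_at_def by blast
  then show ?thesis by simp
qed

lemma linear_at_sum:
  assumes B: "linear_at p B"
  shows "finite I \<Longrightarrow> (\<And>i. i \<in> I \<Longrightarrow> v i \<in> tangent_space M A p) \<Longrightarrow>
    B (\<lambda>h. \<Sum>i\<in>I. c i * v i h) = (\<Sum>i\<in>I. c i * B (v i))"
proof (induction I rule: finite_induct)
  case empty
  then show ?case using linear_at_zero[OF B] by simp
next
  case (insert i I)
  have "(\<lambda>h. \<Sum>i\<in>I. c i * v i h) \<in> tangent_space M A p"
    using insert by (intro tangent_space_sum tangent_space_scale) auto
  then have "B (\<lambda>h. c i * v i h + 1 * (\<Sum>i\<in>I. c i * v i h)) = c i * B (v i) + 1 * B (\<lambda>h. \<Sum>i\<in>I. c i * v i h)"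
    using insert by (intro linear_atD[OF B]) auto
  then show ?case using insert by simp
qed

end

context riemannian_manifold
begin

lemma metric_linear_left:
  assumes "p \<in> topspace M" "w \<in> tangent_space M A p"
  shows "linear_at p (\<lambda>u. g p u w)"
  unfolding linear_at_def by (intro ballI allI metric_linear assms)

lemma metric_linear_right:
  assumes "p \<in> topspace M" "w \<in> tangent_space M A p"
  shows "linear_at p (g p w)"
  unfolding linear_at_def
proof (intro ballI allI)
  fix u v a b assume u: "u \<in> tangent_space M A p" and v: "v \<in> tangent_space M A p"
  have "(\<lambda>h. a * u h + b * v h) \<in> tangent_space M A p"
    by (intro tangent_space_add tangent_space_scale u v)
  then show "g p w (\<lambda>h. a * u h + b * v h) = a * g p w u + b * g p w v"
    using metric_sym[OF assms(1) assms(2)] metric_linear[OF assms(1) u v assms(2)] u v by simp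
qed

text \<open>That the family spans is a dimension count. \<open>L\<close> sends coefficients to the
  chart components of the combination; inner products with \<open>e\<close> recover the
  coefficients, so \<open>L\<close> is an injective endomorphism of a finite-dimensional space and
  hence onto.\<close>

lemma orthonormal_expansion:
  fixes e :: "'n \<Rightarrow> 'a tangent"
  assumes p: "p \<in> topspace M" and e: "orthonormal_basis M A g p e" and w: "w \<in> tangent_space M A p"
  shows "w = (\<lambda>h. \<Sum>i\<in>UNIV. g p w (e i) * e i h)"
proof -
  obtain U x where c: "(U, x) \<in> A" and pU: "p \<in> U" using p cover by fastforce
  note coord = tangent_coord_expansion[OF c pU]
  have eT: "e i \<in> tangent_space M A p" and eo: "g p (e i) (e j) = (if i = j then 1 else 0)" for i j
    using e unfolding orthonormal_basis_def by auto
  let ?u = "\<lambda>c :: real^'n. \<lambda>h. \<Sum>i\<in>UNIV. c $ i * e i h"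
  have uT: "?u c \<in> tangent_space M A p" for c
    by (intro tangent_space_sum tangent_space_scale eT) auto
  have gu: "g p (?u c) (e i) = c $ i" for c i
    using linear_at_sum[OF metric_linear_left[OF p eT[of i]], of UNIV e "\<lambda>i. c $ i"] eT
    by (simp add: eo if_distrib cong: if_cong)
  define L where "L = (\<lambda>c :: real^'n. (\<chi> j. ?u c (\<lambda>r. x r $ j)) :: real^'n)"
  have L: "linear L"
    by (rule linearI) (auto simp: L_def vec_eq_iff sum.distrib sum_distrib_left algebra_simps)
  have "c = 0" if "L c = 0" for c
  proof -
    have "?u c (\<lambda>r. x r $ j) = 0" for j using that unfolding L_def by (simp add: vec_eq_iff)
    then have "(\<Sum>j\<in>UNIV. ?u c (\<lambda>r. x r $ j) * coord_field U x j p h) = 0" for h by simp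
    then have "?u c = (\<lambda>h. 0)" by (intro ext trans[OF coord[OF uT]])
    then have "c $ i = 0" for i
      using gu[of c i] linear_at_zero[OF metric_linear_left[OF p eT[of i]]] by simp
    then show ?thesis by (simp add: vec_eq_iff)
  qed
  then have "inj L" using linear_injective_0[OF L] by blast
  then have "surj L" using linear_injective_imp_surjective[OF L] by blast
  then obtain c where Lc: "(\<chi> j. w (\<lambda>r. x r $ j)) = L c" by (metis surjD)
  then have *: "w (\<lambda>r. x r $ j) = ?u c (\<lambda>r. x r $ j)" for j unfolding L_def by (simp add: vec_eq_iff)
  have "w h = ?u c h" for h
  proof -
    have "w h = (\<Sum>j\<in>UNIV. w (\<lambda>r. x r $ j) * coord_field U x j p h)" by (rule coord[OF w])
    also have "\<dots> = ?u c h" unfolding * by (rule coord[OF uT, symmetric])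
    finally show ?thesis .
  qed
  then have "w = ?u c" by blast
  then show ?thesis using gu[of c] by simp
qed

text \<open>The basis picked by \<open>SOME\<close> differs from \<open>e\<close> by an orthogonal
  matrix, and traces are invariant under it.\<close>

lemma metric_trace_eq:
  fixes e :: "'n \<Rightarrow> 'a tangent"
  assumes p: "p \<in> topspace M" and e: "orthonormal_basis M A g p e"
    and B1: "\<And>w. w \<in> tangent_space M A p \<Longrightarrow> linear_at p (\<lambda>u. B u w)"
    and B2: "\<And>u. u \<in> tangent_space M A p \<Longrightarrow> linear_at p (B u)"
  shows "metric_trace M A g p B = (\<Sum>i\<in>UNIV. B (e i) (e i))"
proof -
  define e' :: "'n \<Rightarrow> 'a tangent" where "e' = (SOME e. orthonormal_basis M A g p e)"
  have e': "orthonormal_basis M A g p e'" unfolding e'_def by (rule someI[of "orthonormal_basis M A g p", OF e])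
  have eT: "e i \<in> tangent_space M A p" and eo: "g p (e i) (e j) = (if i = j then 1 else 0)" for i j
    using e unfolding orthonormal_basis_def by auto
  have eT': "e' i \<in> tangent_space M A p" for i
    using e' unfolding orthonormal_basis_def by auto
  let ?P = "\<lambda>i j. g p (e' i) (e j)"
  have exp: "e' i = (\<lambda>h. \<Sum>j\<in>UNIV. ?P i j * e j h)" for i by (rule orthonormal_expansion[OF p e eT'])
  have BB: "B (e' i) (e' i) = (\<Sum>j\<in>UNIV. \<Sum>k\<in>UNIV. ?P i j * ?P i k * B (e j) (e k))" for i
  proof -
    have "B (e' i) (e' i) = B (\<lambda>h. \<Sum>j\<in>UNIV. ?P i j * e j h) (e' i)" using exp[of i] by simp
    also have "\<dots> = (\<Sum>j\<in>UNIV. ?P i j * B (e j) (e' i))"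
      using linear_at_sum[OF B1[OF eT'[of i]], of UNIV e] eT by simp
    also have "\<dots> = (\<Sum>j\<in>UNIV. ?P i j * B (e j) (\<lambda>h. \<Sum>k\<in>UNIV. ?P i k * e k h))"
      using exp[of i] by simp
    also have "\<dots> = (\<Sum>j\<in>UNIV. ?P i j * (\<Sum>k\<in>UNIV. ?P i k * B (e j) (e k)))"
      using linear_at_sum[OF B2[OF eT], of UNIV e] eT by simp
    finally show ?thesis by (simp add: sum_distrib_left mult.assoc)
  qed
  \<comment> \<open>Expanding \<open>e\<close> in \<open>e'\<close>, and not conversely, gives
    orthogonality of the columns of the matrix, which is the relation that the double sum
    contains.\<close>
  have PP: "(\<Sum>i\<in>UNIV. ?P i j * ?P i k) = (if j = k then 1 else 0)" for j k
  proof -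
    have "g p (e j) (e k) = g p (\<lambda>h. \<Sum>i\<in>UNIV. g p (e j) (e' i) * e' i h) (e k)"
      using orthonormal_expansion[OF p e' eT[of j]] by simp
    also have "\<dots> = (\<Sum>i\<in>UNIV. g p (e j) (e' i) * ?P i k)"
      using linear_at_sum[OF metric_linear_left[OF p eT[of k]], of UNIV e'] eT' by simp
    finally show ?thesis using eo[of j k] metric_sym[OF p eT[of j] eT'] by simp
  qed
  have "metric_trace M A g p B = (\<Sum>i\<in>UNIV. B (e' i) (e' i))"
    unfolding metric_trace_def e'_def Let_def by simp
  also have "\<dots> = (\<Sum>j\<in>UNIV. \<Sum>k\<in>UNIV. \<Sum>i\<in>UNIV. ?P i j * ?P i k * B (e j) (e k))"
    unfolding BB by (subst sum.swap, rule sum.cong[OF refl], rule sum.swap)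
  also have "\<dots> = (\<Sum>j\<in>UNIV. \<Sum>k\<in>UNIV. (if j = k then 1 else 0) * B (e j) (e k))"
    by (simp only: sum_distrib_right[symmetric] PP)
  finally show ?thesis by (simp add: if_distrib[of "\<lambda>c. c * _"] cong: if_cong)
qed

text \<open>The orthonormal expansion yields existence and uniqueness behind \<open>THE\<close>: a
  vector is determined by its inner products with the basis.\<close>

lemma gradient_eq:
  fixes e :: "'n \<Rightarrow> 'a tangent"
  assumes p: "p \<in> topspace M" and e: "orthonormal_basis M A g p e"
  shows "gradient M A g h p = (\<lambda>k. \<Sum>i\<in>UNIV. e i h * e i k)"
  unfolding gradient_def
proof (rule the_equality)
  have eT: "e i \<in> tangent_space M A p" for i
    using e unfolding orthonormal_basis_def by auto
  let ?v = "\<lambda>k. \<Sum>i\<in>UNIV. e i h * e i k"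
  show "?v \<in> tangent_space M A p \<and> (\<forall>w\<in>tangent_space M A p. g p ?v w = differential h p w)"
  proof (intro conjI ballI)
    show "?v \<in> tangent_space M A p" by (intro tangent_space_sum tangent_space_scale eT) auto
    fix w assume w: "w \<in> tangent_space M A p"
    have "g p ?v w = (\<Sum>i\<in>UNIV. e i h * g p (e i) w)"
      using linear_at_sum[OF metric_linear_left[OF p w], of UNIV e] eT by simp
    also have "\<dots> = w h"
      using fun_cong[OF orthonormal_expansion[OF p e w], of h] metric_sym[OF p eT w] by (simp add: mult.commute)
    finally show "g p ?v w = differential h p w" by (simp add: differential_def)
  qed
  fix v assume v: "v \<in> tangent_space M A p \<and> (\<forall>w\<in>tangent_space M A p. g p v w = differential h p w)"
  then have "v = (\<lambda>k. \<Sum>i\<in>UNIV. g p v (e i) * e i k)" using orthonormal_expansion[OF p e] by blast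
  then show "v = ?v" using v eT by (simp add: differential_def)
qed

lemma metric_gradient:
  fixes e :: "'n \<Rightarrow> 'a tangent"
  assumes p: "p \<in> topspace M" and e: "orthonormal_basis M A g p e"
  shows "g p (gradient M A g h p) (gradient M A g k p) = (\<Sum>i\<in>UNIV. e i h * e i k)"
proof -
  have eT: "e i \<in> tangent_space M A p" and eo: "g p (e i) (e j) = (if i = j then 1 else 0)" for i j
    using e unfolding orthonormal_basis_def by auto
  let ?v = "\<lambda>k l. \<Sum>i\<in>UNIV. e i k * e i l"
  have vT: "?v k \<in> tangent_space M A p" for k
    by (intro tangent_space_sum tangent_space_scale eT) auto
  have "g p (?v h) (?v k) = (\<Sum>i\<in>UNIV. e i h * g p (e i) (?v k))"
    using linear_at_sum[OF metric_linear_left[OF p vT], of UNIV e] eT by simp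
  also have "\<dots> = (\<Sum>i\<in>UNIV. e i h * e i k)"
    using linear_at_sum[OF metric_linear_right[OF p eT], of UNIV e] eT
    by (simp add: eo if_distrib cong: if_cong)
  finally show ?thesis by (simp add: gradient_eq[OF p e])
qed

end

section \<open>Normal orthonormal frames\<close>

context affine_connection
begin

lemma conn_sum_right:
  assumes U: "openin M U" and X: "vector_field M A U X" and p: "p \<in> U"
  shows "finite I \<Longrightarrow> (\<And>i. i \<in> I \<Longrightarrow> smooth_fun A U (k i)) \<Longrightarrow> (\<And>i. i \<in> I \<Longrightarrow> vector_field M A U (Y i)) \<Longrightarrow>
    D X (\<lambda>q h. \<Sum>i\<in>I. k i q * Y i q h) p h = (\<Sum>i\<in>I. X p (k i) * Y i p h + k i p * D X (Y i) p h)"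
proof (induction I rule: finite_induct)
  case empty
  \<comment> \<open>The empty combination is the zero field, taken as its own difference with
    itself.\<close>
  show ?case using conn_diff_right[OF U X vector_field_zero vector_field_zero p] by simp
next
  case (insert i I)
  have "D X (\<lambda>q h. k i q * Y i q h + (\<Sum>i\<in>I. k i q * Y i q h)) p h =
      D X (\<lambda>q h. k i q * Y i q h) p h + D X (\<lambda>q h. \<Sum>i\<in>I. k i q * Y i q h) p h"
    using insert
    by (intro fun_cong[OF conn_add_right[OF U X _ _ p]] vector_field_scale vector_field_sum) auto
  then show ?case using insert conn_leibniz[OF U X _ _ p, of "Y i" "k i"] by simp
qed

end

context levi_civita_connection
begin

lemma parallel_inner:
  assumes U: "openin M U" and X: "vector_field M A U X" and Y: "vector_field M A U Y"
    and Z: "vector_field M A U Z" and p: "p \<in> U"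
    and par: "D X Y p = (\<lambda>h. 0)" "D X Z p = (\<lambda>h. 0)"
  shows "X p (\<lambda>q. g q (Y q) (Z q)) = 0"
proof -
  have top: "p \<in> topspace M" using U p openin_subset by blast
  note t = vector_field_tangent[OF _ p]
  show ?thesis
    using metric_compatible[OF U X Y Z p] par
      linear_at_zero[OF metric_linear_left[OF top t[OF Z]]]
      linear_at_zero[OF metric_linear_right[OF top t[OF Y]]] by simp
qed

text \<open>Differentiate r^2 h = 1 for r = h^(-1/2): since X h = 0 at \<open>p\<close>, this leaves
  2 r h (X r) = 0.\<close>

lemma parallel_rsqrt:
  assumes U: "openin M U" and X: "vector_field M A U X" and p: "p \<in> U"
    and h: "smooth_fun A U h" "\<And>q. q \<in> U \<Longrightarrow> h q > 0" and par: "X p h = 0"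
  shows "X p (\<lambda>q. 1 / sqrt (h q)) = 0"
proof -
  let ?r = "\<lambda>q. 1 / sqrt (h q)"
  have top: "p \<in> topspace M" using U p openin_subset by blast
  have r: "smooth_fun A U ?r" by (rule smooth_fun_rsqrt[OF U h])
  note m = vector_field_scalar_mult[OF X U p]
  have rr: "smooth_fun A U (\<lambda>q. ?r q * ?r q)" using smooth_fun_mult[OF U r r] .
  have "X p (\<lambda>q. (?r q * ?r q) * h q) = X p (\<lambda>q. 1)"
    by (rule tangent_local[OF vector_field_tangent[OF X p] U p]) (use h(2) in \<open>force simp: field_simps\<close>)
  also have "\<dots> = 0" by (rule tangent_const[OF vector_field_tangent[OF X p] top])
  finally have "2 * ?r p * h p * X p ?r = 0"
    unfolding m[OF rr h(1)] m[OF r r] using par by (simp add: algebra_simps)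
  moreover have "2 * ?r p * h p \<noteq> 0" using h(2)[OF p] by simp
  ultimately show ?thesis by simp
qed

text \<open>Correcting the coordinate frame by functions vanishing at \<open>p\<close> makes it parallel at \<open>p\<close>, and the
  Gram-Schmidt process preserves this because inner products of fields that are parallel at \<open>p\<close> have
  vanishing derivative there.\<close>

lemma parallel_coord_frame:
  assumes c: "(U, x) \<in> A" and p: "p \<in> U"
  obtains F :: "'n \<Rightarrow> 'a vfield" where "\<And>i. vector_field M A U (F i)" "\<And>i. F i p = coord_field U x i p"
    "\<And>l i. D (coord_field U x l) (F i) p = (\<lambda>h. 0)"
proof
  let ?d = "coord_field U x"
  note U = chart_open[OF c]
  note d = coord_field_vector_field[OF c]
  have top: "p \<in> topspace M" using U p openin_subset by blast
  \<comment> \<open>Christoffel symbols at \<open>p\<close>, read off by applying the covariant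
    derivative to the coordinates. Each \<open>k i j\<close> vanishes at \<open>p\<close> and has
    the symbols as partials there, so its Leibniz term cancels the derivative of the coordinate
    field.\<close>
  define \<Gamma> where "\<Gamma> l i j = D (?d l) (?d i) p (\<lambda>r. x r $ j)" for l i j
  define k where "k i j q = (\<Sum>l\<in>UNIV. \<Gamma> l i j * (x q $ l - x p $ l))" for i j q
  define F where "F i q h = ?d i q h - (\<Sum>j\<in>UNIV. k i j q * ?d j q h)" for i q h
  have x: "smooth_fun A U (\<lambda>q. x q $ l - x p $ l)" for l
    by (intro smooth_fun_diff[OF U] smooth_fun_coord[OF c]) auto
  have xg: "smooth_fun A U (\<lambda>q. \<Gamma> l i j * (x q $ l - x p $ l))" for l i j
    by (intro smooth_fun_mult[OF U] x) auto
  have k: "smooth_fun A U (k i j)" for i j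
    unfolding k_def by (intro smooth_fun_sum[OF U] xg) auto
  have s: "vector_field M A U (\<lambda>q h. \<Sum>j\<in>UNIV. k i j q * ?d j q h)" for i
    by (intro vector_field_sum k d) auto
  have kp: "k i j p = 0" for i j unfolding k_def by simp
  note t = vector_field_tangent[OF d p]
  have dx: "?d l p (\<lambda>q. x q $ l' - x p $ l') = (if l = l' then 1 else 0)" for l l'
    using tangent_diff[OF t smooth_atI[OF U p smooth_fun_coord[OF c]] smooth_at_const[OF top]]
      coord_field_coord[OF c p] tangent_const[OF t top] by simp
  have dk: "?d l p (k i j) = \<Gamma> l i j" for l i j
  proof -
    have "?d l p (k i j) = (\<Sum>l'\<in>UNIV. ?d l p (\<lambda>q. \<Gamma> l' i j * (x q $ l' - x p $ l')))"
      unfolding k_def by (rule tangent_sum[OF t top]) (auto intro: smooth_atI[OF U p xg])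
    also have "\<dots> = (\<Sum>l'\<in>UNIV. \<Gamma> l' i j * (if l = l' then 1 else 0))"
      using tangent_scale[OF t smooth_atI[OF U p x]] dx by simp
    finally show ?thesis by (simp add: if_distrib cong: if_cong)
  qed
  show "vector_field M A U (F i)" for i
    unfolding F_def using vector_field_diff[OF d s] .
  show "F i p = ?d i p" for i unfolding F_def by (simp add: kp)
  show "D (?d l) (F i) p = (\<lambda>h. 0)" for l i
  proof
    fix h
    have "D (?d l) (F i) p h = D (?d l) (?d i) p h - D (?d l) (\<lambda>q h. \<Sum>j\<in>UNIV. k i j q * ?d j q h) p h"
      unfolding F_def using conn_diff_right[OF U d d s p] .
    also have "D (?d l) (\<lambda>q h. \<Sum>j\<in>UNIV. k i j q * ?d j q h) p h = (\<Sum>j\<in>UNIV. \<Gamma> l i j * ?d j p h)"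
      unfolding conn_sum_right[OF U d p finite k d] by (simp add: dk kp)
    also have "\<dots> = D (?d l) (?d i) p h"
      using tangent_coord_expansion[OF c p vector_field_tangent[OF conn_vector_field[OF U d d] p]]
      unfolding \<Gamma>_def by metis
    finally show "D (?d l) (F i) p h = 0" by simp
  qed
qed

text \<open>\<open>J\<close> holds the indices already orthonormalised; inserting one may shrink
  \<open>W\<close>. Independence is carried along at \<open>p\<close> only, where it ensures that
  the next vector to be normalised is nonzero.\<close>

lemma parallel_gram_schmidt:
  fixes J :: "'n set"
  assumes c: "(U, x) \<in> A" and p: "p \<in> U"
  shows "\<exists>W (E :: 'n \<Rightarrow> 'a vfield). openin M W \<and> p \<in> W \<and> W \<subseteq> U \<and> (\<forall>i. vector_field M A W (E i)) \<and>
    (\<forall>l i. D (coord_field U x l) (E i) p = (\<lambda>h. 0)) \<and>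
    (\<forall>a. (\<lambda>h. \<Sum>i\<in>UNIV. a i * E i p h) = (\<lambda>h. 0) \<longrightarrow> (\<forall>i. a i = 0)) \<and>
    (\<forall>q\<in>W. \<forall>i\<in>J. \<forall>j\<in>J. g q (E i q) (E j q) = (if i = j then 1 else 0))"
proof (induction J rule: finite_induct[OF finite])
  let ?d = "coord_field U x"
  note d = coord_field_vector_field[OF c]
  {
    case 1
    obtain F where F: "\<And>i. vector_field M A U (F i)" "\<And>i. F i p = ?d i p"
      "\<And>l i. D (?d l) (F i) p = (\<lambda>h. 0)" by (rule parallel_coord_frame[OF c p]) (rule that)
    have "a j = 0" if "(\<lambda>h. \<Sum>i\<in>UNIV. a i * F i p h) = (\<lambda>h. 0)" for a j
      using fun_cong[OF that, of "\<lambda>r. x r $ j"] by (simp add: F(2) coord_field_coord[OF c p] if_distrib cong: if_cong)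
    then show ?case using F chart_open[OF c] p by (intro exI[of _ U] exI[of _ F]) auto
  next
    case (2 k J)
    then obtain W and E :: "'n \<Rightarrow> 'a vfield" where W: "openin M W" "p \<in> W" "W \<subseteq> U"
      and E: "\<And>i. vector_field M A W (E i)" and par: "\<And>l i. D (?d l) (E i) p = (\<lambda>h. 0)"
      and ind: "\<And>a i. (\<lambda>h. \<Sum>i\<in>UNIV. a i * E i p h) = (\<lambda>h. 0) \<Longrightarrow> a i = 0"
      and orth: "\<And>q i j. q \<in> W \<Longrightarrow> i \<in> J \<Longrightarrow> j \<in> J \<Longrightarrow> g q (E i q) (E j q) = (if i = j then 1 else 0)"
      by blast
    have top: "q \<in> topspace M" if "q \<in> W" for q using W(1) that openin_subset by blast
    have dW: "vector_field M A W (?d l)" for l by (rule vector_field_subset[OF d W(3)])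
    define a where "a j q = g q (E k q) (E j q)" for j q
    have a: "smooth_fun A W (a j)" for j unfolding a_def by (rule metric_smooth[OF W(1) E E])
    define Y where "Y q h = E k q h - (\<Sum>j\<in>J. a j q * E j q h)" for q h
    have s: "vector_field M A W (\<lambda>q h. \<Sum>j\<in>J. a j q * E j q h)"
      by (intro vector_field_sum a E) auto
    have Y: "vector_field M A W Y" unfolding Y_def by (rule vector_field_diff[OF E s])
    have parY: "D (?d l) Y p = (\<lambda>h. 0)" for l
    proof
      fix h
      have "D (?d l) Y p h = D (?d l) (E k) p h - D (?d l) (\<lambda>q h. \<Sum>j\<in>J. a j q * E j q h) p h"
        unfolding Y_def using conn_diff_right[OF W(1) dW E s W(2)] .
      also have "D (?d l) (\<lambda>q h. \<Sum>j\<in>J. a j q * E j q h) p h = 0"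
        unfolding conn_sum_right[OF W(1) dW W(2) finite a E]
        using parallel_inner[OF W(1) dW E E W(2) par par] by (simp add: a_def[abs_def] par)
      finally show "D (?d l) Y p h = 0" by (simp add: par)
    qed
    define n where "n q = g q (Y q) (Y q)" for q
    have n: "smooth_fun A W n" unfolding n_def by (rule metric_smooth[OF W(1) Y Y])
    \<comment> \<open>Written over all indices, \<open>Y\<close> has coefficient 1 at
      \<open>k\<close>, because \<open>k\<close> is outside \<open>J\<close>. Independence at
      \<open>p\<close> thus excludes Y p = 0.\<close>
    have Yexp: "Y q h = (\<Sum>i\<in>UNIV. ((if i = k then 1 else 0) - (if i \<in> J then a i q else 0)) * E i q h)" for q h
      unfolding Y_def by (simp add: left_diff_distrib sum_subtractf if_distrib[of "\<lambda>c. c * _"]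
          sum.If_cases cong: if_cong)
    have "Y p \<noteq> (\<lambda>h. 0)"
    proof
      assume "Y p = (\<lambda>h. 0)"
      then have "(\<lambda>h. \<Sum>i\<in>UNIV. ((if i = k then 1 else 0) - (if i \<in> J then a i p else 0)) * E i p h) = (\<lambda>h. 0)"
        by (simp add: Yexp fun_eq_iff)
      from ind[OF this, of k] show False using \<open>k \<notin> J\<close> by simp
    qed
    then have np: "n p > 0"
      unfolding n_def using metric_pos[OF top[OF W(2)] vector_field_tangent[OF Y W(2)]] by blast
    define W' where "W' = {q \<in> W. n q > 0}"
    have W': "openin M W'" "p \<in> W'" "W' \<subseteq> W"
      unfolding W'_def using smooth_fun_positive_open[OF c W(1,3) n] np W(2) by auto
    define r where "r q = 1 / sqrt (n q)" for q
    have n': "smooth_fun A W' n" by (rule smooth_fun_subset[OF n W'(3)])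
    have npos: "q \<in> W' \<Longrightarrow> n q > 0" for q unfolding W'_def by simp
    have r: "smooth_fun A W' r" unfolding r_def by (rule smooth_fun_rsqrt[OF W'(1) n' npos])
    have Y': "vector_field M A W' Y" by (rule vector_field_subset[OF Y W'(3)])
    have dW': "vector_field M A W' (?d l)" for l by (rule vector_field_subset[OF dW W'(3)])
    have "?d l p n = 0" for l
      unfolding n_def[abs_def] by (rule parallel_inner[OF W(1) dW Y Y W(2) parY parY])
    then have dr: "?d l p r = 0" for l
      unfolding r_def[abs_def] by (intro parallel_rsqrt[OF W'(1) dW' W'(2) n' npos])
    define Z where "Z q h = r q * Y q h" for q h
    have Z: "vector_field M A W' Z" unfolding Z_def by (rule vector_field_scale[OF r Y'])
    have parZ: "D (?d l) Z p = (\<lambda>h. 0)" for l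
      unfolding Z_def conn_leibniz[OF W'(1) dW' Y' r W'(2)] by (simp add: dr parY)
    have rp: "r p > 0" unfolding r_def using np by simp
    define E' where "E' = E(k := Z)"
    have ind': "b i = 0" if b: "(\<lambda>h. \<Sum>i\<in>UNIV. b i * E' i p h) = (\<lambda>h. 0)" for b i
    proof -
      \<comment> \<open>Coefficients in the old frame of the given combination of the new one. At
        \<open>k\<close> they reduce to b k * r p, so b k = 0, and then the others are the b i
        themselves.\<close>
      let ?b = "\<lambda>i. (if i = k then 0 else b i) +
        b k * r p * ((if i = k then 1 else 0) - (if i \<in> J then a i p else 0))"
      have "(\<Sum>i\<in>UNIV. ?b i * E i p h) = (\<Sum>i\<in>UNIV. b i * E' i p h)" for h
      proof -
        have "(\<Sum>i\<in>UNIV. ?b i * E i p h) = (\<Sum>i\<in>UNIV. (if i = k then 0 else b i) * E i p h) + b k * r p * Y p h"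
          unfolding Yexp sum_distrib_left sum.distrib[symmetric] by (rule sum.cong) (simp_all add: algebra_simps)
        also have "\<dots> = (\<Sum>i\<in>UNIV. (if i = k then 0 else b i) * E i p h) + b k * Z p h"
          by (simp add: Z_def)
        also have "\<dots> = (\<Sum>i\<in>UNIV. (if i = k then 0 else b i) * E i p h + (if i = k then b k * Z p h else 0))"
          by (simp add: sum.distrib)
        also have "\<dots> = (\<Sum>i\<in>UNIV. b i * E' i p h)"
          by (rule sum.cong) (auto simp: E'_def)
        finally show ?thesis .
      qed
      then have z: "(\<lambda>h. \<Sum>i\<in>UNIV. ?b i * E i p h) = (\<lambda>h. 0)" using b by simp
      from ind[OF z, of k] have "b k = 0" using rp \<open>k \<notin> J\<close> by simp
      then show ?thesis using ind[OF z, of i] by (cases "i = k") auto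
    qed
    have orth': "g q (E' i q) (E' j q) = (if i = j then 1 else 0)"
      if q: "q \<in> W'" and i: "i \<in> insert k J" and j: "j \<in> insert k J" for q i j
    proof -
      have qW: "q \<in> W" using q W'(3) by blast
      note tq = vector_field_tangent[OF _ qW]
      have YE: "g q (Y q) (E j q) = 0" if "j \<in> J" for j
      proof -
        have "g q (Y q) (E j q) = g q (E k q) (E j q) - g q (\<lambda>h. \<Sum>j\<in>J. a j q * E j q h) (E j q)"
          unfolding Y_def using linear_at_diff[OF metric_linear_left[OF top[OF qW] tq[OF E]] tq[OF E] tq[OF s]] .
        also have "g q (\<lambda>h. \<Sum>j\<in>J. a j q * E j q h) (E j q) = (\<Sum>i\<in>J. a i q * g q (E i q) (E j q))"
          using linear_at_sum[OF metric_linear_left[OF top[OF qW] tq[OF E]] finite tq[OF E]] .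
        also have "\<dots> = (\<Sum>i\<in>J. if i = j then a i q else 0)"
          using that by (intro sum.cong) (auto simp: orth[OF qW])
        also have "\<dots> = a j q" using that by simp
        finally show ?thesis by (simp add: a_def)
      qed
      have ZE: "g q (Z q) (E j q) = 0" if "j \<in> J" for j
        unfolding Z_def using linear_at_scale[OF metric_linear_left[OF top[OF qW] tq[OF E]] tq[OF Y]] YE[OF that]
        by simp
      have EZ: "g q (E j q) (Z q) = 0" if "j \<in> J" for j
        using ZE[OF that] metric_sym[OF top[OF qW] tq[OF E] vector_field_tangent[OF Z q]] by simp
      have "g q (Z q) (Z q) = r q * g q (Y q) (Z q)"
        unfolding Z_def[of q] using linear_at_scale[OF metric_linear_left[OF top[OF qW] vector_field_tangent[OF Z q]] tq[OF Y]]
        unfolding Z_def[of q] .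
      also have "g q (Y q) (Z q) = r q * n q"
        unfolding Z_def n_def using linear_at_scale[OF metric_linear_right[OF top[OF qW] tq[OF Y]] tq[OF Y]] .
      also have "r q * (r q * n q) = 1" unfolding r_def using npos[OF q] by (simp add: field_simps)
      finally have ZZ: "g q (Z q) (Z q) = 1" .
      show ?thesis using i j ZE EZ ZZ orth[OF qW] \<open>k \<notin> J\<close> unfolding E'_def by auto
    qed
    have E': "vector_field M A W' (E' i)" for i
      using Z vector_field_subset[OF E W'(3)] by (simp add: E'_def)
    have par': "D (?d l) (E' i) p = (\<lambda>h. 0)" for l i using parZ par by (simp add: E'_def)
    show ?case
      using W' W(3) E' par' ind' orth' by (intro exI[of _ W'] exI[of _ E']) blast
  }
qed

text \<open>Gram-Schmidt over all indices; tensoriality in the direction of differentiation passes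
  from coordinate fields to arbitrary \<open>X\<close>.\<close>

lemma normal_frame:
  assumes "p \<in> topspace M"
  obtains W and E :: "'n \<Rightarrow> 'a vfield" where "chart_nbhd p W" "\<And>i. vector_field M A W (E i)"
    "\<And>q. q \<in> W \<Longrightarrow> orthonormal_basis M A g q (\<lambda>i. E i q)"
    "\<And>X i h. vector_field M A W X \<Longrightarrow> D X (E i) p h = 0"
proof -
  obtain U x where c: "(U, x) \<in> A" and p: "p \<in> U" using assms cover by fastforce
  let ?d = "coord_field U x"
  obtain W and E :: "'n \<Rightarrow> 'a vfield" where W: "openin M W" "p \<in> W" "W \<subseteq> U"
    and E': "\<forall>i. vector_field M A W (E i)" and par': "\<forall>l i. D (?d l) (E i) p = (\<lambda>h. 0)"
    and orth': "\<forall>q\<in>W. \<forall>i\<in>UNIV. \<forall>j\<in>UNIV. g q (E i q) (E j q) = (if i = j then 1 else 0)"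
    using parallel_gram_schmidt[OF c p, of UNIV] by (elim exE conjE) (rule that)
  have E: "vector_field M A W (E i)" and par: "D (?d l) (E i) p = (\<lambda>h. 0)" for i l
    using E' par' by auto
  have orth: "g q (E i q) (E j q) = (if i = j then 1 else 0)" if "q \<in> W" for q i j
    using orth' that by blast
  have nb: "chart_nbhd p W" unfolding chart_nbhd_def using W c by blast
  have d: "vector_field M A W (?d l)" for l
    by (rule vector_field_subset[OF coord_field_vector_field[OF c] W(3)])
  have "D X (E i) p h = 0" if X: "vector_field M A W X" for X i h
  proof -
    have "X p = (\<lambda>h. \<Sum>l\<in>UNIV. X p (\<lambda>r. x r $ l) * ?d l p h)"
      using tangent_coord_expansion[OF c p vector_field_tangent[OF X W(2)]] by blast
    from tensorial_expansion[OF nb conn_tensorial_left[OF W(1) E W(2)] X finite d this, of i h]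
    show ?thesis by (simp add: par)
  qed
  moreover have "orthonormal_basis M A g q (\<lambda>i. E i q)" if "q \<in> W" for q
    unfolding orthonormal_basis_def using orth[OF that] vector_field_tangent[OF E that] by blast
  ultimately show ?thesis by (intro that[OF nb E])
qed

end

context levi_civita_connection
begin

text \<open>Apply X Y - Y X - (D X Y) + (D Y X), which is zero on functions, to g(Z, Z'). The mixed
  products g(D X Z, D Y Z') are symmetric in \<open>X\<close> and \<open>Y\<close> and cancel; the
  curvature terms remain.\<close>

lemma curvature_metric_skew:
  assumes U: "openin M U" and X: "vector_field M A U X" and Y: "vector_field M A U Y"
    and Z: "vector_field M A U Z" and Z': "vector_field M A U Z'" and p: "p \<in> U"
  shows "g p (curvature M A D X Y Z p) (Z' p) + g p (Z p) (curvature M A D X Y Z' p) = 0"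
proof -
  have top: "p \<in> topspace M" using U p openin_subset by blast
  note v = conn_vector_field[OF U] and t = vector_field_tangent[OF _ p]
  note mc = metric_compatible[OF U] and ms = metric_smooth[OF U]
  let ?s = "\<lambda>q. g q (Z q) (Z' q)"
  have s: "smooth_fun A U ?s" by (rule ms[OF Z Z'])
  have second: "X p (\<lambda>q. Y q ?s) = g p (D X (D Y Z) p) (Z' p) + g p (D Y Z p) (D X Z' p) +
      (g p (D X Z p) (D Y Z' p) + g p (Z p) (D X (D Y Z') p))"
    if X: "vector_field M A U X" and Y: "vector_field M A U Y" for X Y
  proof -
    have "X p (\<lambda>q. Y q ?s) = X p (\<lambda>q. g q (D Y Z q) (Z' q) + g q (Z q) (D Y Z' q))"
      by (rule tangent_local[OF t[OF X] U p]) (rule mc[OF Y Z Z'])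
    also have "\<dots> = X p (\<lambda>q. g q (D Y Z q) (Z' q)) + X p (\<lambda>q. g q (Z q) (D Y Z' q))"
      by (rule vector_field_scalar_add[OF X U p ms[OF v[OF Y Z] Z'] ms[OF Z v[OF Y Z']]])
    finally show ?thesis using mc[OF X v[OF Y Z] Z' p] mc[OF X Z v[OF Y Z'] p] by simp
  qed
  have br: "X p (\<lambda>q. Y q ?s) - Y p (\<lambda>q. X q ?s) =
      g p (D (D X Y) Z p) (Z' p) + g p (Z p) (D (D X Y) Z' p) -
      (g p (D (D Y X) Z p) (Z' p) + g p (Z p) (D (D Y X) Z' p))"
    using bracket_conn[OF U X Y p s] mc[OF v[OF X Y] Z Z' p] mc[OF v[OF Y X] Z Z' p] by simp
  have exp: "B (curvature M A D X Y Z p) = B (D X (D Y Z) p) - B (D Y (D X Z) p) - B (D (D X Y) Z p) + B (D (D Y X) Z p)"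
    if B: "linear_at p B" and Z: "vector_field M A U Z" for B Z
  proof -
    note vs = t[OF v[OF X v[OF Y Z]]] t[OF v[OF Y v[OF X Z]]] t[OF v[OF v[OF X Y] Z]] t[OF v[OF v[OF Y X] Z]]
    have a: "(\<lambda>h. D X (D Y Z) p h - D Y (D X Z) p h) \<in> tangent_space M A p"
      and b: "(\<lambda>h. D (D X Y) Z p h - D (D Y X) Z p h) \<in> tangent_space M A p"
      using t[OF vector_field_diff[OF v[OF X v[OF Y Z]] v[OF Y v[OF X Z]]]]
        t[OF vector_field_diff[OF v[OF v[OF X Y] Z] v[OF v[OF Y X] Z]]] by auto
    have "curvature M A D X Y Z p = (\<lambda>h. (D X (D Y Z) p h - D Y (D X Z) p h) -
        (D (D X Y) Z p h - D (D Y X) Z p h))"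
      using curvature_eq[OF U X Y Z p] by (simp add: fun_eq_iff)
    then show ?thesis
      using linear_at_diff[OF B a b] linear_at_diff[OF B vs(1,2)] linear_at_diff[OF B vs(3,4)] by simp
  qed
  show ?thesis
    unfolding exp[OF metric_linear_left[OF top t[OF Z']] Z] exp[OF metric_linear_right[OF top t[OF Z]] Z']
    using second[OF X Y] second[OF Y X] br by linarith
qed

end

text \<open>Orthonormality holds on all of \<open>W\<close>, so traces can be written in the frame
  before they are differentiated; \<open>normal\<close> is a condition at the centre
  \<open>p\<close> alone.\<close>

locale normal_orthonormal_frame = levi_civita_connection M A g D
  for M :: "'a topology" and A :: "('a, 'n::finite) chart set" and g D +
  fixes p :: 'a and W :: "'a set" and E :: "'n \<Rightarrow> 'a vfield"
  assumes nbhd: "chart_nbhd p W"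
    and frame: "vector_field M A W (E i)"
    and orthonormal: "q \<in> W \<Longrightarrow> orthonormal_basis M A g q (\<lambda>i. E i q)"
    and normal: "vector_field M A W X \<Longrightarrow> D X (E i) p h = 0"
begin

lemma W_open: "openin M W"
  using nbhd by (rule chart_nbhd_open)

lemma p_in_W: "p \<in> W"
  using nbhd by (rule chart_nbhd_mem)

lemma W_top: "q \<in> W \<Longrightarrow> q \<in> topspace M"
  using W_open openin_subset by blast

lemma W_nbhd: "q \<in> W \<Longrightarrow> chart_nbhd q W"
  by (rule chart_nbhd_move[OF nbhd])

lemmas conn_field = conn_vector_field[OF W_open]
  and conn_frame = conn_vector_field[OF W_open frame frame]
  and frame_tangent = vector_field_tangent[OF frame]
  and curvature_frame = curvature_vector_field[OF W_open frame frame frame]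

lemma frame_inner: "q \<in> W \<Longrightarrow> g q (E i q) (E j q) = (if i = j then 1 else 0)"
  using orthonormal unfolding orthonormal_basis_def by blast

lemma frame_expansion:
  "q \<in> W \<Longrightarrow> v \<in> tangent_space M A q \<Longrightarrow> v = (\<lambda>h. \<Sum>i\<in>UNIV. g q v (E i q) * E i q h)"
  by (rule orthonormal_expansion[OF W_top orthonormal])

lemma frame_extension:
  assumes "q \<in> W" "v \<in> tangent_space M A q"
  obtains X where "vector_field M A W X" "X q = v"
  by (rule that[of "\<lambda>r h. \<Sum>i\<in>UNIV. g q v (E i q) * E i r h"])
     (use frame_expansion[OF assms] in \<open>auto intro!: vector_field_sum frame\<close>)

text \<open>A field that is zero at the point is there an empty combination.\<close>

lemma tensorial_vanish:
  assumes "tensorial_at q W T" "q \<in> W" "vector_field M A W X" "X q = (\<lambda>h. 0)"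
  shows "T X = 0"
  using tensorial_expansion[OF W_nbhd[OF assms(2)] assms(1,3), of "{}" E "\<lambda>i. 0"] assms(4) by simp

section \<open>Components in the frame\<close>

text \<open>Components are given by fields and not by \<open>hessian\<close> at a point, which makes
  them visibly smooth functions on \<open>W\<close>; the same holds for \<open>riem\<close> and
  \<open>ric\<close>.\<close>

definition hess :: "('a \<Rightarrow> real) \<Rightarrow> 'n \<Rightarrow> 'n \<Rightarrow> 'a \<Rightarrow> real" where
  "hess h j k q = E j q (\<lambda>r. E k r h) - D (E j) (E k) q h"

definition riem :: "'n \<Rightarrow> 'n \<Rightarrow> 'n \<Rightarrow> 'n \<Rightarrow> 'a \<Rightarrow> real" where
  "riem i j k l q = g q (curvature M A D (E i) (E j) (E k) q) (E l q)"

definition ric :: "'n \<Rightarrow> 'n \<Rightarrow> 'a \<Rightarrow> real" where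
  "ric j k q = (\<Sum>i\<in>UNIV. riem i j k i q)"

lemma hess_smooth: "smooth_fun A W h \<Longrightarrow> smooth_fun A W (hess h j k)"
  unfolding hess_def
  by (intro smooth_fun_diff W_open vector_field_smooth[OF frame] vector_field_smooth[OF conn_frame])

lemma riem_smooth: "smooth_fun A W (riem i j k l)"
  unfolding riem_def by (intro metric_smooth[OF W_open] curvature_frame frame)

lemma ric_smooth: "smooth_fun A W (ric j k)"
  unfolding ric_def by (intro smooth_fun_sum[OF W_open] riem_smooth) auto

lemma hessian_frame: "q \<in> W \<Longrightarrow> smooth_fun A W h \<Longrightarrow> hessian M A D h q (E j q) (E k q) = hess h j k q"
  unfolding hess_def by (rule hessian_eq[OF W_nbhd frame frame])

text \<open>Vectors are extended through the frame to fields on \<open>W\<close>, where tensoriality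
  applies. Linearity is established at every \<open>q\<close>, as the Laplacian will be
  differentiated.\<close>

lemma hessian_linear_1:
  assumes q: "q \<in> W" and h: "smooth_fun A W h" and w: "w \<in> tangent_space M A q"
  shows "linear_at q (\<lambda>u. hessian M A D h q u w)"
  unfolding linear_at_def
proof (intro ballI allI)
  fix u v a b assume u: "u \<in> tangent_space M A q" and v: "v \<in> tangent_space M A q"
  obtain X where X: "vector_field M A W X" "X q = u" using frame_extension[OF q u] .
  obtain Y where Y: "vector_field M A W Y" "Y q = v" using frame_extension[OF q v] .
  obtain Z where Z: "vector_field M A W Z" "Z q = w" using frame_extension[OF q w] .
  let ?S = "\<lambda>q h. a * X q h + b * Y q h"
  have aX: "vector_field M A W (\<lambda>q h. a * X q h)" and bY: "vector_field M A W (\<lambda>q h. b * Y q h)"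
    using vector_field_scale[OF smooth_fun_const X(1)] vector_field_scale[OF smooth_fun_const Y(1)] .
  note e = hessian_eq[OF W_nbhd[OF q] _ Z(1) h, unfolded Z(2)]
  note T = hessian_tensorial_1[OF W_open Z(1) q, of h]
  have "hessian M A D h q (?S q) w = a * hessian M A D h q (X q) w + b * hessian M A D h q (Y q) w"
    unfolding e[OF vector_field_add[OF aX bY]] e[OF X(1)] e[OF Y(1)]
    using tensorial_add[OF T aX bY] tensorial_scale[OF T smooth_fun_const X(1), of a]
      tensorial_scale[OF T smooth_fun_const Y(1), of b] by simp
  then show "hessian M A D h q (\<lambda>h. a * u h + b * v h) w = a * hessian M A D h q u w + b * hessian M A D h q v w"
    by (simp only: X(2) Y(2))
qed

lemma hessian_linear_2:
  assumes q: "q \<in> W" and h: "smooth_fun A W h" and w: "w \<in> tangent_space M A q"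
  shows "linear_at q (hessian M A D h q w)"
  unfolding linear_at_def
proof (intro ballI allI)
  fix u v a b assume u: "u \<in> tangent_space M A q" and v: "v \<in> tangent_space M A q"
  obtain X where X: "vector_field M A W X" "X q = u" using frame_extension[OF q u] .
  obtain Y where Y: "vector_field M A W Y" "Y q = v" using frame_extension[OF q v] .
  obtain Z where Z: "vector_field M A W Z" "Z q = w" using frame_extension[OF q w] .
  let ?S = "\<lambda>q h. a * X q h + b * Y q h"
  have aX: "vector_field M A W (\<lambda>q h. a * X q h)" and bY: "vector_field M A W (\<lambda>q h. b * Y q h)"
    using vector_field_scale[OF smooth_fun_const X(1)] vector_field_scale[OF smooth_fun_const Y(1)] .
  note e = hessian_eq[OF W_nbhd[OF q] Z(1) _ h, unfolded Z(2)]
  note T = hessian_tensorial_2[OF W_open Z(1) q h, unfolded Z(2)]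
  have "hessian M A D h q w (?S q) = a * hessian M A D h q w (X q) + b * hessian M A D h q w (Y q)"
    unfolding e[OF vector_field_add[OF aX bY]] e[OF X(1)] e[OF Y(1)]
    using tensorial_add[OF T aX bY] tensorial_scale[OF T smooth_fun_const X(1), of a]
      tensorial_scale[OF T smooth_fun_const Y(1), of b] by simp
  then show "hessian M A D h q w (\<lambda>h. a * u h + b * v h) = a * hessian M A D h q w u + b * hessian M A D h q w v"
    by (simp only: X(2) Y(2))
qed

lemma laplacian_frame:
  assumes "q \<in> W" "smooth_fun A W h"
  shows "laplacian M A g D h q = (\<Sum>i\<in>UNIV. hess h i i q)"
  unfolding laplacian_def
  using metric_trace_eq[OF W_top[OF assms(1)] orthonormal[OF assms(1)] hessian_linear_1[OF assms] hessian_linear_2[OF assms]]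
  by (simp add: hessian_frame[OF assms])

text \<open>\<open>metric_trace\<close> picks a basis point by point, so smoothness becomes visible
  only in the frame formula.\<close>

lemma laplacian_smooth: "smooth_fun A W h \<Longrightarrow> smooth_fun A W (laplacian M A g D h)"
  using smooth_fun_cong[OF W_open, of "laplacian M A g D h" "\<lambda>q. \<Sum>i\<in>UNIV. hess h i i q"]
    smooth_fun_sum[OF W_open finite, of UNIV "\<lambda>i. hess h i i"] hess_smooth laplacian_frame by simp

lemma riemann_tangent:
  assumes q: "q \<in> W" and "u \<in> tangent_space M A q" "v \<in> tangent_space M A q" "w \<in> tangent_space M A q"
  shows "riemann M A D q u v w \<in> tangent_space M A q"
proof -
  obtain X where X: "vector_field M A W X" "X q = u" using frame_extension[OF q assms(2)] .
  obtain Y where Y: "vector_field M A W Y" "Y q = v" using frame_extension[OF q assms(3)] .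
  obtain Z where Z: "vector_field M A W Z" "Z q = w" using frame_extension[OF q assms(4)] .
  show ?thesis
    using riemann_eq[OF W_nbhd[OF q] X(1) Y(1) Z(1), unfolded X(2) Y(2) Z(2)]
      vector_field_tangent[OF curvature_vector_field[OF W_open X(1) Y(1) Z(1)] q] by simp
qed

lemma riemann_linear:
  assumes q: "q \<in> W" and w: "w \<in> tangent_space M A q" and w': "w' \<in> tangent_space M A q"
    and u: "u \<in> tangent_space M A q" and v: "v \<in> tangent_space M A q"
  shows "riemann M A D q (\<lambda>h. a * u h + b * v h) w w' =
    (\<lambda>h. a * riemann M A D q u w w' h + b * riemann M A D q v w w' h)"
proof
  fix h
  obtain X where X: "vector_field M A W X" "X q = u" using frame_extension[OF q u] .
  obtain Y where Y: "vector_field M A W Y" "Y q = v" using frame_extension[OF q v] .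
  obtain Z where Z: "vector_field M A W Z" "Z q = w" using frame_extension[OF q w] .
  obtain Z' where Z': "vector_field M A W Z'" "Z' q = w'" using frame_extension[OF q w'] .
  let ?S = "\<lambda>q h. a * X q h + b * Y q h"
  have aX: "vector_field M A W (\<lambda>q h. a * X q h)" and bY: "vector_field M A W (\<lambda>q h. b * Y q h)"
    using vector_field_scale[OF smooth_fun_const X(1)] vector_field_scale[OF smooth_fun_const Y(1)] .
  note e = riemann_eq[OF W_nbhd[OF q] _ Z(1) Z'(1), unfolded Z(2) Z'(2)]
  note T = curvature_tensorial_1[OF W_open Z(1) Z'(1) q, of h]
  have "riemann M A D q (?S q) w w' h = a * riemann M A D q (X q) w w' h + b * riemann M A D q (Y q) w w' h"
    unfolding e[OF vector_field_add[OF aX bY]] e[OF X(1)] e[OF Y(1)]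
    using tensorial_add[OF T aX bY] tensorial_scale[OF T smooth_fun_const X(1), of a]
      tensorial_scale[OF T smooth_fun_const Y(1), of b] by simp
  then show "riemann M A D q (\<lambda>h. a * u h + b * v h) w w' h =
      a * riemann M A D q u w w' h + b * riemann M A D q v w w' h"
    by (simp only: X(2) Y(2))
qed

lemma ricci_frame:
  assumes q: "q \<in> W"
  shows "ricci M A g D q (E j q) (E k q) = ric j k q"
proof -
  note t = frame_tangent[OF q] and top = W_top[OF q]
  let ?R = "\<lambda>u. riemann M A D q u (E j q) (E k q)"
  have "linear_at q (\<lambda>u. g q (?R u) w)" if w: "w \<in> tangent_space M A q" for w
    unfolding linear_at_def
    using linear_atD[OF metric_linear_left[OF top w] riemann_tangent[OF q _ t t] riemann_tangent[OF q _ t t]]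
    by (auto simp: riemann_linear[OF q t t])
  moreover have "linear_at q (g q (?R u))" if u: "u \<in> tangent_space M A q" for u
    by (rule metric_linear_right[OF top riemann_tangent[OF q u t t]])
  ultimately have "ricci M A g D q (E j q) (E k q) = (\<Sum>i\<in>UNIV. g q (?R (E i q)) (E i q))"
    unfolding ricci_def by (intro metric_trace_eq[OF top orthonormal[OF q]])
  then show ?thesis
    by (simp add: ric_def riem_def riemann_eq[OF W_nbhd[OF q] frame frame frame])
qed

section \<open>Contracted second Bianchi identity and Bochner's formula\<close>

lemma frame_local: "(\<And>q. q \<in> W \<Longrightarrow> h q = k q) \<Longrightarrow> E i p h = E i p k"
  by (rule tangent_local[OF frame_tangent[OF p_in_W] W_open p_in_W])

lemma frame_sum: "(\<And>i. smooth_fun A W (h i)) \<Longrightarrow> E j p (\<lambda>q. \<Sum>i\<in>UNIV. h i q) = (\<Sum>i\<in>UNIV. E j p (h (i :: 'n)))"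
  by (rule tangent_sum[OF frame_tangent[OF p_in_W] W_top[OF p_in_W] finite])
     (auto intro: smooth_atI[OF W_open p_in_W])

lemma frame_minus: "smooth_fun A W h \<Longrightarrow> E i p (\<lambda>q. - h q) = - E i p h"
  using tangent_scale[OF frame_tangent[OF p_in_W] smooth_atI[OF W_open p_in_W], of h i "- 1"] by simp

text \<open>At \<open>p\<close> the curvature term R(E_i, E_j) Z is zero because Z is, and the
  bracket terms are zero because D (E i) (E j) is.\<close>

lemma conn_commute_vanishing:
  assumes Z: "vector_field M A W Z" and 0: "Z p = (\<lambda>h. 0)"
  shows "D (E i) (D (E j) Z) p h = D (E j) (D (E i) Z) p h"
proof -
  have "curvature M A D (E i) (E j) Z p h = 0"
    by (rule tensorial_vanish[OF curvature_tensorial_3[OF W_open frame frame p_in_W] p_in_W Z 0])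
  moreover have "D (D (E i) (E j)) Z p h = 0" for i j
    by (rule tensorial_vanish[OF conn_tensorial_left[OF W_open Z p_in_W] p_in_W conn_frame])
       (simp add: fun_eq_iff normal[OF frame])
  ultimately show ?thesis
    using curvature_eq[OF W_open frame frame Z p_in_W, of i j h] by simp
qed

text \<open>R(E_l, Z) E_k vanishes at \<open>p\<close>. In its expansion the last two terms
  differentiate \<open>E k\<close> and vanish by \<open>normal\<close>, and D Z (D (E l) (E k))
  vanishes since its direction does; only the claimed term is left.\<close>

lemma conn_frame_vanishing:
  assumes Z: "vector_field M A W Z" and 0: "Z p = (\<lambda>h. 0)"
  shows "D (E l) (D Z (E k)) p h = 0"
proof -
  have "curvature M A D (E l) Z (E k) p h = 0"
    by (rule tensorial_vanish[OF curvature_tensorial_2[OF W_open frame frame p_in_W] p_in_W Z 0])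
  moreover have "D Z (D (E l) (E k)) p h = 0"
    by (rule tensorial_vanish[OF conn_tensorial_left[OF W_open conn_frame p_in_W] p_in_W Z 0])
  ultimately show ?thesis
    using curvature_eq[OF W_open frame Z frame p_in_W, of l k h] normal[OF conn_field] frame Z by simp
qed

text \<open>The bracket part of curvature vanishes at \<open>p\<close> and, by
  \<open>conn_frame_vanishing\<close>, so do its first derivatives.\<close>

lemma conn_curvature:
  "D (E l) (curvature M A D (E i) (E j) (E k)) p h =
    D (E l) (D (E i) (D (E j) (E k))) p h - D (E l) (D (E j) (D (E i) (E k))) p h"
proof -
  let ?a = "D (E i) (D (E j) (E k))" and ?b = "D (E j) (D (E i) (E k))"
    and ?c = "D (D (E i) (E j)) (E k)" and ?d = "D (D (E j) (E i)) (E k)"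
  note v = conn_field[OF frame conn_frame] conn_field[OF conn_frame frame]
  have z: "D (E i) (E j) p = (\<lambda>h. 0)" for i j by (simp add: fun_eq_iff normal[OF frame])
  have "D (E l) (curvature M A D (E i) (E j) (E k)) p =
      D (E l) (\<lambda>q h. (?a q h - ?b q h) - (?c q h - ?d q h)) p"
    by (rule conn_cong[OF W_open frame _ refl _ p_in_W])
       (auto simp: curvature_eq[OF W_open frame frame frame] intro!: vector_field_diff v)
  moreover have "D (E l) (\<lambda>q h. (?a q h - ?b q h) - (?c q h - ?d q h)) p h =
      (D (E l) ?a p h - D (E l) ?b p h) - (D (E l) ?c p h - D (E l) ?d p h)"
    unfolding conn_diff_right[OF W_open frame vector_field_diff[OF v(1) v(1)] vector_field_diff[OF v(2) v(2)] p_in_W]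
      conn_diff_right[OF W_open frame v(1) v(1) p_in_W] conn_diff_right[OF W_open frame v(2) v(2) p_in_W] ..
  ultimately show ?thesis by (simp add: conn_frame_vanishing[OF conn_frame z])
qed

text \<open>\<open>E m\<close> is parallel at \<open>p\<close>, so differentiating a component
  amounts to taking the component of the covariant derivative.\<close>

lemma frame_inner_derivative:
  assumes Z: "vector_field M A W Z"
  shows "E l p (\<lambda>q. g q (Z q) (E m q)) = g p (D (E l) Z p) (E m p)"
proof -
  have "D (E l) (E m) p = (\<lambda>h. 0)" by (simp add: fun_eq_iff normal[OF frame])
  then show ?thesis
    using metric_compatible[OF W_open frame Z frame p_in_W, of l m]
      linear_at_zero[OF metric_linear_right[OF W_top[OF p_in_W] vector_field_tangent[OF Z p_in_W]]] by simp
qed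

text \<open>Since the frame is parallel at \<open>p\<close>, all brackets vanish there and only the third derivatives of
  the frame survive.\<close>

lemma second_Bianchi: "E l p (riem i j k m) + E i p (riem j l k m) + E j p (riem l i k m) = 0"
proof -
  let ?R = "\<lambda>l i j. D (E l) (curvature M A D (E i) (E j) (E k)) p"
  have z: "D (E i) (E j) p = (\<lambda>h. 0)" for i j by (simp add: fun_eq_iff normal[OF frame])
  \<comment> \<open>The six third derivatives pair off: each pair differs in the order of the two
    outer derivatives of some D (E j) (E k), a field vanishing at \<open>p\<close>.\<close>
  have sum0: "?R l i j h + ?R i j l h + ?R j l i h = 0" for h
    unfolding conn_curvature
    using conn_commute_vanishing[OF conn_frame z, of l i j k h]
      conn_commute_vanishing[OF conn_frame z, of i j l k h]
      conn_commute_vanishing[OF conn_frame z, of j l i k h] by linarith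
  have RT: "?R l i j \<in> tangent_space M A p" for l i j
    by (rule vector_field_tangent[OF conn_field[OF frame curvature_frame] p_in_W])
  have "?R l i j h = (- 1) * ?R i j l h + (- 1) * ?R j l i h" for h
    using sum0[of h] by linarith
  then have R: "?R l i j = (\<lambda>h. (- 1) * ?R i j l h + (- 1) * ?R j l i h)" by blast
  have "g p (?R l i j) (E m p) = (- 1) * g p (?R i j l) (E m p) + (- 1) * g p (?R j l i) (E m p)"
    by (subst R, rule linear_atD[OF metric_linear_left[OF W_top[OF p_in_W] frame_tangent[OF p_in_W]] RT RT])
  then show ?thesis
    unfolding riem_def by (simp add: frame_inner_derivative[OF curvature_frame])
qed

lemma riem_skew_12: "q \<in> W \<Longrightarrow> riem j i k l q = - riem i j k l q"
proof -
  assume q: "q \<in> W"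
  have "curvature M A D (E j) (E i) (E k) q = (\<lambda>h. - 1 * curvature M A D (E i) (E j) (E k) q h)"
    by (rule ext, subst curvature_skew[OF W_open frame frame frame q]) simp
  moreover have "g q (\<lambda>h. - 1 * curvature M A D (E i) (E j) (E k) q h) (E l q) =
      - 1 * g q (curvature M A D (E i) (E j) (E k) q) (E l q)"
    by (rule linear_at_scale[OF metric_linear_left[OF W_top[OF q] frame_tangent[OF q]]
          vector_field_tangent[OF curvature_frame q]])
  ultimately show ?thesis by (simp add: riem_def)
qed

lemma riem_skew_34: "q \<in> W \<Longrightarrow> riem i j l k q = - riem i j k l q"
proof -
  assume q: "q \<in> W"
  show ?thesis
    using curvature_metric_skew[OF W_open frame frame frame frame q, of i j k l]
      metric_sym[OF W_top[OF q] frame_tangent[OF q] vector_field_tangent[OF curvature_frame q], of k i j l]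
    unfolding riem_def by simp
qed

text \<open>Trace the second Bianchi identity over both index pairs. By the antisymmetries each of
  the two remaining sums is the divergence of the Ricci tensor, whence the factor 2.\<close>

lemma contracted_Bianchi:
  "E j p (\<lambda>q. \<Sum>k\<in>UNIV. ric k k q) = 2 * (\<Sum>k\<in>UNIV. E k p (ric j k))"
proof -
  have s12: "E a p (riem j i k l) = - E a p (riem i j k l)" for a i j k l
    by (rule trans[OF frame_local[OF riem_skew_12] frame_minus[OF riem_smooth]])
  have s34: "E a p (riem i j l k) = - E a p (riem i j k l)" for a i j k l
    by (rule trans[OF frame_local[OF riem_skew_34] frame_minus[OF riem_smooth]])
  have dric: "E a p (ric j k) = (\<Sum>i\<in>UNIV. E a p (riem i j k i))" for a j k
    unfolding ric_def by (rule frame_sum[OF riem_smooth])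
  have term_eq: "E j p (riem i k k i) = E i p (riem k j i k) + E k p (riem i j k i)" for i k
    using second_Bianchi[of j i k k i] s34[of i k j i k] s12[of k i j k i] by linarith
  have "E j p (\<lambda>q. \<Sum>k\<in>UNIV. ric k k q) = (\<Sum>k\<in>UNIV. \<Sum>i\<in>UNIV. E j p (riem i k k i))"
    unfolding frame_sum[OF ric_smooth] dric ..
  also have "\<dots> = (\<Sum>k\<in>UNIV. \<Sum>i\<in>UNIV. E i p (riem k j i k)) + (\<Sum>k\<in>UNIV. \<Sum>i\<in>UNIV. E k p (riem i j k i))"
    by (simp add: term_eq sum.distrib)
  also have "(\<Sum>k\<in>UNIV. \<Sum>i\<in>UNIV. E i p (riem k j i k)) = (\<Sum>i\<in>UNIV. E i p (ric j i))"
    unfolding dric by (rule sum.swap)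
  also have "(\<Sum>k\<in>UNIV. \<Sum>i\<in>UNIV. E k p (riem i j k i)) = (\<Sum>k\<in>UNIV. E k p (ric j k))"
    unfolding dric ..
  finally show ?thesis by simp
qed

text \<open>With G the gradient of h, E_k(hess h j k) at \<open>p\<close> is g(D_k D_j G, E_k).
  Exchanging D_k and D_j costs R(E_k, E_j) G, the bracket terms being zero at \<open>p\<close>.
  Summation over k gives d\<Delta>h from the exchanged term and Ric(E_j, G) from the
  curvature.\<close>

lemma hess_divergence:
  assumes h: "smooth_fun A W h"
  shows "(\<Sum>k\<in>UNIV. E k p (hess h j k)) =
    E j p (laplacian M A g D h) + (\<Sum>k\<in>UNIV. ric j k p * E k p h)"
proof -
  \<comment> \<open>The gradient in frame form, so that it is visibly a smooth field;
    \<open>Gw\<close> is its defining property.\<close>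
  define G where "G q l = (\<Sum>i\<in>UNIV. E i q h * E i q l)" for q l
  have G: "vector_field M A W G"
    unfolding G_def using vector_field_smooth[OF frame W_open h] by (intro vector_field_sum frame) auto
  note DG = conn_field[OF frame G]
  have Gw: "g q (G q) w = w h" if q: "q \<in> W" and w: "w \<in> tangent_space M A q" for q w
  proof -
    have "g q (G q) w = (\<Sum>i\<in>UNIV. E i q h * g q (E i q) w)"
      unfolding G_def[of q, abs_def]
      by (rule linear_at_sum[OF metric_linear_left[OF W_top[OF q] w] finite frame_tangent[OF q]])
    also have "\<dots> = (\<Sum>i\<in>UNIV. g q w (E i q) * E i q h)"
      by (simp add: metric_sym[OF W_top[OF q] frame_tangent[OF q] w] mult.commute)
    also have "\<dots> = w h" using fun_cong[OF frame_expansion[OF q w], of h] by simp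
    finally show ?thesis .
  qed
  have hess_G: "hess h j k q = g q (D (E j) G q) (E k q)" if q: "q \<in> W" for j k q
  proof -
    have "E j q (\<lambda>r. E k r h) = E j q (\<lambda>r. g r (G r) (E k r))"
      by (rule tangent_local[OF frame_tangent[OF q] W_open q]) (simp add: Gw frame_tangent)
    also have "\<dots> = g q (D (E j) G q) (E k q) + g q (G q) (D (E j) (E k) q)"
      by (rule metric_compatible[OF W_open frame G frame q])
    finally show ?thesis
      unfolding hess_def by (simp add: Gw[OF q vector_field_tangent[OF conn_frame q]])
  qed
  have dhess: "E l p (hess h j k) = g p (D (E l) (D (E j) G) p) (E k p)" for l j k
    using frame_local[OF hess_G] frame_inner_derivative[OF DG] by simp
  have z: "D (E i) (E j) p = (\<lambda>h. 0)" for i j by (simp add: fun_eq_iff normal[OF frame])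
  \<comment> \<open>The factors \<open>1 *\<close> give the right side the shape expected by
    \<open>linear_atD\<close>.\<close>
  have comm: "D (E k) (D (E j) G) p l = 1 * D (E j) (D (E k) G) p l +
      1 * (\<Sum>i\<in>UNIV. E i p h * curvature M A D (E k) (E j) (E i) p l)" for k l
  proof -
    have "curvature M A D (E k) (E j) G p l = (\<Sum>i\<in>UNIV. E i p h * curvature M A D (E k) (E j) (E i) p l)"
      by (rule tensorial_expansion[OF nbhd curvature_tensorial_3[OF W_open frame frame p_in_W] G finite frame])
         (simp add: G_def fun_eq_iff)
    moreover have "D (D (E i) (E j)) G p l = 0" for i j
      by (rule tensorial_vanish[OF conn_tensorial_left[OF W_open G p_in_W] p_in_W conn_frame z])
    ultimately show ?thesis
      using curvature_eq[OF W_open frame frame G p_in_W, of k j l] by simp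
  qed
  have "E k p (hess h j k) = E j p (hess h k k) + (\<Sum>i\<in>UNIV. E i p h * riem k j i k p)" for k
  proof -
    note lin = metric_linear_left[OF W_top[OF p_in_W] frame_tangent[OF p_in_W, of k]]
    note ct = vector_field_tangent[OF curvature_frame p_in_W]
    let ?C = "\<lambda>l. \<Sum>i\<in>UNIV. E i p h * curvature M A D (E k) (E j) (E i) p l"
    have C: "?C \<in> tangent_space M A p"
      by (intro tangent_space_sum tangent_space_scale ct) auto
    have "E k p (hess h j k) = g p (\<lambda>l. 1 * D (E j) (D (E k) G) p l + 1 * ?C l) (E k p)"
      unfolding dhess comm[symmetric] ..
    also have "\<dots> = g p (D (E j) (D (E k) G) p) (E k p) + g p ?C (E k p)"
      using linear_atD[OF lin vector_field_tangent[OF conn_field[OF frame DG] p_in_W] C, of 1 j k 1] by simp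
    also have "g p ?C (E k p) = (\<Sum>i\<in>UNIV. E i p h * riem k j i k p)"
      unfolding riem_def by (rule linear_at_sum[OF lin finite ct])
    finally show ?thesis unfolding dhess .
  qed
  then have "(\<Sum>k\<in>UNIV. E k p (hess h j k)) =
      (\<Sum>k\<in>UNIV. E j p (hess h k k)) + (\<Sum>k\<in>UNIV. \<Sum>i\<in>UNIV. E i p h * riem k j i k p)"
    by (simp add: sum.distrib)
  also have "(\<Sum>k\<in>UNIV. E j p (hess h k k)) = E j p (\<lambda>q. \<Sum>k\<in>UNIV. hess h k k q)"
    by (rule frame_sum[OF hess_smooth[OF h], symmetric])
  also have "\<dots> = E j p (laplacian M A g D h)"
    by (rule frame_local) (simp add: laplacian_frame[OF _ h])
  also have "(\<Sum>k\<in>UNIV. \<Sum>i\<in>UNIV. E i p h * riem k j i k p) = (\<Sum>i\<in>UNIV. ric j i p * E i p h)"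
    unfolding ric_def by (subst sum.swap) (simp add: sum_distrib_left mult.commute)
  finally show ?thesis .
qed

lemma inner_gradient_smooth:
  assumes h: "smooth_fun A W h" and k: "smooth_fun A W k"
  shows "smooth_fun A W (\<lambda>q. g q (gradient M A g h q) (gradient M A g k q))"
proof -
  have "smooth_fun A W (\<lambda>q. \<Sum>i\<in>UNIV. E i q h * E i q k)"
    using vector_field_smooth[OF frame W_open h] vector_field_smooth[OF frame W_open k]
    by (intro smooth_fun_sum[OF W_open] smooth_fun_mult[OF W_open]) auto
  then show ?thesis
    using smooth_fun_cong[OF W_open, of "\<lambda>q. g q (gradient M A g h q) (gradient M A g k q)"
        "\<lambda>q. \<Sum>i\<in>UNIV. E i q h * E i q k"] metric_gradient[OF W_top orthonormal] by simp
qed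

text \<open>At \<open>p\<close> the second derivatives E_j(E_i h) are the Hessian components, since
  the correction D (E j) (E i) vanishes there.\<close>

lemma inner_gradient_derivative:
  assumes h: "smooth_fun A W h" and k: "smooth_fun A W k"
  shows "E j p (\<lambda>q. g q (gradient M A g h q) (gradient M A g k q)) =
    (\<Sum>i\<in>UNIV. hess h j i p * E i p k) + (\<Sum>i\<in>UNIV. hess k j i p * E i p h)"
proof -
  note s = vector_field_smooth[OF frame W_open]
  have "E j p (\<lambda>q. g q (gradient M A g h q) (gradient M A g k q)) = E j p (\<lambda>q. \<Sum>i\<in>UNIV. E i q h * E i q k)"
    by (rule frame_local) (rule metric_gradient[OF W_top orthonormal])
  also have "\<dots> = (\<Sum>i\<in>UNIV. E i p h * E j p (\<lambda>q. E i q k) + E j p (\<lambda>q. E i q h) * E i p k)"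
    using vector_field_scalar_mult[OF frame W_open p_in_W s[OF h] s[OF k]]
    by (subst frame_sum) (auto intro: smooth_fun_mult[OF W_open s[OF h] s[OF k]])
  finally show ?thesis
    by (simp add: hess_def normal[OF frame] sum.distrib mult.commute add.commute)
qed

end

section \<open>Ricci-Hessian type manifolds\<close>

context levi_civita_connection
begin

lemma normal_orthonormal_frame_exists:
  assumes "p \<in> topspace M"
  obtains W and E :: "'n \<Rightarrow> 'a vfield" where "normal_orthonormal_frame M A g D p W E"
proof (rule normal_frame[OF assms])
  fix W and E :: "'n \<Rightarrow> 'a vfield"
  assume "chart_nbhd p W" "\<And>i. vector_field M A W (E i)"
    "\<And>q. q \<in> W \<Longrightarrow> orthonormal_basis M A g q (\<lambda>i. E i q)"
    "\<And>X i h. vector_field M A W X \<Longrightarrow> D X (E i) p h = 0"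
  then have "normal_orthonormal_frame M A g D p W E" by unfold_locales
  then show thesis by (rule that)
qed

text \<open>If \<Sum> a_i db_i = dk then \<Sum> da_i \<and> db_i = 0, evaluated on X and Y. The
  vanishing of ddk is expressed by X(Y k) - Y(X k) = (D X Y - D Y X) k, and the assumed equality is
  used again along D X Y and D Y X.\<close>

lemma exact_form_closed:
  assumes W: "openin M W" and p: "p \<in> W" and X: "vector_field M A W X" and Y: "vector_field M A W Y"
    and I: "finite I" and a: "\<And>i. i \<in> I \<Longrightarrow> smooth_fun A W (a i)"
    and b: "\<And>i. i \<in> I \<Longrightarrow> smooth_fun A W (b i)" and k: "smooth_fun A W k"
    and eq: "\<And>Z q. vector_field M A W Z \<Longrightarrow> q \<in> W \<Longrightarrow> (\<Sum>i\<in>I. a i q * Z q (b i)) = Z q k"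
  shows "(\<Sum>i\<in>I. X p (a i) * Y p (b i) - Y p (a i) * X p (b i)) = 0"
proof -
  have top: "p \<in> topspace M" using W p openin_subset by blast
  have e: "X p (\<lambda>q. Y q k) = (\<Sum>i\<in>I. a i p * X p (\<lambda>q. Y q (b i)) + X p (a i) * Y p (b i))"
    if X: "vector_field M A W X" and Y: "vector_field M A W Y" for X Y
  proof -
    note s = vector_field_smooth[OF Y W b]
    have "X p (\<lambda>q. Y q k) = X p (\<lambda>q. \<Sum>i\<in>I. a i q * Y q (b i))"
      by (rule tangent_local[OF vector_field_tangent[OF X p] W p]) (simp add: eq[OF Y])
    also have "\<dots> = (\<Sum>i\<in>I. X p (\<lambda>q. a i q * Y q (b i)))"
      by (rule tangent_sum[OF vector_field_tangent[OF X p] top I])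
         (intro smooth_atI[OF W p] smooth_fun_mult[OF W a s])
    also have "\<dots> = (\<Sum>i\<in>I. a i p * X p (\<lambda>q. Y q (b i)) + X p (a i) * Y p (b i))"
      by (rule sum.cong[OF refl], rule vector_field_scalar_mult[OF X W p a s])
    finally show ?thesis .
  qed
  have "X p (\<lambda>q. Y q k) - Y p (\<lambda>q. X q k) = D X Y p k - D Y X p k"
    by (rule bracket_conn[OF W X Y p k])
  also have "\<dots> = (\<Sum>i\<in>I. a i p * (X p (\<lambda>q. Y q (b i)) - Y p (\<lambda>q. X q (b i))))"
    unfolding eq[OF conn_vector_field[OF W X Y] p, symmetric] eq[OF conn_vector_field[OF W Y X] p, symmetric]
      sum_subtractf[symmetric]
    by (rule sum.cong[OF refl]) (simp add: bracket_conn[OF W X Y p b] algebra_simps)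
  finally show ?thesis
    unfolding e[OF X Y] e[OF Y X] sum_subtractf[symmetric]
    by (simp add: sum_subtractf sum.distrib algebra_simps)
qed

end

context ricci_hessian_manifold
begin

abbreviation inner_grad :: "('a \<Rightarrow> real) \<Rightarrow> ('a \<Rightarrow> real) \<Rightarrow> 'a \<Rightarrow> real" where
  "inner_grad h k \<equiv> \<lambda>q. g q (gradient M A g h q) (gradient M A g k q)"

text \<open>The divergence of the structural equation, multiplied by \<open>f\<^sup>2\<close>, after \<open>Ric(\<nabla>f)\<close>, \<open>Ric(\<nabla>\<phi>)\<close> and
  the scalar curvature have been eliminated by the structural equation itself.\<close>

lemma divergence_identity:
  assumes p: "p \<in> topspace M" and v: "v \<in> tangent_space M A p"
  shows "f p * f p * ((real CARD('n) - 2) * v lam + v (laplacian M A g D \<phi>) - v (inner_grad \<phi> \<phi>))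
      + 2 * (f p * f p) * lam p * v \<phi> + 2 * real m * f p * v (inner_grad \<phi> f)
    = real m * (f p * v (laplacian M A g D f) + laplacian M A g D f p * v f + 2 * lam p * f p * v f
      + (real m - 1) * v (inner_grad f f))"
proof -
  obtain W and E :: "'n \<Rightarrow> 'a vfield" where fr: "normal_orthonormal_frame M A g D p W E"
    by (rule normal_orthonormal_frame_exists[OF p])
  interpret F: normal_orthonormal_frame M A g D p W E by (rule fr)
  note W = F.W_open and pW = F.p_in_W
  have sub: "W \<subseteq> topspace M" using W openin_subset by blast
  note sf = smooth_fun_subset[OF f_smooth sub] and sphi = smooth_fun_subset[OF phi_smooth sub]
    and slam = smooth_fun_subset[OF lam_smooth sub]
  note sm = smooth_fun_mult[OF W] and sa = smooth_fun_add[OF W]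
  note Em = vector_field_scalar_mult[OF F.frame W pW] and Ea = vector_field_scalar_add[OF F.frame W pW]
  let ?n = "real CARD('n)" and ?m = "real m"
  let ?Lf = "laplacian M A g D f" and ?L\<phi> = "laplacian M A g D \<phi>"
  let ?S = "\<lambda>q. \<Sum>k\<in>UNIV. F.ric k k q"
  note sLf = F.laplacian_smooth[OF sf] and sL\<phi> = F.laplacian_smooth[OF sphi]
  note hf = F.hess_smooth[OF sf] and h\<phi> = F.hess_smooth[OF sphi]
  have sS: "smooth_fun A W ?S" by (intro smooth_fun_sum[OF W] F.ric_smooth) auto
  have E0: "E k p (\<lambda>q. c) = 0" for k c
    by (rule tangent_const[OF F.frame_tangent[OF pW] p])
  \<comment> \<open>Cleared of the denominator, so that no quotient is differentiated later.\<close>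
  have eqn: "f q * F.ric j k q + f q * F.hess \<phi> j k q =
      (f q * lam q) * (if j = k then 1 else 0) + ?m * F.hess f j k q" if q: "q \<in> W" for j k q
  proof -
    note t = F.frame_tangent[OF q]
    have "F.ric j k q + F.hess \<phi> j k q = lam q * (if j = k then 1 else 0) + ?m / f q * F.hess f j k q"
      using ricci_hessian[OF F.W_top[OF q] t t, of j k]
      by (simp add: F.ricci_frame[OF q] F.hessian_frame[OF q sphi] F.hessian_frame[OF q sf] F.frame_inner[OF q])
    moreover have "f q \<noteq> 0" using f_pos[OF F.W_top[OF q]] by simp
    ultimately show ?thesis by (simp add: field_simps)
  qed
  have trace: "f q * (?S q + ?L\<phi> q) = ?n * (f q * lam q) + ?m * ?Lf q" if q: "q \<in> W" for q
  proof -
    have "(\<Sum>k\<in>UNIV. f q * F.ric k k q + f q * F.hess \<phi> k k q) = (\<Sum>k\<in>UNIV. f q * lam q + ?m * F.hess f k k q)"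
      by (simp add: eqn[OF q])
    then show ?thesis
      by (simp add: F.laplacian_frame[OF q sphi] F.laplacian_frame[OF q sf] sum.distrib sum_distrib_left distrib_left)
  qed
  have frame_case: "f p * f p * ((?n - 2) * E j p lam + E j p ?L\<phi> - E j p (inner_grad \<phi> \<phi>))
      + 2 * (f p * f p) * lam p * E j p \<phi> + 2 * ?m * f p * E j p (inner_grad \<phi> f)
    - ?m * (f p * E j p ?Lf + ?Lf p * E j p f + 2 * lam p * f p * E j p f
      + (?m - 1) * E j p (inner_grad f f)) = 0" for j
  proof -
    \<comment> \<open>\<open>R h\<close> is Ric(E_j, \<nabla>h) and \<open>H h h'\<close> is the
      Hessian of h on E_j and \<nabla>h', both at \<open>p\<close>.\<close>
    define R where "R h = (\<Sum>k\<in>UNIV. F.ric j k p * E k p h)" for h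
    define H where "H h h' = (\<Sum>k\<in>UNIV. F.hess h j k p * E k p h')" for h h'
    have contr: "f p * R h + f p * H \<phi> h = lam p * f p * E j p h + ?m * H f h" for h
    proof -
      have "(\<Sum>k\<in>UNIV. (f p * F.ric j k p + f p * F.hess \<phi> j k p) * E k p h) =
        (\<Sum>k\<in>UNIV. ((f p * lam p) * (if j = k then 1 else 0) + ?m * F.hess f j k p) * E k p h)"
        by (simp add: eqn[OF pW])
      then show ?thesis
        unfolding R_def H_def
        by (simp add: distrib_right sum.distrib sum_distrib_left mult.assoc mult.commute[of "lam p"]
            if_distrib[of "\<lambda>c. c * _"] if_distrib[of "\<lambda>c. _ * c"] cong: if_cong)
    qed
    have div: "R f + f p * (\<Sum>k\<in>UNIV. E k p (F.ric j k)) + H \<phi> f + f p * (\<Sum>k\<in>UNIV. E k p (F.hess \<phi> j k)) =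
      E j p f * lam p + f p * E j p lam + ?m * (\<Sum>k\<in>UNIV. E k p (F.hess f j k))"
    proof -
      have s: "smooth_fun A W (\<lambda>q. f q * lam q)" by (rule sm[OF sf slam])
      have "f p * E k p (F.ric j k) + E k p f * F.ric j k p + (f p * E k p (F.hess \<phi> j k) + E k p f * F.hess \<phi> j k p)
        = (f p * E k p lam + E k p f * lam p) * (if j = k then 1 else 0) + ?m * E k p (F.hess f j k)" for k
      proof -
        have "E k p (\<lambda>q. f q * F.ric j k q + f q * F.hess \<phi> j k q) =
          E k p (\<lambda>q. (f q * lam q) * (if j = k then 1 else 0) + ?m * F.hess f j k q)"
          by (rule F.frame_local) (rule eqn)
        also have "\<dots> = E k p (\<lambda>q. (f q * lam q) * (if j = k then 1 else 0)) + E k p (\<lambda>q. ?m * F.hess f j k q)"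
          by (rule Ea[OF sm[OF s smooth_fun_const] sm[OF smooth_fun_const hf]])
        also have "E k p (\<lambda>q. (f q * lam q) * (if j = k then 1 else 0)) =
          (f p * E k p lam + E k p f * lam p) * (if j = k then 1 else 0)"
          unfolding Em[OF s smooth_fun_const] Em[OF sf slam] E0 by simp
        also have "E k p (\<lambda>q. ?m * F.hess f j k q) = ?m * E k p (F.hess f j k)"
          unfolding Em[OF smooth_fun_const hf] E0 by simp
        finally show ?thesis
          unfolding Ea[OF sm[OF sf F.ric_smooth] sm[OF sf h\<phi>]] Em[OF sf F.ric_smooth] Em[OF sf h\<phi>] .
      qed
      then have "(\<Sum>k\<in>UNIV. f p * E k p (F.ric j k) + E k p f * F.ric j k p
          + (f p * E k p (F.hess \<phi> j k) + E k p f * F.hess \<phi> j k p))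
        = (\<Sum>k\<in>UNIV. (f p * E k p lam + E k p f * lam p) * (if j = k then 1 else 0) + ?m * E k p (F.hess f j k))"
        by simp
      then show ?thesis
        unfolding R_def H_def
        by (simp add: sum.distrib sum_distrib_left mult.commute[of "E _ p f"]
            if_distrib[of "\<lambda>c. _ * c"] cong: if_cong)
    qed
    have tr: "f p * (E j p ?S + E j p ?L\<phi>) + E j p f * (?S p + ?L\<phi> p) =
      ?n * (f p * E j p lam + E j p f * lam p) + ?m * E j p ?Lf"
    proof -
      have "E j p (\<lambda>q. f q * (?S q + ?L\<phi> q)) = E j p (\<lambda>q. ?n * (f q * lam q) + ?m * ?Lf q)"
        by (rule F.frame_local) (rule trace)
      then show ?thesis
        unfolding Em[OF sf sa[OF sS sL\<phi>]] Ea[OF sS sL\<phi>]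
          Ea[OF sm[OF smooth_fun_const sm[OF sf slam]] sm[OF smooth_fun_const sLf]]
          Em[OF smooth_fun_const sm[OF sf slam]] Em[OF smooth_fun_const sLf] Em[OF sf slam] E0 by simp
    qed
    note c1 = contr[of f] and c2 = contr[of \<phi>] and t0 = trace[OF pW]
    note d = div[unfolded F.hess_divergence[OF sf] F.hess_divergence[OF sphi], folded R_def]
    have b: "E j p ?S = 2 * (\<Sum>k\<in>UNIV. E k p (F.ric j k))" by (rule F.contracted_Bianchi)
    have g1: "E j p (inner_grad \<phi> \<phi>) = H \<phi> \<phi> + H \<phi> \<phi>" "E j p (inner_grad f f) = H f f + H f f"
      "E j p (inner_grad \<phi> f) = H \<phi> f + H f \<phi>"
      unfolding H_def using F.inner_gradient_derivative sf sphi by blast+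
    define dS where "dS = (\<Sum>k\<in>UNIV. E k p (F.ric j k))"
    \<comment> \<open>Pure elimination. The hypotheses are the contractions with \<nabla>f and
      \<nabla>\<phi>, the divergence after Bochner, the derivative of the trace after Bianchi, and
      the trace. Here \<open>s\<close> is the divergence of Ric; twice f times the third is reduced
      by the others, and the terms n f l fj cancel.\<close>
    have main: "f * f * ((n - 2) * lj + pj - (d + d)) + 2 * (f * f) * l * ej + 2 * m * f * (a + c)
        - m * (f * qj + Lf * fj + 2 * l * f * fj + (m - 1) * (b + b)) = 0"
      if "f * rf + f * a = l * f * fj + m * b" "f * rp + f * d = l * f * ej + m * c"
        "rf + f * s + a + f * (pj + rp) = fj * l + f * lj + m * (qj + rf)"
        "f * (2 * s + pj) + fj * (S + P) = n * (f * lj + fj * l) + m * qj"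
        "f * (S + P) = n * (f * l) + m * Lf"
      for f n lj pj d l ej m a c qj Lf fj b rf rp s S P :: real
      using that by algebra
    show ?thesis
      unfolding g1
      by (rule main[OF c1 c2 d[folded dS_def] tr[unfolded b, folded dS_def] t0])
  qed
  have exp: "v h = (\<Sum>j\<in>UNIV. g p v (E j p) * E j p h)" for h
    using fun_cong[OF F.frame_expansion[OF pW v], of h] .
  \<comment> \<open>Both sides are linear in the vector, so the frame case suffices; the functions
    are generic to keep the rearrangement small. \<open>h7\<close> occurs twice because f carries
    two coefficients.\<close>
  have lin: "a * a * (b * v h1 + v h2 - v h3) + c * v h4 + d * v h5 - m * (a * v h6 + k * v h7 + l * v h7 + r * v h8)
    = (\<Sum>j\<in>UNIV. g p v (E j p) * (a * a * (b * E j p h1 + E j p h2 - E j p h3) + c * E j p h4 + d * E j p h5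
      - m * (a * E j p h6 + k * E j p h7 + l * E j p h7 + r * E j p h8)))" for a b c d m k l r h1 h2 h3 h4 h5 h6 h7 h8
  proof -
    have "(\<Sum>j\<in>UNIV. g p v (E j p) * (a * a * (b * E j p h1 + E j p h2 - E j p h3) + c * E j p h4 + d * E j p h5
      - m * (a * E j p h6 + k * E j p h7 + l * E j p h7 + r * E j p h8)))
      = (\<Sum>j\<in>UNIV. a * a * (b * (g p v (E j p) * E j p h1) + g p v (E j p) * E j p h2 - g p v (E j p) * E j p h3)
        + c * (g p v (E j p) * E j p h4) + d * (g p v (E j p) * E j p h5)
        - m * (a * (g p v (E j p) * E j p h6) + k * (g p v (E j p) * E j p h7)
          + l * (g p v (E j p) * E j p h7) + r * (g p v (E j p) * E j p h8)))"
      by (rule sum.cong[OF refl]) (simp add: algebra_simps)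
    also have "\<dots> = a * a * (b * v h1 + v h2 - v h3) + c * v h4 + d * v h5
        - m * (a * v h6 + k * v h7 + l * v h7 + r * v h8)"
      unfolding exp[of h1] exp[of h2] exp[of h3] exp[of h4] exp[of h5] exp[of h6] exp[of h7] exp[of h8]
      by (simp only: sum_subtractf sum.distrib sum_distrib_left[symmetric])
    finally show ?thesis by simp
  qed
  show ?thesis
    using lin[of "f p" "?n - 2" lam ?L\<phi> "inner_grad \<phi> \<phi>" "2 * (f p * f p) * lam p" \<phi> "2 * ?m * f p" "inner_grad \<phi> f"
        ?m ?Lf "?Lf p" f "2 * lam p * f p" "?m - 1" "inner_grad f f"]
    by (simp only: frame_case) simp
qed

text \<open>\<open>divergence_identity\<close> with the non-exact term moved to the left says \<Sum>
  a_i db_i = dK; its exterior derivative is evaluated through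
  \<open>exact_form_closed\<close>.\<close>

lemma wedge_identity:
  assumes p: "p \<in> topspace M" and v: "v \<in> tangent_space M A p" and w: "w \<in> tangent_space M A p"
  shows "f p * wedge (differential \<phi> p) (differential lam p) v w =
    wedge (differential f p)
      (\<lambda>z. (real CARD('n) + real m - 2) * differential lam p z
         + real m / f p * differential (inner_grad \<phi> f) p z
         - differential (inner_grad \<phi> \<phi>) p z
         + 2 * lam p * differential \<phi> p z
         + differential (laplacian M A g D \<phi>) p z) v w"
proof -
  obtain W and E :: "'n \<Rightarrow> 'a vfield" where fr: "normal_orthonormal_frame M A g D p W E"
    by (rule normal_orthonormal_frame_exists[OF p])
  interpret F: normal_orthonormal_frame M A g D p W E by (rule fr)
  note W = F.W_open and pW = F.p_in_W
  have sub: "W \<subseteq> topspace M" using W openin_subset by blast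
  note sf = smooth_fun_subset[OF f_smooth sub] and sphi = smooth_fun_subset[OF phi_smooth sub]
    and slam = smooth_fun_subset[OF lam_smooth sub]
  note sc = smooth_fun_const and sm = smooth_fun_mult[OF W] and sa = smooth_fun_add[OF W]
    and sd = smooth_fun_diff[OF W]
  note sLf = F.laplacian_smooth[OF sf] and sL\<phi> = F.laplacian_smooth[OF sphi]
  note sN = F.inner_gradient_smooth[OF sphi sphi] and sQ = F.inner_gradient_smooth[OF sf sf]
    and sG = F.inner_gradient_smooth[OF sphi sf]
  let ?n = "real CARD('n)" and ?m = "real m"
  let ?Lf = "laplacian M A g D f" and ?L\<phi> = "laplacian M A g D \<phi>"
  \<comment> \<open>\<open>B\<close> gathers the functions whose differentials share the coefficient
    f^2, and \<open>K\<close> is the potential of the exact part.\<close>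
  define B where "B q = (?n - 2) * lam q + ?L\<phi> q - inner_grad \<phi> \<phi> q" for q
  define K where "K q = ?m * (f q * ?Lf q + (?m - 1) * inner_grad f f q)" for q
  note sB1 = sm[OF sc[of W "?n - 2"] slam]
  have sB: "smooth_fun A W B" unfolding B_def by (intro sd sa sB1 sL\<phi> sN)
  note sK1 = sm[OF sf sLf] and sK2 = sm[OF sc[of W "?m - 1"] sQ]
  have sK: "smooth_fun A W K" unfolding K_def by (intro sm[OF sc] sa sK1 sK2)
  \<comment> \<open>The last pair, -2m \<lambda> f with f, is the non-exact term. It contributes -2m
    f d\<lambda> \<and> df, which after division by 2f is the additional m df \<and>
    d\<lambda>.\<close>
  define a :: "nat \<Rightarrow> 'a \<Rightarrow> real" where "a = (!) [\<lambda>q. f q * f q, \<lambda>q. 2 * ((f q * f q) * lam q),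
    \<lambda>q. (2 * ?m) * f q, \<lambda>q. (- 2 * ?m) * (lam q * f q)]"
  define b :: "nat \<Rightarrow> 'a \<Rightarrow> real" where "b = (!) [B, \<phi>, inner_grad \<phi> f, f]"
  have I: "{..<4} = {0, 1, 2, 3 :: nat}" by auto
  have a: "smooth_fun A W (a i)" if "i \<in> {..<4}" for i
    using that sm[OF sc[of W "- 2 * ?m"] sm[OF slam sf]] unfolding I a_def
    by (auto intro!: sm sc sf slam)
  have b: "smooth_fun A W (b i)" if "i \<in> {..<4}" for i
    using that unfolding I b_def by (auto intro!: sB sphi sG sf)
  have Bq: "Z q B = (?n - 2) * Z q lam + Z q ?L\<phi> - Z q (inner_grad \<phi> \<phi>)"
    and Kq: "Z q K = ?m * (f q * Z q ?Lf + Z q f * ?Lf q + (?m - 1) * Z q (inner_grad f f))"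
    if Z: "vector_field M A W Z" and q: "q \<in> W" for Z q
  proof -
    have c: "Z q (\<lambda>r. c) = 0" for c
      by (rule tangent_const[OF vector_field_tangent[OF Z q] F.W_top[OF q]])
    note Zm = vector_field_scalar_mult[OF Z W q] and Za = vector_field_scalar_add[OF Z W q]
      and Zd = vector_field_scalar_diff[OF Z W q]
    show "Z q B = (?n - 2) * Z q lam + Z q ?L\<phi> - Z q (inner_grad \<phi> \<phi>)"
      unfolding B_def[abs_def] Zd[OF sa[OF sB1 sL\<phi>] sN] Za[OF sB1 sL\<phi>] Zm[OF sc slam] c by simp
    show "Z q K = ?m * (f q * Z q ?Lf + Z q f * ?Lf q + (?m - 1) * Z q (inner_grad f f))"
      unfolding K_def[abs_def] Zm[OF sc sa[OF sK1 sK2]] Za[OF sK1 sK2] Zm[OF sf sLf] Zm[OF sc sQ] c by simp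
  qed
  have eq: "(\<Sum>i<4. a i q * Z q (b i)) = Z q K" if Z: "vector_field M A W Z" and q: "q \<in> W" for Z q
    using divergence_identity[OF F.W_top[OF q] vector_field_tangent[OF Z q]]
    unfolding I a_def b_def by (simp add: Bq[OF Z q] Kq[OF Z q] algebra_simps)
  obtain X where X: "vector_field M A W X" "X p = v" using F.frame_extension[OF pW v] .
  obtain Y where Y: "vector_field M A W Y" "Y p = w" using F.frame_extension[OF pW w] .
  have closed: "(\<Sum>i<4. X p (a i) * Y p (b i) - Y p (a i) * X p (b i)) = 0"
    by (rule exact_form_closed[OF W pW X(1) Y(1), where k = K]) (simp_all only: finite_lessThan a b sK eq)
  have da: "z (a 0) = 2 * f p * z f" "z (a 1) = 2 * (2 * f p * z f * lam p + f p * f p * z lam)"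
    "z (a 2) = 2 * ?m * z f" "z (a 3) = - 2 * ?m * (lam p * z f + z lam * f p)"
    if z: "vector_field M A W Z" "Z p = z" for Z z
  proof -
    note Zm = vector_field_scalar_mult[OF z(1) W pW, unfolded z(2)]
    have c: "z (\<lambda>r. c) = 0" for c
      using tangent_const[OF vector_field_tangent[OF z(1) pW] p] z(2) by simp
    show "z (a 0) = 2 * f p * z f" unfolding a_def by (simp add: Zm[OF sf sf])
    show "z (a 1) = 2 * (2 * f p * z f * lam p + f p * f p * z lam)"
    proof -
      have "z (a 1) = z (\<lambda>q. 2 * ((f q * f q) * lam q))" by (simp add: a_def)
      also have "\<dots> = 2 * (2 * f p * z f * lam p + f p * f p * z lam)"
        unfolding Zm[OF sc sm[OF sm[OF sf sf] slam]] Zm[OF sm[OF sf sf] slam] Zm[OF sf sf] c by simp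
      finally show ?thesis .
    qed
    show "z (a 2) = 2 * ?m * z f" unfolding a_def by (simp add: Zm[OF sc sf] c)
    show "z (a 3) = - 2 * ?m * (lam p * z f + z lam * f p)"
    proof -
      have "z (a 3) = z (\<lambda>q. (- 2 * ?m) * (lam q * f q))" by (simp add: a_def)
      also have "\<dots> = - 2 * ?m * (lam p * z f + z lam * f p)"
        unfolding Zm[OF sc sm[OF slam sf]] Zm[OF slam sf] c by simp
      finally show ?thesis .
    qed
  qed
  have b': "b 0 = B" "b 1 = \<phi>" "b 2 = inner_grad \<phi> f" "b 3 = f" unfolding b_def by simp_all
  have fp: "f p \<noteq> 0" using f_pos[OF p] by simp
  \<comment> \<open>Naming the quotient leaves a polynomial relation, so that the rearrangement can
    be settled by \<open>algebra\<close>.\<close>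
  define \<mu> where "\<mu> = ?m / f p"
  have \<mu>: "\<mu> * f p = ?m" using fp by (simp add: \<mu>_def)
  have "2 * f p * (f p * (v \<phi> * w lam - v lam * w \<phi>)) =
    2 * f p * (v f * ((?n + ?m - 2) * w lam + \<mu> * w (inner_grad \<phi> f) - w (inner_grad \<phi> \<phi>) + 2 * lam p * w \<phi> + w ?L\<phi>)
    - ((?n + ?m - 2) * v lam + \<mu> * v (inner_grad \<phi> f) - v (inner_grad \<phi> \<phi>) + 2 * lam p * v \<phi> + v ?L\<phi>) * w f)"
  proof -
    have "(X p (a 0) * Y p (b 0) - Y p (a 0) * X p (b 0)) + (X p (a 1) * Y p (b 1) - Y p (a 1) * X p (b 1))
      + (X p (a 2) * Y p (b 2) - Y p (a 2) * X p (b 2)) + (X p (a 3) * Y p (b 3) - Y p (a 3) * X p (b 3)) = 0"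
      using closed unfolding I by simp
    then show ?thesis
      unfolding b' X(2) Y(2) da[OF X] da[OF Y] Bq[OF X(1) pW, unfolded X(2)] Bq[OF Y(1) pW, unfolded Y(2)]
      using \<mu> by algebra
  qed
  then show ?thesis
    using fp unfolding wedge_def differential_def \<mu>_def by simp
qed

end

theorem proposition1:
  fixes M :: "'a topology" and A :: "('a, 'n::finite) chart set"
    and g :: "'a \<Rightarrow> 'a tangent \<Rightarrow> 'a tangent \<Rightarrow> real"
    and D :: "'a vfield \<Rightarrow> 'a vfield \<Rightarrow> 'a vfield"
    and f \<phi> lam :: "'a \<Rightarrow> real" and m :: nat
  assumes "ricci_hessian_manifold M A g D f \<phi> lam m"
  shows "(\<forall>p\<in>topspace M. \<forall>v\<in>tangent_space M A p. \<forall>w\<in>tangent_space M A p.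
      f p * wedge (differential \<phi> p) (differential lam p) v w =
      wedge (differential f p)
        (\<lambda>z. (real CARD('n) + real m - 2) * differential lam p z
           + real m / f p * differential (\<lambda>q. g q (gradient M A g \<phi> q) (gradient M A g f q)) p z
           - differential (\<lambda>q. g q (gradient M A g \<phi> q) (gradient M A g \<phi> q)) p z
           + 2 * lam p * differential \<phi> p z
           + differential (laplacian M A g D \<phi>) p z) v w) \<and>
    (\<forall>p\<in>topspace M. \<forall>u\<in>tangent_space M A p. \<forall>v\<in>tangent_space M A p. \<forall>w\<in>tangent_space M A p.
      wedge2 (differential f p) (wedge (differential \<phi> p) (differential lam p)) u v w = 0)"
proof -
  interpret ricci_hessian_manifold M A g D f \<phi> lam m by (rule assms)
  have "wedge2 (differential f p) (wedge (differential \<phi> p) (differential lam p)) u v w = 0"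
    if p: "p \<in> topspace M" and u: "u \<in> tangent_space M A p" and v: "v \<in> tangent_space M A p"
      and w: "w \<in> tangent_space M A p" for p u v w
  proof -
    let ?\<omega> = "wedge (differential \<phi> p) (differential lam p)"
    \<comment> \<open>Only the shape df \<and> \<alpha> matters from here: its product with df
      cancels term by term in the values of df and \<alpha>.\<close>
    obtain \<alpha> where \<alpha>: "\<And>v w. v \<in> tangent_space M A p \<Longrightarrow> w \<in> tangent_space M A p \<Longrightarrow>
        f p * ?\<omega> v w = wedge (differential f p) \<alpha> v w"
      using wedge_identity[OF p] by blast
    have "f p * wedge2 (differential f p) ?\<omega> u v w =
        differential f p u * (f p * ?\<omega> v w) - differential f p v * (f p * ?\<omega> u w)
        + differential f p w * (f p * ?\<omega> u v)"
      by (simp add: wedge2_def algebra_simps)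
    also have "\<dots> = 0"
      unfolding \<alpha>[OF v w] \<alpha>[OF u w] \<alpha>[OF u v] by (simp add: wedge_def algebra_simps)
    finally show ?thesis using f_pos[OF p] by simp
  qed
  then show ?thesis using wedge_identity by blast
qed

end
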